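(* Let $A$ be a $\sigma$-unital C*-algebra and let $\mathcal{E}$ be a faithful, non-degenerate, full, countably generated C*-correspondence over $A$. Let $\mathbb{K}=\mathbb{K}(\ell^2(\mathbb{N}))$. Then there is a $*$-homomorphism $\rho\colon A\otimes\mathbb{K}\to\mathcal{M}(A\otimes\mathbb{K})$ such that the exterior tensor product $\mathcal{E}\otimes\mathbb{K}$ is isomorphic, as a C*-correspondence over $A\otimes\mathbb{K}$, to ${}_\rho(A\otimes\mathbb{K})$.
   Context: A C*-correspondence $\mathcal{E}$ over $A$ is a right Hilbert $A$-module together with a $*$-homomorphism (left action) $A\to\mathbb{B}(\mathcal{E})$ into the adjointable operators. It is faithful if the left action is injective, non-degenerate if $A\cdot\mathcal{E}$ is dense in $\mathcal{E}$, full if the range of the $A$-valued inner product is total in $A$. $\mathcal{M}(\cdot)$ denotes the multiplier algebra. For a $*$-homomorphism $\rho\colon B\to\mathcal{M}(B)$, ${}_\rho B$ denotes the C*-correspondence over $B$ which is $B$ as a standard right Hilbert $B$-module ($\langle x,y\rangle=x^*y$), with left action $b\cdot x=\rho(b)x$. $\mathbb{K}$ is regarded as a C*-correspondence over itself in the standard way, and $\mathcal{E}\otimes\mathbb{K}$ is the exterior tensor product, a C*-correspondence over the minimal tensor product $A\otimes\mathbb{K}$. *)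

theory Defs
  imports "HOL-Analysis.Analysis"
begin

section \<open>Complex vector spaces and C*-algebras\<close>

class scaleC =
  fixes scaleC :: "complex \<Rightarrow> 'a \<Rightarrow> 'a"  (infixr "*\<^sub>C" 75)

class complex_vector = real_vector + scaleC +
  assumes scaleC_add_right: "c *\<^sub>C (x + y) = c *\<^sub>C x + c *\<^sub>C y"
    and scaleC_add_left: "(c + d) *\<^sub>C x = c *\<^sub>C x + d *\<^sub>C x"
    and scaleC_scaleC: "c *\<^sub>C d *\<^sub>C x = (c * d) *\<^sub>C x"
    and scaleR_scaleC: "r *\<^sub>R x = complex_of_real r *\<^sub>C x"

class complex_normed_vector = complex_vector + real_normed_vector +
  assumes norm_scaleC: "norm (c *\<^sub>C x) = cmod c * norm x"

class cbanach = complex_normed_vector + complete_space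

subclass (in cbanach) banach ..

class star =
  fixes star :: "'a \<Rightarrow> 'a"

class star_algebra = complex_vector + ring + star +
  assumes mult_scaleC_left: "(c *\<^sub>C x) * y = c *\<^sub>C (x * y)"
    and mult_scaleC_right: "x * (c *\<^sub>C y) = c *\<^sub>C (x * y)"
    and star_add: "star (x + y) = star x + star y"
    and star_scaleC: "star (c *\<^sub>C x) = cnj c *\<^sub>C star x"
    and star_mult: "star (x * y) = star y * star x"
    and star_star: "star (star x) = x"

subclass (in star_algebra) real_algebra
  by standard (simp_all add: scaleR_scaleC mult_scaleC_left mult_scaleC_right)

class cstar_algebra = star_algebra + cbanach + real_normed_algebra +
  assumes cstar_identity: "norm (star x * x) = (norm x)\<^sup>2"

lemma scaleC_one: "1 *\<^sub>C x = (x :: 'a::complex_vector)"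
  by (metis scaleR_scaleC scaleR_one of_real_1)

global_interpretation complex_vector: vector_space "scaleC :: complex \<Rightarrow> 'a \<Rightarrow> 'a::complex_vector"
  by unfold_locales (simp_all add: scaleC_add_right scaleC_add_left scaleC_scaleC scaleC_one)

abbreviation clinear :: "('a::complex_vector \<Rightarrow> 'b::complex_vector) \<Rightarrow> bool"
  where "clinear \<equiv> Vector_Spaces.linear scaleC scaleC"

abbreviation cspan :: "'a::complex_vector set \<Rightarrow> 'a set"
  where "cspan \<equiv> complex_vector.span"

lemma clinear_iff:
  "clinear f \<longleftrightarrow> (\<forall>x y. f (x + y) = f x + f y) \<and> (\<forall>c x. f (c *\<^sub>C x) = c *\<^sub>C f x)"
  unfolding Vector_Spaces.linear_def module_hom_iff module_hom_axioms_def
  by (simp add: complex_vector.vector_space_axioms complex_vector.module_axioms)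

lemma norm_star: "norm (star x) = norm (x :: 'a::cstar_algebra)"
proof -
  have *: "norm y \<le> norm (star y)" for y :: 'a
  proof (cases "y = 0")
    case False
    have "(norm y)\<^sup>2 \<le> norm (star y) * norm y"
      using norm_mult_ineq[of "star y" y] by (simp add: cstar_identity)
    then show ?thesis
      using False by (simp add: power2_eq_square)
  qed simp
  show ?thesis
    using *[of x] *[of "star x"] by (simp add: star_star)
qed

lemma star_zero: "star 0 = (0 :: 'a::star_algebra)"
  using star_add[of 0 "0::'a"] by simp

lemma star_minus: "star (- x) = - star (x :: 'a::star_algebra)"
  using star_add[of x "- x"] by (simp add: star_zero eq_neg_iff_add_eq_0 add.commute)

lemma star_diff: "star (x - y) = star x - star (y :: 'a::star_algebra)"
  using star_add[of x "- y"] by (simp add: star_minus)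

lemma star_scaleR: "star (r *\<^sub>R x) = r *\<^sub>R star (x :: 'a::star_algebra)"
  by (simp add: scaleR_scaleC star_scaleC)

lemma bounded_linear_star: "bounded_linear (star :: 'a::cstar_algebra \<Rightarrow> 'a)"
  by (rule bounded_linear_intro[where K=1]) (simp_all add: star_add star_scaleR norm_star)

lemma bounded_linear_scaleC: "bounded_linear (\<lambda>x :: 'a::complex_normed_vector. c *\<^sub>C x)"
proof (rule bounded_linear_intro[where K="cmod c"])
  show "norm (c *\<^sub>C x) \<le> norm x * cmod c" for x :: 'a
    by (simp add: norm_scaleC mult.commute)
qed (simp_all add: scaleC_add_right scaleR_scaleC scaleC_scaleC mult.commute)

section \<open>The Hilbert space of square-summable sequences\<close>

typedef ell2 = "{x :: nat \<Rightarrow> complex. summable (\<lambda>n. (cmod (x n))\<^sup>2)}"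
  morphisms coord Abs_ell2
  by (rule exI[of _ "\<lambda>_. 0"]) simp

setup_lifting type_definition_ell2

lemma ell2_sqrt_bound:
  assumes "\<And>N. L2_set (\<lambda>n. cmod (f n)) {..<N} \<le> b"
  shows "summable (\<lambda>n. (cmod (f n))\<^sup>2)" "sqrt (\<Sum>n. (cmod (f n))\<^sup>2) \<le> b"
proof -
  have b: "0 \<le> b" using assms[of 0] by simp
  have le: "(\<Sum>n<N. (cmod (f n))\<^sup>2) \<le> b\<^sup>2" for N
    using assms[of N] b unfolding L2_set_def by (metis real_sqrt_le_iff real_sqrt_unique)
  show s: "summable (\<lambda>n. (cmod (f n))\<^sup>2)"
    by (rule summableI_nonneg_bounded[OF _ le]) simp
  show "sqrt (\<Sum>n. (cmod (f n))\<^sup>2) \<le> b"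
    using suminf_le_const[OF s le] b by (simp add: real_le_lsqrt suminf_nonneg[OF s])
qed

lemma ell2_L2_set_le:
  assumes "summable (\<lambda>n. (cmod (f n))\<^sup>2)"
  shows "L2_set (\<lambda>n. cmod (f n)) {..<N} \<le> sqrt (\<Sum>n. (cmod (f n))\<^sup>2)"
  unfolding L2_set_def using sum_le_suminf[OF assms, of "{..<N}"] by simp

lemma ell2_add_bound:
  assumes "summable (\<lambda>n. (cmod (f n))\<^sup>2)" "summable (\<lambda>n. (cmod (g n))\<^sup>2)"
  shows "L2_set (\<lambda>n. cmod (f n + g n)) {..<N}
    \<le> sqrt (\<Sum>n. (cmod (f n))\<^sup>2) + sqrt (\<Sum>n. (cmod (g n))\<^sup>2)"
proof -
  have "L2_set (\<lambda>n. cmod (f n + g n)) {..<N} \<le> L2_set (\<lambda>n. cmod (f n) + cmod (g n)) {..<N}"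
    by (rule L2_set_mono) (auto simp: norm_triangle_ineq)
  also have "\<dots> \<le> L2_set (\<lambda>n. cmod (f n)) {..<N} + L2_set (\<lambda>n. cmod (g n)) {..<N}"
    by (rule L2_set_triangle_ineq)
  finally show ?thesis
    using ell2_L2_set_le[OF assms(1), of N] ell2_L2_set_le[OF assms(2), of N] by linarith
qed

lemma ell2_scale: 
  assumes "summable (\<lambda>n. (cmod (f n))\<^sup>2)"
  shows "summable (\<lambda>n. (cmod (c * f n))\<^sup>2)"
    "sqrt (\<Sum>n. (cmod (c * f n))\<^sup>2) = cmod c * sqrt (\<Sum>n. (cmod (f n))\<^sup>2)"
  using summable_mult[OF assms, of "(cmod c)\<^sup>2"] suminf_mult[OF assms, of "(cmod c)\<^sup>2"]
  by (simp_all add: norm_mult power_mult_distrib real_sqrt_mult)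

instantiation ell2 :: complex_vector
begin
lift_definition zero_ell2 :: ell2 is "\<lambda>_. 0" by simp
lift_definition plus_ell2 :: "ell2 \<Rightarrow> ell2 \<Rightarrow> ell2" is "\<lambda>x y n. x n + y n"
  by (rule ell2_sqrt_bound(1)[OF ell2_add_bound])
lift_definition uminus_ell2 :: "ell2 \<Rightarrow> ell2" is "\<lambda>x n. - x n" by simp
lift_definition scaleC_ell2 :: "complex \<Rightarrow> ell2 \<Rightarrow> ell2" is "\<lambda>c x n. c * x n"
  by (rule ell2_scale)
definition minus_ell2 :: "ell2 \<Rightarrow> ell2 \<Rightarrow> ell2" where "minus_ell2 x y = x + - y"
definition scaleR_ell2 :: "real \<Rightarrow> ell2 \<Rightarrow> ell2" where "scaleR_ell2 r x = complex_of_real r *\<^sub>C x"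
instance
  by standard (unfold minus_ell2_def scaleR_ell2_def, (transfer, simp add: algebra_simps)+)
end

instantiation ell2 :: complex_normed_vector
begin
lift_definition norm_ell2 :: "ell2 \<Rightarrow> real" is "\<lambda>x. sqrt (\<Sum>n. (cmod (x n))\<^sup>2)" .
definition "dist_ell2 x y = norm (x - y :: ell2)"
definition "sgn_ell2 x = x /\<^sub>R norm (x :: ell2)"
definition [code del]:
  "(uniformity :: (ell2 \<times> ell2) filter) = (INF e\<in>{0<..}. principal {(x, y). dist x y < e})"
definition [code del]:
  "open (S :: ell2 set) = (\<forall>x\<in>S. \<forall>\<^sub>F (x', y) in uniformity. x' = x \<longrightarrow> y \<in> S)"
instance
proof
  fix x y :: ell2 and r :: real and c :: complex and S :: "ell2 set"
  show "dist x y = norm (x - y)" by (rule dist_ell2_def)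
  show "sgn x = x /\<^sub>R norm x" by (rule sgn_ell2_def)
  show "(uniformity :: (ell2 \<times> ell2) filter) = (INF e\<in>{0<..}. principal {(x, y). dist x y < e})"
    by (rule uniformity_ell2_def)
  show "open S = (\<forall>x\<in>S. \<forall>\<^sub>F (x', y) in uniformity. x' = x \<longrightarrow> y \<in> S)"
    by (rule open_ell2_def)
  show "norm x = 0 \<longleftrightarrow> x = 0"
    by transfer (simp add: suminf_eq_zero_iff fun_eq_iff)
  show "norm (x + y) \<le> norm x + norm y"
    by transfer (rule ell2_sqrt_bound(2)[OF ell2_add_bound])
  show c: "norm (c *\<^sub>C x) = cmod c * norm x" for c
    by transfer (rule ell2_scale(2))
  show "norm (r *\<^sub>R x) = \<bar>r\<bar> * norm x"
    by (simp add: scaleR_ell2_def c)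
qed
end

lemma ell2_coord_le: "cmod (coord x n) \<le> norm x"
proof -
  have "cmod (coord x n) \<le> L2_set (\<lambda>n. cmod (coord x n)) {..<Suc n}"
    by (rule member_le_L2_set) auto
  also have "\<dots> \<le> norm x"
    unfolding norm_ell2.rep_eq using coord[of x] by (intro ell2_L2_set_le) simp
  finally show ?thesis .
qed

lemma coord_diff: "coord (x - y) n = coord x n - coord y n"
  unfolding minus_ell2_def plus_ell2.rep_eq uminus_ell2.rep_eq by simp

lemma ell2_summable: "summable (\<lambda>n. (cmod (coord x n))\<^sup>2)"
  using coord[of x] by simp

lemma ell2_L2_set_le_norm: "L2_set (\<lambda>n. cmod (coord x n)) {..<N} \<le> norm x"
  unfolding norm_ell2.rep_eq by (intro ell2_L2_set_le ell2_summable)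

lemma ell2_norm_le:
  assumes "\<And>N. L2_set (\<lambda>n. cmod (coord x n)) {..<N} \<le> b"
  shows "norm x \<le> b"
  unfolding norm_ell2.rep_eq by (rule ell2_sqrt_bound(2)[OF assms])

instance ell2 :: cbanach
proof
  fix X :: "nat \<Rightarrow> ell2"
  assume X: "Cauchy X"
  have "Cauchy (\<lambda>k. coord (X k) n)" for n
    unfolding Cauchy_def dist_norm
  proof (intro allI impI)
    fix e :: real assume "0 < e"
    then obtain M where M: "\<forall>m\<ge>M. \<forall>k\<ge>M. norm (X m - X k) < e"
      using X unfolding Cauchy_def dist_norm by blast
    then show "\<exists>M. \<forall>m\<ge>M. \<forall>k\<ge>M. cmod (coord (X m) n - coord (X k) n) < e"
      using ell2_coord_le[of "X _ - X _" n] by (metis coord_diff le_less_trans)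
  qed
  then have f: "(\<lambda>k. coord (X k) n) \<longlonglongrightarrow> f n" if "f = (\<lambda>n. lim (\<lambda>k. coord (X k) n))" for n f
    unfolding that by (simp add: Cauchy_convergent convergent_LIMSEQ_iff[symmetric])
  define f where "f = (\<lambda>n. lim (\<lambda>k. coord (X k) n))"
  note f = f[OF f_def]
  obtain B where B: "\<And>k. norm (X k) \<le> B"
    using Cauchy_Bseq[OF X] unfolding Bseq_def by blast
  have lim: "(\<lambda>k. L2_set (\<lambda>n. cmod (g n - coord (X k) n)) {..<N}) \<longlonglongrightarrow> L2_set (\<lambda>n. cmod (g n - f n)) {..<N}" for g N
    unfolding L2_set_def by (intro tendsto_intros f)
  have lim0: "(\<lambda>k. L2_set (\<lambda>n. cmod (coord (X k) n)) {..<N}) \<longlonglongrightarrow> L2_set (\<lambda>n. cmod (f n)) {..<N}" for N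
    unfolding L2_set_def by (intro tendsto_intros f)
  have "L2_set (\<lambda>n. cmod (f n)) {..<N} \<le> B" for N
    by (rule LIMSEQ_le_const2[OF lim0]) (use ell2_L2_set_le_norm B order_trans in blast)
  then have "summable (\<lambda>n. (cmod (f n))\<^sup>2)" by (rule ell2_sqrt_bound(1))
  then have F: "coord (Abs_ell2 f) = f" by (simp add: Abs_ell2_inverse)
  have "X \<longlonglongrightarrow> Abs_ell2 f"
    unfolding LIMSEQ_iff
  proof (intro allI impI)
    fix e :: real assume "0 < e"
    then obtain M where M: "\<forall>m\<ge>M. \<forall>k\<ge>M. norm (X m - X k) < e / 2"
      using X unfolding Cauchy_def dist_norm by (meson half_gt_zero)
    have "norm (X m - Abs_ell2 f) \<le> e / 2" if m: "m \<ge> M" for m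
    proof (rule ell2_norm_le)
      fix N
      have "L2_set (\<lambda>n. cmod (coord (X m) n - f n)) {..<N} \<le> e / 2"
      proof (rule LIMSEQ_le_const2[OF lim], intro exI[of _ M] allI impI)
        fix k assume "M \<le> k"
        then have "norm (X m - X k) \<le> e / 2" using M m by (simp add: less_imp_le)
        then show "L2_set (\<lambda>n. cmod (coord (X m) n - coord (X k) n)) {..<N} \<le> e / 2"
          using ell2_L2_set_le_norm[of "X m - X k" N] by (simp add: coord_diff)
      qed
      then show "L2_set (\<lambda>n. cmod (coord (X m - Abs_ell2 f) n)) {..<N} \<le> e / 2"
        by (simp add: coord_diff F)
    qed
    then show "\<exists>M. \<forall>m\<ge>M. norm (X m - Abs_ell2 f) < e"
      using \<open>0 < e\<close> by (intro exI[of _ M]) fastforce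
  qed
  then show "convergent X" by (rule convergentI)
qed

definition cinner_ell2 :: "ell2 \<Rightarrow> ell2 \<Rightarrow> complex"
  where "cinner_ell2 x y = (\<Sum>n. cnj (coord x n) * coord y n)"

lemma cinner_ell2_summable: "summable (\<lambda>n. cnj (coord x n) * coord y n)"
proof (rule summable_comparison_test)
  have "norm (cnj (coord x n) * coord y n) \<le> (cmod (coord x n))\<^sup>2 + (cmod (coord y n))\<^sup>2" for n
    using sum_squares_bound[of "cmod (coord x n)" "cmod (coord y n)"]
      mult_nonneg_nonneg[OF norm_ge_zero norm_ge_zero, of "coord x n" "coord y n"]
    unfolding norm_mult complex_mod_cnj by linarith
  then show "\<exists>N. \<forall>n\<ge>N. norm (cnj (coord x n) * coord y n) \<le> (cmod (coord x n))\<^sup>2 + (cmod (coord y n))\<^sup>2"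
    by blast
  show "summable (\<lambda>n. (cmod (coord x n))\<^sup>2 + (cmod (coord y n))\<^sup>2)"
    by (intro summable_add ell2_summable)
qed

lemma cinner_ell2_add_right: "cinner_ell2 x (y + z) = cinner_ell2 x y + cinner_ell2 x z"
  unfolding cinner_ell2_def
  by (subst suminf_add[OF cinner_ell2_summable cinner_ell2_summable])
     (simp add: plus_ell2.rep_eq algebra_simps)

lemma cinner_ell2_scaleC_right: "cinner_ell2 x (c *\<^sub>C y) = c * cinner_ell2 x y"
  unfolding cinner_ell2_def
  by (subst suminf_mult[OF cinner_ell2_summable, symmetric])
     (simp add: scaleC_ell2.rep_eq algebra_simps)

lemma cinner_ell2_commute: "cinner_ell2 y x = cnj (cinner_ell2 x y)"
proof -
  have "(\<lambda>n. cnj (cnj (coord x n) * coord y n)) sums cnj (cinner_ell2 x y)"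
    unfolding cinner_ell2_def sums_cnj by (rule summable_sums[OF cinner_ell2_summable])
  then show ?thesis
    unfolding cinner_ell2_def by (simp add: mult.commute sums_iff)
qed

lemma cinner_ell2_add_left: "cinner_ell2 (x + y) z = cinner_ell2 x z + cinner_ell2 y z"
  by (subst (1 2 3) cinner_ell2_commute) (simp add: cinner_ell2_add_right)

lemma cinner_ell2_scaleC_left: "cinner_ell2 (c *\<^sub>C x) y = cnj c * cinner_ell2 x y"
  by (subst (1 2) cinner_ell2_commute) (simp add: cinner_ell2_scaleC_right)

lemma cinner_ell2_self: "cinner_ell2 x x = complex_of_real ((norm x)\<^sup>2)"
proof -
  have "(\<lambda>n. complex_of_real ((cmod (coord x n))\<^sup>2)) sums complex_of_real (\<Sum>n. (cmod (coord x n))\<^sup>2)"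
    by (intro sums_of_real summable_sums ell2_summable)
  moreover have "cnj (coord x n) * coord x n = complex_of_real ((cmod (coord x n))\<^sup>2)" for n
    using complex_norm_square[of "coord x n"] by (simp add: mult.commute)
  ultimately show ?thesis
    unfolding cinner_ell2_def norm_ell2.rep_eq
    by (simp add: sums_unique[symmetric] suminf_nonneg ell2_summable)
qed

lemma cinner_ell2_Cauchy_Schwarz: "cmod (cinner_ell2 x y) \<le> norm x * norm y"
proof (rule LIMSEQ_le_const2)
  show "(\<lambda>N. cmod (\<Sum>n<N. cnj (coord x n) * coord y n)) \<longlonglongrightarrow> cmod (cinner_ell2 x y)"
    unfolding cinner_ell2_def by (intro tendsto_norm summable_LIMSEQ cinner_ell2_summable)
  have "cmod (\<Sum>n<N. cnj (coord x n) * coord y n) \<le> norm x * norm y" for N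
  proof -
    have "cmod (\<Sum>n<N. cnj (coord x n) * coord y n) \<le> (\<Sum>n<N. \<bar>cmod (coord x n)\<bar> * \<bar>cmod (coord y n)\<bar>)"
      by (rule order_trans[OF norm_sum]) (simp add: norm_mult)
    also have "\<dots> \<le> L2_set (\<lambda>n. cmod (coord x n)) {..<N} * L2_set (\<lambda>n. cmod (coord y n)) {..<N}"
      by (rule L2_set_mult_ineq)
    also have "\<dots> \<le> norm x * norm y"
      by (intro mult_mono ell2_L2_set_le_norm) simp_all
    finally show ?thesis .
  qed
  then show "\<exists>N. \<forall>n\<ge>N. cmod (\<Sum>n<n. cnj (coord x n) * coord y n) \<le> norm x * norm y" by blast
qed

lemma cinner_ell2_scaleR: "cinner_ell2 x (r *\<^sub>R y) = r *\<^sub>R cinner_ell2 x y"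
  "cinner_ell2 (r *\<^sub>R x) y = r *\<^sub>R cinner_ell2 x y"
  by (simp_all add: scaleR_scaleC cinner_ell2_scaleC_left cinner_ell2_scaleC_right scaleR_conv_of_real)

lemma bounded_bilinear_cinner_ell2: "bounded_bilinear cinner_ell2"
  by unfold_locales
     (auto simp: cinner_ell2_add_left cinner_ell2_add_right cinner_ell2_scaleR
        intro!: exI[of _ 1] cinner_ell2_Cauchy_Schwarz)

lift_definition ell2_unit :: "nat \<Rightarrow> ell2" is "\<lambda>n m. if m = n then 1 else 0"
proof -
  fix n :: nat
  show "summable (\<lambda>m. (cmod (if m = n then 1 else 0))\<^sup>2)"
    by (rule summable_finite[of "{n}"]) auto
qed

definition ell2_trunc :: "nat \<Rightarrow> (nat \<Rightarrow> complex) \<Rightarrow> ell2"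
  where "ell2_trunc N s = (\<Sum>n<N. s n *\<^sub>C ell2_unit n)"

lemma coord_ell2_trunc: "coord (ell2_trunc N s) m = (if m < N then s m else 0)"
  unfolding ell2_trunc_def
  by (induction N)
     (auto simp: zero_ell2.rep_eq plus_ell2.rep_eq scaleC_ell2.rep_eq ell2_unit.rep_eq less_Suc_eq)

lemma norm_ell2_trunc: "norm (ell2_trunc N s) = L2_set (\<lambda>n. cmod (s n)) {..<N}"
  unfolding norm_ell2.rep_eq L2_set_def
  by (subst suminf_finite[of "{..<N}"]) (auto simp: coord_ell2_trunc)

lemma ell2_trunc_tendsto: "(\<lambda>N. ell2_trunc N (coord x)) \<longlonglongrightarrow> x"
proof -
  let ?f = "\<lambda>n. (cmod (coord x n))\<^sup>2"
  have eq: "(norm (x - ell2_trunc N (coord x)))\<^sup>2 = suminf ?f - (\<Sum>n<N. ?f n)" for N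
  proof -
    let ?g = "\<lambda>n. if n < N then ?f n else 0"
    have g: "summable ?g" "suminf ?g = (\<Sum>n<N. ?f n)"
      using suminf_finite[of "{..<N}" ?g] summable_finite[of "{..<N}" ?g] by auto
    have "(norm (x - ell2_trunc N (coord x)))\<^sup>2 = (\<Sum>n. (cmod (coord (x - ell2_trunc N (coord x)) n))\<^sup>2)"
      unfolding norm_ell2.rep_eq by (simp add: suminf_nonneg ell2_summable)
    also have "\<dots> = (\<Sum>n. ?f n - ?g n)"
      by (rule suminf_cong) (simp add: coord_diff coord_ell2_trunc)
    also have "\<dots> = suminf ?f - suminf ?g"
      by (rule suminf_diff[symmetric, OF ell2_summable g(1)])
    finally show ?thesis by (simp only: g(2))
  qed
  have "(\<lambda>N. suminf ?f - (\<Sum>n<N. ?f n)) \<longlonglongrightarrow> suminf ?f - suminf ?f"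
    by (intro tendsto_diff tendsto_const summable_LIMSEQ ell2_summable)
  then have "(\<lambda>N. sqrt ((norm (x - ell2_trunc N (coord x)))\<^sup>2)) \<longlonglongrightarrow> sqrt 0"
    unfolding eq by (intro tendsto_real_sqrt) simp
  then have "(\<lambda>N. norm (x - ell2_trunc N (coord x))) \<longlonglongrightarrow> 0" by simp
  then show ?thesis
    by (subst LIM_zero_iff[symmetric], subst tendsto_norm_zero_iff[symmetric])
       (simp only: norm_minus_commute)
qed

lemma cinner_ell2_eqI:
  assumes "\<And>x. cinner_ell2 x y = cinner_ell2 x z"
  shows "y = z"
proof -
  have "cinner_ell2 (y - z) (y - z) = 0"
    using assms bounded_bilinear.diff_right[OF bounded_bilinear_cinner_ell2, of "y - z" y z] by simp
  then show ?thesis by (simp add: cinner_ell2_self)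
qed

definition ell2_adj :: "(ell2 \<Rightarrow>\<^sub>L ell2) \<Rightarrow> (ell2 \<Rightarrow>\<^sub>L ell2)"
  where "ell2_adj T = (THE S. \<forall>x y. cinner_ell2 (blinfun_apply T x) y = cinner_ell2 x (blinfun_apply S y))"

lemma ell2_adj_eqI:
  assumes "\<And>x y. cinner_ell2 (blinfun_apply T x) y = cinner_ell2 x (blinfun_apply S y)"
  shows "ell2_adj T = S"
  unfolding ell2_adj_def
proof (rule the_equality)
  show "\<forall>x y. cinner_ell2 (T x) y = cinner_ell2 x (S y)" using assms by blast
  fix S' :: "ell2 \<Rightarrow>\<^sub>L ell2"
  assume "\<forall>x y. cinner_ell2 (T x) y = cinner_ell2 x (S' y)"
  then have "\<And>x y. cinner_ell2 x (S' y) = cinner_ell2 x (S y)"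
    using assms by metis
  then show "S' = S" by (intro blinfun_eqI cinner_ell2_eqI)
qed

lemma ell2_adj_exists:
  fixes T :: "ell2 \<Rightarrow>\<^sub>L ell2"
  assumes T: "clinear (blinfun_apply T)"
  shows "\<exists>S :: ell2 \<Rightarrow>\<^sub>L ell2. \<forall>x y. cinner_ell2 (T x) y = cinner_ell2 x (S y)"
proof -
  note Tlin = T[unfolded clinear_iff]
  have Tsum: "cinner_ell2 (T (ell2_trunc N s)) y = (\<Sum>n<N. cnj (s n) * cinner_ell2 (T (ell2_unit n)) y)" for N s y
    unfolding ell2_trunc_def using Tlin
    by (simp add: blinfun.sum_right bounded_bilinear.sum_left[OF bounded_bilinear_cinner_ell2]
        cinner_ell2_scaleC_left)
  define s where "s y n = cinner_ell2 (T (ell2_unit n)) y" for y n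
  have bd: "L2_set (\<lambda>n. cmod (s y n)) {..<N} \<le> norm y * norm T" for y N
  proof -
    let ?L = "L2_set (\<lambda>n. cmod (s y n)) {..<N}"
    have "complex_of_real (?L\<^sup>2) = (\<Sum>n<N. cnj (s y n) * s y n)"
      unfolding L2_set_def
      by (simp add: sum_nonneg complex_norm_square mult.commute del: of_real_power)
    also have "\<dots> = cinner_ell2 (T (ell2_trunc N (s y))) y"
      by (simp add: Tsum s_def)
    finally have "?L\<^sup>2 = cmod (cinner_ell2 (T (ell2_trunc N (s y))) y)"
      by (metis abs_of_nonneg norm_of_real zero_le_power2)
    also have "\<dots> \<le> norm (T (ell2_trunc N (s y))) * norm y"
      by (rule cinner_ell2_Cauchy_Schwarz)
    also have "\<dots> \<le> (norm T * ?L) * norm y"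
      using norm_blinfun[of T "ell2_trunc N (s y)"] by (intro mult_right_mono) (simp_all add: norm_ell2_trunc)
    finally have "?L * ?L \<le> ?L * (norm y * norm T)"
      by (simp add: power2_eq_square mult_ac)
    then show ?thesis
      by (cases "?L = 0") (auto simp: mult_le_cancel_left less_le)
  qed
  define S0 where "S0 y = Abs_ell2 (s y)" for y
  have coordS: "coord (S0 y) = s y" for y
    unfolding S0_def using ell2_sqrt_bound(1)[OF bd] by (simp add: Abs_ell2_inverse)
  have "bounded_linear S0"
  proof (rule bounded_linear_intro[where K="norm T"])
    show "S0 (x + y) = S0 x + S0 y" for x y
      by (intro coord_inject[THEN iffD1] ext) (simp add: coordS plus_ell2.rep_eq s_def cinner_ell2_add_right)
    show "S0 (r *\<^sub>R x) = r *\<^sub>R S0 x" for r x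
      by (intro coord_inject[THEN iffD1] ext)
         (simp add: coordS scaleC_ell2.rep_eq s_def scaleR_scaleC cinner_ell2_scaleC_right)
    show "norm (S0 x) \<le> norm x * norm T" for x
      by (rule ell2_norm_le) (simp add: coordS bd)
  qed
  then have S: "blinfun_apply (Blinfun S0) = S0" by (rule bounded_linear_Blinfun_apply)
  have "cinner_ell2 (T x) y = cinner_ell2 x (S0 y)" for x y
  proof (rule LIMSEQ_unique)
    show "(\<lambda>N. cinner_ell2 (T (ell2_trunc N (coord x))) y) \<longlonglongrightarrow> cinner_ell2 (T x) y"
      by (intro bounded_bilinear.tendsto[OF bounded_bilinear_cinner_ell2] blinfun.tendsto
          tendsto_const ell2_trunc_tendsto)
    show "(\<lambda>N. cinner_ell2 (T (ell2_trunc N (coord x))) y) \<longlonglongrightarrow> cinner_ell2 x (S0 y)"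
      unfolding Tsum using summable_LIMSEQ[OF cinner_ell2_summable[of x "S0 y"]]
      by (simp add: cinner_ell2_def[of x "S0 y"] coordS s_def)
  qed
  then show ?thesis by (intro exI[of _ "Blinfun S0"]) (simp add: S)
qed

lemma ell2_adj:
  assumes "clinear (blinfun_apply T)"
  shows "cinner_ell2 (blinfun_apply T x) y = cinner_ell2 x (blinfun_apply (ell2_adj T) y)"
  using ell2_adj_exists[OF assms] ell2_adj_eqI by metis

lemma ell2_adj_right:
  assumes "clinear (blinfun_apply T)"
  shows "cinner_ell2 (ell2_adj T x) y = cinner_ell2 x (T y)"
  using ell2_adj[OF assms] cinner_ell2_commute by metis

lemma clinear_ell2_adj:
  assumes "clinear (blinfun_apply T)"
  shows "clinear (blinfun_apply (ell2_adj T))"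
  unfolding clinear_iff
  by (intro conjI allI cinner_ell2_eqI)
     (simp_all add: ell2_adj[OF assms, symmetric] cinner_ell2_add_right cinner_ell2_scaleC_right)

lemma norm_ell2_adj:
  assumes "clinear (blinfun_apply T)"
  shows "norm (ell2_adj T) \<le> norm T"
proof (rule norm_blinfun_bound)
  fix y
  let ?z = "ell2_adj T y"
  have "complex_of_real ((norm ?z)\<^sup>2) = cinner_ell2 (T ?z) y"
    unfolding ell2_adj[OF assms] cinner_ell2_self ..
  then have "(norm ?z)\<^sup>2 = cmod (cinner_ell2 (T ?z) y)"
    by (metis abs_of_nonneg norm_of_real zero_le_power2)
  also have "\<dots> \<le> norm (T ?z) * norm y" by (rule cinner_ell2_Cauchy_Schwarz)
  also have "\<dots> \<le> (norm T * norm ?z) * norm y"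
    by (intro mult_right_mono norm_blinfun) simp
  finally have "norm ?z * norm ?z \<le> norm ?z * (norm T * norm y)"
    by (simp add: power2_eq_square mult_ac)
  then show "norm ?z \<le> norm T * norm y"
    by (cases "norm ?z = 0") (auto simp: mult_le_cancel_left less_le)
qed simp

section \<open>The C*-algebra of compact operators\<close>

instantiation blinfun :: (real_normed_vector, complex_normed_vector) complex_normed_vector
begin
lift_definition scaleC_blinfun :: "complex \<Rightarrow> ('a \<Rightarrow>\<^sub>L 'b) \<Rightarrow> ('a \<Rightarrow>\<^sub>L 'b)"
  is "\<lambda>c f x. c *\<^sub>C f x"
  by (rule bounded_linear_compose[OF bounded_linear_scaleC])
instance
proof
  fix c d :: complex and f g :: "'a \<Rightarrow>\<^sub>L 'b" and r :: real
  show "c *\<^sub>C (f + g) = c *\<^sub>C f + c *\<^sub>C g" by transfer (simp add: scaleC_add_right)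
  show "(c + d) *\<^sub>C f = c *\<^sub>C f + d *\<^sub>C f" by transfer (simp add: scaleC_add_left)
  show "c *\<^sub>C d *\<^sub>C f = (c * d) *\<^sub>C f" by transfer (simp add: scaleC_scaleC)
  show "r *\<^sub>R f = complex_of_real r *\<^sub>C f" by transfer (simp add: scaleR_scaleC)
  have le: "norm (c *\<^sub>C f) \<le> cmod c * norm f" for c and f :: "'a \<Rightarrow>\<^sub>L 'b"
    by (rule norm_blinfun_bound)
       (simp_all add: scaleC_blinfun.rep_eq norm_scaleC mult.assoc mult_left_mono norm_blinfun)
  show "norm (c *\<^sub>C f) = cmod c * norm f"
  proof (cases "c = 0")
    case True
    then show ?thesis using le[of c f] by simp
  next
    case False
    have "inverse c *\<^sub>C c *\<^sub>C f = f"
      using False by transfer (simp add: scaleC_scaleC scaleC_one)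
    then have "norm f \<le> inverse (cmod c) * norm (c *\<^sub>C f)"
      using le[of "inverse c" "c *\<^sub>C f"] by (simp add: norm_inverse)
    then have "cmod c * norm f \<le> norm (c *\<^sub>C f)"
      using False by (simp add: field_simps)
    then show ?thesis using le[of c f] by simp
  qed
qed
end

lemma compact_closure_iff:
  fixes S :: "'a::banach set"
  shows "compact (closure S) \<longleftrightarrow> (\<forall>e>0. \<exists>k. finite k \<and> S \<subseteq> (\<Union>x\<in>k. ball x e))" (is "?L \<longleftrightarrow> ?R")
proof
  assume ?L
  then show ?R
    unfolding compact_eq_totally_bounded using closure_subset[of S] by (meson order_trans)
next
  assume R: ?R
  show ?L
    unfolding compact_eq_totally_bounded
  proof (intro conjI allI impI)
    show "complete (closure S)" by (simp add: complete_eq_closed)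
    fix e :: real assume "0 < e"
    then obtain k where k: "finite k" "S \<subseteq> (\<Union>x\<in>k. ball x (e / 2))"
      using R by (meson half_gt_zero)
    have "S \<subseteq> (\<Union>x\<in>k. cball x (e / 2))" using k(2) ball_subset_cball by blast
    then have "closure S \<subseteq> (\<Union>x\<in>k. cball x (e / 2))"
      using k(1) by (intro closure_minimal closed_UN) auto
    also have "\<dots> \<subseteq> (\<Union>x\<in>k. ball x e)"
      using \<open>0 < e\<close> by (intro UN_mono) auto
    finally show "\<exists>k. finite k \<and> closure S \<subseteq> (\<Union>x\<in>k. ball x e)" using k(1) by blast
  qed
qed

lemma compact_closure_subset:
  fixes S :: "'a::banach set"
  assumes "compact (closure S)" "T \<subseteq> S"
  shows "compact (closure T)"
  using assms unfolding compact_closure_iff by (meson order_trans)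

lemma compact_closure_image:
  fixes S :: "'a::banach set" and f :: "'a \<Rightarrow> 'b::banach"
  assumes "compact (closure S)" "continuous_on UNIV f"
  shows "compact (closure (f ` S))"
proof -
  have c: "compact (f ` closure S)"
    using assms by (intro compact_continuous_image) (auto intro: continuous_on_subset)
  have "closure (f ` closure S) = f ` closure S"
    by (rule closure_closed[OF compact_imp_closed[OF c]])
  moreover have "f ` S \<subseteq> f ` closure S" using closure_subset by blast
  ultimately show ?thesis using compact_closure_subset c by metis
qed

lemma compact_closure_centers:
  fixes S :: "'a::banach set"
  assumes "compact (closure S)" "0 < e"
  obtains k where "finite k" "k \<subseteq> S" "S \<subseteq> (\<Union>x\<in>k. ball x e)"
proof -
  obtain c where c: "finite c" "S \<subseteq> (\<Union>x\<in>c. ball x (e / 2))"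
    using assms unfolding compact_closure_iff by (meson half_gt_zero)
  define p where "p x = (SOME y. y \<in> S \<and> y \<in> ball x (e / 2))" for x
  let ?k = "p ` {x \<in> c. \<exists>y. y \<in> S \<and> y \<in> ball x (e / 2)}"
  have p: "p x \<in> S \<and> p x \<in> ball x (e / 2)" if "\<exists>y. y \<in> S \<and> y \<in> ball x (e / 2)" for x
    unfolding p_def using that by (rule someI_ex)
  show thesis
  proof
    show "finite ?k" using c by simp
    show "?k \<subseteq> S" using p by auto
    show "S \<subseteq> (\<Union>x\<in>?k. ball x e)"
    proof
      fix y assume y: "y \<in> S"
      then obtain x where x: "x \<in> c" "y \<in> ball x (e / 2)" using c by blast
      then have px: "p x \<in> ?k" "p x \<in> ball x (e / 2)" using p[of x] y by blast+
      have "dist (p x) y < e"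
        using x(2) px(2) dist_triangle[of "p x" y x] by (simp add: dist_commute[of "p x" x])
      then show "y \<in> (\<Union>x\<in>?k. ball x e)" using px(1) by auto
    qed
  qed
qed

text \<open>
  Elements of the function space are only bounded and real-linear, so complex linearity is
  required explicitly.
\<close>

definition compact_operator :: "(ell2 \<Rightarrow>\<^sub>L ell2) \<Rightarrow> bool"
  where "compact_operator T \<longleftrightarrow> clinear (blinfun_apply T) \<and> compact (closure (T ` cball 0 1))"

lemma compact_operator_add:
  assumes "compact_operator S" "compact_operator T"
  shows "compact_operator (S + T)"
  unfolding compact_operator_def
proof
  show "clinear (blinfun_apply (S + T))"
    using assms unfolding compact_operator_def clinear_iff
    by (auto simp: blinfun.add_left scaleC_add_right)
  show "compact (closure ((S + T) ` cball 0 1))"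
    unfolding compact_closure_iff
  proof (intro allI impI)
    fix e :: real assume e: "0 < e"
    then obtain k l where k: "finite k" "S ` cball 0 1 \<subseteq> (\<Union>x\<in>k. ball x (e / 2))"
      and l: "finite l" "T ` cball 0 1 \<subseteq> (\<Union>x\<in>l. ball x (e / 2))"
      using assms unfolding compact_operator_def compact_closure_iff by (meson half_gt_zero)
    let ?m = "(\<lambda>(x, y). x + y) ` (k \<times> l)"
    have "(S + T) z \<in> (\<Union>x\<in>?m. ball x e)" if z: "z \<in> cball 0 1" for z
    proof -
      obtain x where x: "x \<in> k" "dist x (S z) < e / 2" using z k(2) by fastforce
      obtain y where y: "y \<in> l" "dist y (T z) < e / 2" using z l(2) by fastforce
      have "dist (x + y) (S z + T z) < e"
        using dist_triangle_add[of x y "S z" "T z"] x y by simp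
      then show ?thesis using x y by (force simp: blinfun.add_left)
    qed
    then show "\<exists>k. finite k \<and> (S + T) ` cball 0 1 \<subseteq> (\<Union>x\<in>k. ball x e)"
      using k(1) l(1) by (intro exI[of _ ?m]) blast
  qed
qed

lemma compact_operator_compose_left:
  assumes "compact_operator T" "clinear (blinfun_apply S)"
  shows "compact_operator (S o\<^sub>L T)"
  using assms compact_closure_image[of "T ` cball 0 1" "blinfun_apply S"]
  unfolding compact_operator_def clinear_iff
  by (simp add: image_image blinfun.continuous_on)

lemma compact_operator_scaleC:
  assumes "compact_operator T"
  shows "compact_operator (c *\<^sub>C T)"
  using assms compact_closure_image[of "T ` cball 0 1" "\<lambda>x. c *\<^sub>C x"]
    linear_continuous_on[OF bounded_linear_scaleC, of UNIV c]
  unfolding compact_operator_def clinear_iff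
  by (simp add: image_image scaleC_blinfun.rep_eq scaleC_add_right scaleC_scaleC mult.commute)

lemma compact_operator_compose_right:
  assumes "compact_operator T" "clinear (blinfun_apply R)"
  shows "compact_operator (T o\<^sub>L R)"
proof -
  define r where "r = norm R + 1"
  have r: "0 < r" by (simp add: r_def add_nonneg_pos)
  have "T (R x) \<in> (\<lambda>z. r *\<^sub>R z) ` T ` cball 0 1" if "x \<in> cball 0 1" for x
  proof -
    have "norm (R x) \<le> norm R * 1"
      using norm_blinfun[of R x] that by (meson mem_cball_0 mult_left_mono norm_ge_zero order_trans)
    then have "norm (R x) \<le> r" by (simp add: r_def)
    then have "inverse r *\<^sub>R R x \<in> cball 0 1" using r by (simp add: field_simps)
    moreover have "T (R x) = r *\<^sub>R T (inverse r *\<^sub>R R x)" using r by (simp add: blinfun.scaleR_right)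
    ultimately show ?thesis by blast
  qed
  then have "(T o\<^sub>L R) ` cball 0 1 \<subseteq> (\<lambda>z. r *\<^sub>R z) ` T ` cball 0 1" by auto
  moreover have "compact (closure ((\<lambda>z. r *\<^sub>R z) ` T ` cball 0 1))"
  proof (rule compact_closure_image)
    show "compact (closure (T ` cball 0 1))" using assms(1) by (simp add: compact_operator_def)
    show "continuous_on UNIV (\<lambda>z :: ell2. r *\<^sub>R z)" by (intro continuous_intros)
  qed
  ultimately have "compact (closure ((T o\<^sub>L R) ` cball 0 1))"
    by (rule compact_closure_subset[rotated])
  then show ?thesis
    using assms unfolding compact_operator_def clinear_iff by simp
qed

lemma compact_operator_adj:
  assumes "compact_operator T"
  shows "compact_operator (ell2_adj T)"
proof -
  let ?A = "ell2_adj T"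
  have T: "clinear (blinfun_apply T)" using assms by (simp add: compact_operator_def)
  have TA: "compact (closure ((\<lambda>x. T (?A x)) ` cball 0 1))"
    using compact_operator_compose_right[OF assms clinear_ell2_adj[OF T]]
    by (simp add: compact_operator_def)
  have "\<exists>k. finite k \<and> ?A ` cball 0 1 \<subseteq> (\<Union>x\<in>k. ball x e)" if e: "0 < e" for e
  proof -
    obtain k where k: "finite k" "k \<subseteq> (\<lambda>x. T (?A x)) ` cball 0 1"
      "(\<lambda>x. T (?A x)) ` cball 0 1 \<subseteq> (\<Union>x\<in>k. ball x (e\<^sup>2 / 4))"
      using compact_closure_centers[OF TA, of "e\<^sup>2 / 4"] e by auto
    obtain Y where Y: "Y \<subseteq> cball 0 1" "finite Y" "k = (\<lambda>x. T (?A x)) ` Y"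
      using finite_subset_image[OF k(1,2)] by blast
    have "?A x \<in> (\<Union>x\<in>?A ` Y. ball x e)" if x: "x \<in> cball 0 1" for x
    proof -
      have "T (?A x) \<in> (\<Union>x\<in>k. ball x (e\<^sup>2 / 4))" using x k(3) by blast
      then obtain y where y: "y \<in> Y" "dist (T (?A y)) (T (?A x)) < e\<^sup>2 / 4"
        unfolding Y(3) by auto
      let ?d = "y - x"
      have d: "norm ?d \<le> 2" using norm_triangle_ineq4[of y x] x y(1) Y(1) by fastforce
      have "complex_of_real ((norm (?A ?d))\<^sup>2) = cinner_ell2 (T (?A ?d)) ?d"
        unfolding ell2_adj[OF T] cinner_ell2_self ..
      then have "(norm (?A ?d))\<^sup>2 = cmod (cinner_ell2 (T (?A ?d)) ?d)"
        by (metis abs_of_nonneg norm_of_real zero_le_power2)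
      also have "\<dots> \<le> norm (T (?A ?d)) * norm ?d" by (rule cinner_ell2_Cauchy_Schwarz)
      also have "\<dots> \<le> (e\<^sup>2 / 4) * 2"
        using y(2) d by (intro mult_mono) (simp_all add: dist_norm blinfun.diff_right)
      also have "\<dots> < e\<^sup>2" using e by simp
      finally have "norm (?A ?d) < e" using e power2_less_imp_less by (meson less_imp_le)
      then show ?thesis using y(1) by (auto simp: dist_norm blinfun.diff_right)
    qed
    then show ?thesis using Y(2) by (intro exI[of _ "?A ` Y"]) blast
  qed
  then show ?thesis
    unfolding compact_operator_def compact_closure_iff using clinear_ell2_adj[OF T] by blast
qed

lemma compact_operator_limit:
  fixes X :: "nat \<Rightarrow> ell2 \<Rightarrow>\<^sub>L ell2"
  assumes X: "\<And>n. compact_operator (X n)" and lim: "X \<longlonglongrightarrow> T"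
  shows "compact_operator T"
  unfolding compact_operator_def compact_closure_iff
proof (intro conjI allI impI)
  have Xx: "(\<lambda>n. X n x) \<longlonglongrightarrow> T x" for x
    by (intro blinfun.tendsto lim tendsto_const)
  show "clinear (blinfun_apply T)"
    unfolding clinear_iff
  proof (intro conjI allI)
    fix c x
    have "(\<lambda>n. X n (c *\<^sub>C x)) \<longlonglongrightarrow> c *\<^sub>C T x"
      using bounded_linear.tendsto[OF bounded_linear_scaleC Xx, of c x] X
      by (simp add: compact_operator_def clinear_iff)
    then show "T (c *\<^sub>C x) = c *\<^sub>C T x" using Xx LIMSEQ_unique by blast
  qed (simp add: blinfun.add_right)
  fix e :: real assume e: "0 < e"
  then obtain n where n: "norm (X n - T) < e / 2"
    using lim unfolding LIMSEQ_iff by (meson half_gt_zero order_refl)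
  obtain k where k: "finite k" "X n ` cball 0 1 \<subseteq> (\<Union>x\<in>k. ball x (e / 2))"
    using X[of n] e unfolding compact_operator_def compact_closure_iff by (meson half_gt_zero)
  have "T x \<in> (\<Union>y\<in>k. ball y e)" if x: "x \<in> cball 0 1" for x
  proof -
    obtain y where y: "y \<in> k" "dist y (X n x) < e / 2" using x k(2) by fastforce
    have "norm ((X n - T) x) \<le> norm (X n - T) * 1"
      using norm_blinfun[of "X n - T" x] x by (meson mem_cball_0 mult_left_mono norm_ge_zero order_trans)
    then have "dist (X n x) (T x) < e / 2" using n by (simp add: dist_norm blinfun.diff_left)
    then have "dist y (T x) < e" using y(2) dist_triangle_half_r[of "X n x" y e "T x"]
      by (simp add: dist_commute)
    then show ?thesis using y(1) by auto
  qed
  then show "\<exists>k. finite k \<and> T ` cball 0 1 \<subseteq> (\<Union>x\<in>k. ball x e)" using k(1) by blast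
qed

typedef compact_op = "{T. compact_operator T}"
  morphisms op_of Abs_compact_op
proof
  have "(blinfun_apply (0 :: ell2 \<Rightarrow>\<^sub>L ell2)) ` cball 0 1 \<subseteq> {0}" by auto
  then have "compact (closure (blinfun_apply (0 :: ell2 \<Rightarrow>\<^sub>L ell2) ` cball 0 1))"
    by (rule compact_closure_subset[rotated]) simp
  then show "0 \<in> {T. compact_operator T}"
    by (simp add: compact_operator_def clinear_iff)
qed

setup_lifting type_definition_compact_op

lemma compact_operator_op_of: "compact_operator (op_of T)"
  using op_of[of T] by simp

lemma clinear_op_of: "clinear (blinfun_apply (op_of T))"
  using compact_operator_op_of by (simp add: compact_operator_def)

instantiation compact_op :: star_algebra
begin
lift_definition zero_compact_op :: compact_op is 0
  using compact_operator_scaleC[OF compact_operator_op_of, of 0] by simp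
lift_definition plus_compact_op :: "compact_op \<Rightarrow> compact_op \<Rightarrow> compact_op" is "(+)"
  by (rule compact_operator_add)
lift_definition scaleC_compact_op :: "complex \<Rightarrow> compact_op \<Rightarrow> compact_op" is "scaleC"
  by (rule compact_operator_scaleC)
lift_definition uminus_compact_op :: "compact_op \<Rightarrow> compact_op" is uminus
  using compact_operator_scaleC[of _ "- 1"] by simp
lift_definition minus_compact_op :: "compact_op \<Rightarrow> compact_op \<Rightarrow> compact_op" is "(-)"
  using compact_operator_add compact_operator_scaleC[of _ "- 1"] by fastforce
lift_definition scaleR_compact_op :: "real \<Rightarrow> compact_op \<Rightarrow> compact_op" is "scaleR"
  by (simp add: scaleR_scaleC compact_operator_scaleC)
lift_definition times_compact_op :: "compact_op \<Rightarrow> compact_op \<Rightarrow> compact_op" is "(o\<^sub>L)"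
  by (rule compact_operator_compose_left) (auto simp only: compact_operator_def)
lift_definition star_compact_op :: "compact_op \<Rightarrow> compact_op" is ell2_adj
  by (rule compact_operator_adj)
instance
proof
  fix a b c :: compact_op and r s :: real and z w :: complex
  show "a + b + c = a + (b + c)" "a + b = b + a" "0 + a = a" "- a + a = 0" "a - b = a + - b"
    "r *\<^sub>R (a + b) = r *\<^sub>R a + r *\<^sub>R b" "(r + s) *\<^sub>R a = r *\<^sub>R a + s *\<^sub>R a"
    "r *\<^sub>R s *\<^sub>R a = (r * s) *\<^sub>R a" "1 *\<^sub>R a = a"
    by (transfer, simp add: algebra_simps)+
  show "z *\<^sub>C (a + b) = z *\<^sub>C a + z *\<^sub>C b" "(z + w) *\<^sub>C a = z *\<^sub>C a + w *\<^sub>C a"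
    "z *\<^sub>C w *\<^sub>C a = (z * w) *\<^sub>C a" "r *\<^sub>R a = complex_of_real r *\<^sub>C a"
    by (transfer, simp add: scaleC_add_left scaleC_add_right scaleC_scaleC scaleR_scaleC)+
  show "a * b * c = a * (b * c)"
    by transfer (auto intro: blinfun_eqI)
  show "(a + b) * c = a * c + b * c" "a * (b + c) = a * b + a * c"
    by (transfer, auto intro!: blinfun_eqI simp: blinfun.add_left blinfun.add_right)+
  show "(z *\<^sub>C a) * b = z *\<^sub>C (a * b)"
    by transfer (auto intro!: blinfun_eqI simp: scaleC_blinfun.rep_eq)
  show "a * (z *\<^sub>C b) = z *\<^sub>C (a * b)"
    by transfer (auto intro!: blinfun_eqI simp: scaleC_blinfun.rep_eq compact_operator_def clinear_iff)
  show "star (a + b) = star a + star b"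
    by transfer (auto intro!: ell2_adj_eqI
        simp: compact_operator_def blinfun.add_left cinner_ell2_add_left cinner_ell2_add_right ell2_adj)
  show "star (z *\<^sub>C a) = cnj z *\<^sub>C star a"
    by transfer (auto intro!: ell2_adj_eqI simp: compact_operator_def scaleC_blinfun.rep_eq
        cinner_ell2_scaleC_left cinner_ell2_scaleC_right ell2_adj)
  show "star (a * b) = star b * star a"
    by transfer (auto intro!: ell2_adj_eqI simp: compact_operator_def ell2_adj)
  show "star (star a) = a"
    by transfer (auto intro!: ell2_adj_eqI simp: compact_operator_def ell2_adj_right)
qed
end

instantiation compact_op :: complex_normed_vector
begin
lift_definition norm_compact_op :: "compact_op \<Rightarrow> real" is norm .
definition "dist_compact_op x y = norm (x - y :: compact_op)"
definition "sgn_compact_op x = x /\<^sub>R norm (x :: compact_op)"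
definition [code del]:
  "(uniformity :: (compact_op \<times> compact_op) filter) = (INF e\<in>{0<..}. principal {(x, y). dist x y < e})"
definition [code del]:
  "open (S :: compact_op set) = (\<forall>x\<in>S. \<forall>\<^sub>F (x', y) in uniformity. x' = x \<longrightarrow> y \<in> S)"
instance
proof
  fix x y :: compact_op and r :: real and c :: complex and S :: "compact_op set"
  show "dist x y = norm (x - y)" by (rule dist_compact_op_def)
  show "sgn x = x /\<^sub>R norm x" by (rule sgn_compact_op_def)
  show "(uniformity :: (compact_op \<times> compact_op) filter) = (INF e\<in>{0<..}. principal {(x, y). dist x y < e})"
    by (rule uniformity_compact_op_def)
  show "open S = (\<forall>x\<in>S. \<forall>\<^sub>F (x', y) in uniformity. x' = x \<longrightarrow> y \<in> S)"
    by (rule open_compact_op_def)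
  show "norm x = 0 \<longleftrightarrow> x = 0" by transfer simp
  show "norm (x + y) \<le> norm x + norm y" by transfer (rule norm_triangle_ineq)
  show "norm (c *\<^sub>C x) = cmod c * norm x" by transfer (rule norm_scaleC)
  show "norm (r *\<^sub>R x) = \<bar>r\<bar> * norm x" by transfer simp
qed
end

instance compact_op :: cbanach
proof
  fix X :: "nat \<Rightarrow> compact_op"
  assume X: "Cauchy X"
  have d: "norm (a - b) = norm (op_of a - op_of b)" for a b
    by transfer simp
  have "Cauchy (\<lambda>n. op_of (X n))"
    using X unfolding Cauchy_def dist_compact_op_def dist_norm d .
  then have T: "(\<lambda>n. op_of (X n)) \<longlonglongrightarrow> lim (\<lambda>n. op_of (X n))" (is "_ \<longlonglongrightarrow> ?T")
    by (simp only: Cauchy_convergent_iff convergent_LIMSEQ_iff)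
  have "compact_operator ?T"
    by (rule compact_operator_limit[OF compact_operator_op_of T])
  then have "op_of (Abs_compact_op ?T) = ?T" by (simp add: Abs_compact_op_inverse)
  then have "X \<longlonglongrightarrow> Abs_compact_op ?T"
    using T unfolding LIMSEQ_iff d by simp
  then show "convergent X" by (rule convergentI)
qed

instance compact_op :: cstar_algebra
proof
  fix x y :: compact_op
  show "norm (x * y) \<le> norm x * norm y" by transfer (rule norm_blinfun_compose)
  show "norm (star x * x) = (norm x)\<^sup>2"
  proof (transfer, rule antisym)
    fix T :: "ell2 \<Rightarrow>\<^sub>L ell2"
    assume "compact_operator T"
    then have T: "clinear (blinfun_apply T)" by (simp add: compact_operator_def)
    show "norm (ell2_adj T o\<^sub>L T) \<le> (norm T)\<^sup>2"
      using norm_blinfun_compose[of "ell2_adj T" T] mult_right_mono[OF norm_ell2_adj[OF T], of "norm T"]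
      by (simp add: power2_eq_square)
    have "norm T \<le> sqrt (norm (ell2_adj T o\<^sub>L T))"
    proof (rule norm_blinfun_bound)
      fix v
      have "complex_of_real ((norm (T v))\<^sup>2) = cinner_ell2 v ((ell2_adj T o\<^sub>L T) v)"
        by (simp add: cinner_ell2_self ell2_adj[OF T, symmetric])
      then have "(norm (T v))\<^sup>2 = cmod (cinner_ell2 v ((ell2_adj T o\<^sub>L T) v))"
        by (metis abs_of_nonneg norm_of_real zero_le_power2)
      also have "\<dots> \<le> norm v * norm ((ell2_adj T o\<^sub>L T) v)" by (rule cinner_ell2_Cauchy_Schwarz)
      also have "\<dots> \<le> norm v * (norm (ell2_adj T o\<^sub>L T) * norm v)"
        by (intro mult_left_mono norm_blinfun) simp
      also have "\<dots> = (sqrt (norm (ell2_adj T o\<^sub>L T)) * norm v)\<^sup>2"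
        by (simp add: power2_eq_square)
      finally show "norm (T v) \<le> sqrt (norm (ell2_adj T o\<^sub>L T)) * norm v"
        by (rule power2_le_imp_le) simp
    qed simp
    then show "(norm T)\<^sup>2 \<le> norm (ell2_adj T o\<^sub>L T)"
      by (metis norm_ge_zero power_mono real_sqrt_pow2)
  qed
qed

section \<open>Multiplier algebras\<close>

definition star_hom :: "('a::star_algebra \<Rightarrow> 'b::star_algebra) \<Rightarrow> bool"
  where "star_hom \<phi> \<longleftrightarrow> clinear \<phi> \<and> (\<forall>x y. \<phi> (x * y) = \<phi> x * \<phi> y) \<and> (\<forall>x. \<phi> (star x) = star (\<phi> x))"

definition cstar_positive :: "'a::cstar_algebra \<Rightarrow> bool"
  where "cstar_positive a \<longleftrightarrow> (\<exists>b. a = star b * b)"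

text \<open>A sequential approximate unit of positive contractions; it is not required to be increasing.\<close>

definition sigma_unital :: "'a::cstar_algebra itself \<Rightarrow> bool"
  where "sigma_unital _ \<longleftrightarrow> (\<exists>e :: nat \<Rightarrow> 'a.
    (\<forall>n. cstar_positive (e n) \<and> norm (e n) \<le> 1) \<and> (\<forall>a. (\<lambda>n. e n * a) \<longlonglongrightarrow> a))"

text \<open>
  The multiplier algebra is the *-algebra of double centralizers.  A multiplier
  \<^term>\<open>(L, R)\<close> acts on the algebra from the left by \<^term>\<open>L\<close>, so \<open>left_mult m b\<close>
  below is the product \<open>mb\<close> and \<open>right_mult m b\<close> is \<open>bm\<close>.
\<close>

definition double_centralizer :: "('a::cstar_algebra \<Rightarrow> 'a) \<Rightarrow> ('a \<Rightarrow> 'a) \<Rightarrow> bool"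
  where "double_centralizer L R \<longleftrightarrow>
    bounded_linear L \<and> bounded_linear R \<and> clinear L \<and> clinear R \<and>
    (\<forall>x y. L (x * y) = L x * y) \<and> (\<forall>x y. R (x * y) = x * R y) \<and>
    (\<forall>x y. R x * y = x * L y)"

typedef (overloaded) ('a::cstar_algebra) multiplier =
  "{LR :: ('a \<Rightarrow> 'a) \<times> ('a \<Rightarrow> 'a). double_centralizer (fst LR) (snd LR)}"
  morphisms centralizer Abs_multiplier
  by (rule exI[of _ "(\<lambda>_. 0, \<lambda>_. 0)"]) (simp add: double_centralizer_def clinear_iff)

setup_lifting type_definition_multiplier

lift_definition left_mult :: "'a::cstar_algebra multiplier \<Rightarrow> 'a \<Rightarrow> 'a" is fst .
lift_definition right_mult :: "'a::cstar_algebra multiplier \<Rightarrow> 'a \<Rightarrow> 'a" is snd .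

lemma double_centralizer_mult: "double_centralizer (left_mult m) (right_mult m)"
  by transfer auto

lemma multiplier_eqI:
  assumes "\<And>x. left_mult m x = left_mult n x" "\<And>x. right_mult m x = right_mult n x"
  shows "m = n"
  using assms by transfer (auto simp: fun_eq_iff prod_eq_iff)

lemma centralizer_star:
  assumes "double_centralizer L R"
  shows "double_centralizer (\<lambda>x. star (R (star x))) (\<lambda>x. star (L (star x)))"
proof -
  have A: "bounded_linear L" "bounded_linear R" "clinear L" "clinear R"
    "\<And>x y. L (x * y) = L x * y" "\<And>x y. R (x * y) = x * R y" "\<And>x y. R x * y = x * L y"
    using assms by (simp_all add: double_centralizer_def)
  have "star (L (star x)) * y = x * star (R (star y))" for x y
  proof -
    have "star (star y * L (star x)) = star (R (star y) * star x)" by (simp only: A(7))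
    then show ?thesis by (simp add: star_mult star_star)
  qed
  moreover have "bounded_linear (\<lambda>x. star (L (star x)))" "bounded_linear (\<lambda>x. star (R (star x)))"
    by (intro bounded_linear_compose[OF bounded_linear_star]
        bounded_linear_compose[OF _ bounded_linear_star] A)+
  ultimately show ?thesis
    using A(3,4) unfolding double_centralizer_def clinear_iff
    by (simp add: A(5,6) star_add star_scaleC star_mult star_star)
qed

instantiation multiplier :: (cstar_algebra) star_algebra
begin
lift_definition zero_multiplier :: "'a multiplier" is "(\<lambda>_. 0, \<lambda>_. 0)"
  by (simp add: double_centralizer_def clinear_iff)
lift_definition plus_multiplier :: "'a multiplier \<Rightarrow> 'a multiplier \<Rightarrow> 'a multiplier"
  is "\<lambda>(L, R) (L', R'). (\<lambda>x. L x + L' x, \<lambda>x. R x + R' x)"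
  by (auto simp: double_centralizer_def clinear_iff bounded_linear_add algebra_simps scaleC_add_right)
lift_definition scaleC_multiplier :: "complex \<Rightarrow> 'a multiplier \<Rightarrow> 'a multiplier"
  is "\<lambda>c (L, R). (\<lambda>x. c *\<^sub>C L x, \<lambda>x. c *\<^sub>C R x)"
  by (auto simp: double_centralizer_def clinear_iff bounded_linear_compose[OF bounded_linear_scaleC]
      scaleC_add_right scaleC_scaleC mult.commute mult_scaleC_left mult_scaleC_right)
lift_definition times_multiplier :: "'a multiplier \<Rightarrow> 'a multiplier \<Rightarrow> 'a multiplier"
  is "\<lambda>(L, R) (L', R'). (\<lambda>x. L (L' x), \<lambda>x. R' (R x))"
  by (auto simp: double_centralizer_def clinear_iff intro: bounded_linear_compose)
lift_definition star_multiplier :: "'a multiplier \<Rightarrow> 'a multiplier"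
  is "\<lambda>(L, R). (\<lambda>x. star (R (star x)), \<lambda>x. star (L (star x)))"
  by (auto intro: centralizer_star)
definition uminus_multiplier :: "'a multiplier \<Rightarrow> 'a multiplier"
  where "uminus_multiplier m = (- 1) *\<^sub>C m"
definition minus_multiplier :: "'a multiplier \<Rightarrow> 'a multiplier \<Rightarrow> 'a multiplier"
  where "minus_multiplier m n = m + - n"
definition scaleR_multiplier :: "real \<Rightarrow> 'a multiplier \<Rightarrow> 'a multiplier"
  where "scaleR_multiplier r m = complex_of_real r *\<^sub>C m"

lemma left_right_mult:
  "left_mult 0 x = 0" "right_mult 0 x = (0 :: 'a)"
  "left_mult (m + n) x = left_mult m x + left_mult n x"
  "right_mult (m + n) x = right_mult m x + right_mult n x"
  "left_mult (c *\<^sub>C m) x = c *\<^sub>C left_mult m x"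
  "right_mult (c *\<^sub>C m) x = c *\<^sub>C right_mult m x"
  "left_mult (m * n) x = left_mult m (left_mult n x)"
  "right_mult (m * n) x = right_mult n (right_mult m x)"
  "left_mult (star m) x = star (right_mult m (star x))"
  "right_mult (star m) x = star (left_mult m (star x))"
  by (transfer, force)+

instance
proof
  fix a b c :: "'a multiplier" and r s :: real and z w :: complex
  have lin: "left_mult m (x + y) = left_mult m x + left_mult m y"
    "right_mult m (x + y) = right_mult m x + right_mult m y"
    "left_mult m (d *\<^sub>C x) = d *\<^sub>C left_mult m x"
    "right_mult m (d *\<^sub>C x) = d *\<^sub>C right_mult m x"
    for m :: "'a multiplier" and x y :: 'a and d :: complex
    using double_centralizer_mult[of m] by (simp_all add: double_centralizer_def clinear_iff)
  note defs = uminus_multiplier_def minus_multiplier_def scaleR_multiplier_def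
  have neg: "(- 1) *\<^sub>C x = - x" for x :: 'a
    using scaleR_scaleC[of "- 1" x] by simp
  note simps = left_right_mult lin neg scaleC_add_left scaleC_add_right scaleC_scaleC scaleC_one
    star_add star_scaleC star_mult star_star
  show "a + b + c = a + (b + c)" "a + b = b + a" "0 + a = a" "- a + a = 0" "a - b = a + - b"
    "r *\<^sub>R (a + b) = r *\<^sub>R a + r *\<^sub>R b" "(r + s) *\<^sub>R a = r *\<^sub>R a + s *\<^sub>R a"
    "r *\<^sub>R s *\<^sub>R a = (r * s) *\<^sub>R a" "1 *\<^sub>R a = a" "z *\<^sub>C (a + b) = z *\<^sub>C a + z *\<^sub>C b"
    "(z + w) *\<^sub>C a = z *\<^sub>C a + w *\<^sub>C a" "z *\<^sub>C w *\<^sub>C a = (z * w) *\<^sub>C a"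
    "r *\<^sub>R a = complex_of_real r *\<^sub>C a" "a * b * c = a * (b * c)"
    "(a + b) * c = a * c + b * c" "a * (b + c) = a * b + a * c"
    "(z *\<^sub>C a) * b = z *\<^sub>C (a * b)" "a * (z *\<^sub>C b) = z *\<^sub>C (a * b)"
    "star (a + b) = star a + star b" "star (z *\<^sub>C a) = cnj z *\<^sub>C star a"
    "star (a * b) = star b * star a" "star (star a) = a"
    by (rule multiplier_eqI; simp add: defs simps add_ac)+
qed
end

section \<open>C*-correspondences\<close>

record ('e, 'a) correspondence =
  ract :: "'e \<Rightarrow> 'a \<Rightarrow> 'e"
  iprod :: "'e \<Rightarrow> 'e \<Rightarrow> 'a"
  lact :: "'a \<Rightarrow> 'e \<Rightarrow> 'e"

text \<open>
  The last clause ties the norm of the underlying Banach space to the inner product.  It makes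
  the inner product definite, and completeness of the module is completeness of the type.
\<close>

definition hilbert_module :: "('e::cbanach, 'a::cstar_algebra) correspondence \<Rightarrow> bool"
  where "hilbert_module E \<longleftrightarrow>
    (\<forall>x y a. ract E (x + y) a = ract E x a + ract E y a) \<and>
    (\<forall>c x a. ract E (c *\<^sub>C x) a = c *\<^sub>C ract E x a) \<and>
    (\<forall>x a b. ract E x (a + b) = ract E x a + ract E x b) \<and>
    (\<forall>c x a. ract E x (c *\<^sub>C a) = c *\<^sub>C ract E x a) \<and>
    (\<forall>x a b. ract E x (a * b) = ract E (ract E x a) b) \<and>
    (\<forall>x y z. iprod E x (y + z) = iprod E x y + iprod E x z) \<and>
    (\<forall>c x y. iprod E x (c *\<^sub>C y) = c *\<^sub>C iprod E x y) \<and>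
    (\<forall>x y a. iprod E x (ract E y a) = iprod E x y * a) \<and>
    (\<forall>x y. iprod E y x = star (iprod E x y)) \<and>
    (\<forall>x. cstar_positive (iprod E x x)) \<and>
    (\<forall>x. norm x = sqrt (norm (iprod E x x)))"

text \<open>
  The last clause says that \<open>lact E a\<close> is adjointable with adjoint \<open>lact E (star a)\<close>; in
  particular each \<open>lact E a\<close> is linear.  The clauses on \<open>lact\<close> together say that it is a
  *-homomorphism into the adjointable operators.
\<close>

definition cstar_correspondence :: "('e::cbanach, 'a::cstar_algebra) correspondence \<Rightarrow> bool"
  where "cstar_correspondence E \<longleftrightarrow> hilbert_module E \<and>
    (\<forall>a b x. lact E (a + b) x = lact E a x + lact E b x) \<and>
    (\<forall>c a x. lact E (c *\<^sub>C a) x = c *\<^sub>C lact E a x) \<and>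
    (\<forall>a b x. lact E (a * b) x = lact E a (lact E b x)) \<and>
    (\<forall>a x y. iprod E (lact E a x) y = iprod E x (lact E (star a) y))"

definition faithful :: "('e::cbanach, 'a::cstar_algebra) correspondence \<Rightarrow> bool"
  where "faithful E \<longleftrightarrow> inj (lact E)"

definition nondegenerate :: "('e::cbanach, 'a::cstar_algebra) correspondence \<Rightarrow> bool"
  where "nondegenerate E \<longleftrightarrow> closure (cspan {lact E a x | a x. True}) = UNIV"

definition full :: "('e::cbanach, 'a::cstar_algebra) correspondence \<Rightarrow> bool"
  where "full E \<longleftrightarrow> closure (cspan {iprod E x y | x y. True}) = UNIV"

definition countably_generated :: "('e::cbanach, 'a::cstar_algebra) correspondence \<Rightarrow> bool"
  where "countably_generated E \<longleftrightarrow>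
    (\<exists>S. countable S \<and> closure (cspan {ract E x a | x a. x \<in> S}) = UNIV)"

definition correspondence_iso ::
    "('e::cbanach, 'a::cstar_algebra) correspondence \<Rightarrow> ('f::cbanach, 'a) correspondence \<Rightarrow> ('e \<Rightarrow> 'f) \<Rightarrow> bool"
  where "correspondence_iso E F U \<longleftrightarrow> bij U \<and> clinear U \<and>
    (\<forall>x y. iprod F (U x) (U y) = iprod E x y) \<and>
    (\<forall>x a. U (ract E x a) = ract F (U x) a) \<and>
    (\<forall>a x. U (lact E a x) = lact F a (U x))"

definition isomorphic ::
    "('e::cbanach, 'a::cstar_algebra) correspondence \<Rightarrow> ('f::cbanach, 'a) correspondence \<Rightarrow> bool"
  where "isomorphic E F \<longleftrightarrow> (\<exists>U. correspondence_iso E F U)"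

definition multiplier_correspondence ::
    "('b::cstar_algebra \<Rightarrow> 'b multiplier) \<Rightarrow> ('b, 'b) correspondence"
  where "multiplier_correspondence \<rho> =
    \<lparr>ract = (\<lambda>x b. x * b), iprod = (\<lambda>x y. star x * y), lact = (\<lambda>b x. left_mult (\<rho> b) x)\<rparr>"

definition standard_correspondence :: "('b::cstar_algebra, 'b) correspondence"
  where "standard_correspondence =
    \<lparr>ract = (\<lambda>x b. x * b), iprod = (\<lambda>x y. star x * y), lact = (\<lambda>b x. b * x)\<rparr>"

lemma norm_eq_sqrt_cstar: "norm x = sqrt (norm (star x * x))" for x :: "'a::cstar_algebra"
  by (simp add: cstar_identity)

lemma cstar_correspondence_standard:
  "cstar_correspondence (standard_correspondence :: ('b::cstar_algebra, 'b) correspondence)"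
  unfolding cstar_correspondence_def hilbert_module_def standard_correspondence_def
  by (auto simp: algebra_simps mult_scaleC_left mult_scaleC_right star_mult star_star
      cstar_positive_def norm_eq_sqrt_cstar[symmetric])

lemma cstar_correspondence_multiplier:
  fixes \<rho> :: "'b::cstar_algebra \<Rightarrow> 'b multiplier"
  assumes "star_hom \<rho>"
  shows "cstar_correspondence (multiplier_correspondence \<rho>)"
proof -
  have adj: "star (left_mult m x) * y = star x * left_mult (star m) y" for m :: "'b multiplier" and x y
  proof -
    have "right_mult (star m) (star x) * y = star x * left_mult (star m) y"
      using double_centralizer_mult[of "star m"] by (simp add: double_centralizer_def)
    then show ?thesis by (simp add: left_right_mult star_star)
  qed
  show ?thesis
    using assms
    unfolding cstar_correspondence_def hilbert_module_def multiplier_correspondence_def star_hom_def clinear_iff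
    by (auto simp: algebra_simps mult_scaleC_left mult_scaleC_right star_mult star_star left_right_mult adj
        cstar_positive_def norm_eq_sqrt_cstar[symmetric])
qed

section \<open>Tensor products\<close>

text \<open>
  Tensor products are determined only up to isomorphism, so they are described by predicates on
  the canonical map \<open>t\<close>, where \<open>t u v\<close> is the elementary tensor of \<open>u\<close> and \<open>v\<close>.
\<close>

definition cbilinear :: "('u::complex_vector \<Rightarrow> 'v::complex_vector \<Rightarrow> 'w::complex_vector) \<Rightarrow> bool"
  where "cbilinear t \<longleftrightarrow> (\<forall>v. clinear (\<lambda>u. t u v)) \<and> (\<forall>u. clinear (\<lambda>v. t u v))"

abbreviation tensor_span :: "('u \<Rightarrow> 'v \<Rightarrow> 'w::complex_vector) \<Rightarrow> 'w set"
  where "tensor_span t \<equiv> cspan {t u v | u v. True}"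

text \<open>
  The second conjunct says that the linear map induced by \<open>t\<close> on the algebraic tensor product is
  injective, so that \<open>tensor_span t\<close> is a copy of the algebraic tensor product.
\<close>

definition algebraic_tensor :: "('u::complex_vector \<Rightarrow> 'v::complex_vector \<Rightarrow> 'w::complex_vector) \<Rightarrow> bool"
  where "algebraic_tensor t \<longleftrightarrow> cbilinear t \<and>
    (\<forall>F f. finite F \<and> complex_vector.independent F \<and> (\<Sum>v\<in>F. t (f v) v) = 0 \<longrightarrow> (\<forall>v\<in>F. f v = 0))"

definition cstar_norm_on :: "'t::star_algebra set \<Rightarrow> ('t \<Rightarrow> real) \<Rightarrow> bool"
  where "cstar_norm_on D \<gamma> \<longleftrightarrow>
    (\<forall>x\<in>D. 0 \<le> \<gamma> x \<and> (\<gamma> x = 0 \<longrightarrow> x = 0)) \<and>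
    (\<forall>x\<in>D. \<forall>y\<in>D. \<gamma> (x + y) \<le> \<gamma> x + \<gamma> y) \<and>
    (\<forall>c. \<forall>x\<in>D. \<gamma> (c *\<^sub>C x) = cmod c * \<gamma> x) \<and>
    (\<forall>x\<in>D. \<forall>y\<in>D. \<gamma> (x * y) \<le> \<gamma> x * \<gamma> y) \<and>
    (\<forall>x\<in>D. \<gamma> (star x * x) = (\<gamma> x)\<^sup>2)"

text \<open>
  The target is the completion of the algebraic tensor product *-algebra in its least C*-norm.
  (The target's norm restricts to a C*-norm on \<open>tensor_span t\<close>, being a C*-algebra norm.)
\<close>

definition minimal_tensor_product ::
    "('a::cstar_algebra \<Rightarrow> 'b::cstar_algebra \<Rightarrow> 't::cstar_algebra) \<Rightarrow> bool"
  where "minimal_tensor_product t \<longleftrightarrow> algebraic_tensor t \<and>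
    (\<forall>a a' b b'. t a b * t a' b' = t (a * a') (b * b')) \<and>
    (\<forall>a b. star (t a b) = t (star a) (star b)) \<and>
    closure (tensor_span t) = UNIV \<and>
    (\<forall>\<gamma>. cstar_norm_on (tensor_span t) \<gamma> \<longrightarrow> (\<forall>x\<in>tensor_span t. norm x \<le> \<gamma> x))"

text \<open>
  The Hausdorff completion of the algebraic tensor product of the two modules, for the inner
  product with values in the C*-tensor product \<open>t\<close>.
\<close>

definition exterior_tensor_product ::
    "('a::cstar_algebra \<Rightarrow> 'b::cstar_algebra \<Rightarrow> 't::cstar_algebra) \<Rightarrow>
     ('e::cbanach, 'a) correspondence \<Rightarrow> ('f::cbanach, 'b) correspondence \<Rightarrow>
     ('g::cbanach, 't) correspondence \<Rightarrow> ('e \<Rightarrow> 'f \<Rightarrow> 'g) \<Rightarrow> bool"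
  where "exterior_tensor_product t E F G \<tau> \<longleftrightarrow>
    cstar_correspondence G \<and> cbilinear \<tau> \<and>
    (\<forall>x y x' y'. iprod G (\<tau> x y) (\<tau> x' y') = t (iprod E x x') (iprod F y y')) \<and>
    (\<forall>x y a b. ract G (\<tau> x y) (t a b) = \<tau> (ract E x a) (ract F y b)) \<and>
    (\<forall>a b x y. lact G (t a b) (\<tau> x y) = \<tau> (lact E a x) (lact F b y)) \<and>
    closure (tensor_span \<tau>) = UNIV"

end

theory Submission
  imports Defs
begin

text \<open>
  A surjection preserving inner products from \<open>\<E> \<otimes> \<K>\<close> onto \<open>T = A \<otimes> \<K>\<close> carries the left action over
  to multipliers of \<open>T\<close>, so it suffices that the two are isomorphic as Hilbert modules.  Both are
  stable: isometries \<open>1 \<otimes> s\<^sub>i\<close> identify each with the direct sum of countably many copies of itself.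
  By an Eilenberg swindle it is then enough to embed each as a complemented submodule of the other.

  Take adjointable maps from \<open>M\<close> to a stable module \<open>N\<close>, countably many, whose adjoints have jointly
  dense range.  They combine to a single \<open>X\<close> from \<open>M\<close> to \<open>N\<close> such that \<open>X\<^sup>*\<close> has dense range.  With
  \<open>h = X\<^sup>* X\<close> and the Cayley transform \<open>c = (1 - h) / (1 + h)\<close>, the maps \<open>2 X (1 + h)\<^sup>-\<^sup>1 c\<^sup>m\<close> have squares
  summing to \<open>1\<close>, so placing them in the copies of \<open>N\<close> gives an isometry from \<open>M\<close> to \<open>N\<close>.  Embedding
  \<open>\<E> \<otimes> \<K>\<close> into \<open>T\<close> uses countable generation of \<open>\<E>\<close>; embedding \<open>T\<close> into \<open>\<E> \<otimes> \<K>\<close> uses fullness of \<open>\<E>\<close>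
  and a countable approximate unit of \<open>A\<close>.

  The only facts about positivity needed are that sums of positive elements of \<open>T\<close> are positive and
  that the norm is monotone on them; both follow from two isometries with orthogonal ranges.
\<close>

section \<open>Closed complex spans\<close>

lemma closure_cspan_add:
  fixes G :: "'a::complex_normed_vector set"
  assumes "x \<in> closure (cspan G)" "y \<in> closure (cspan G)"
  shows "x + y \<in> closure (cspan G)"
proof -
  obtain X Y where "\<forall>n. X n \<in> cspan G" "X \<longlonglongrightarrow> x" "\<forall>n. Y n \<in> cspan G" "Y \<longlonglongrightarrow> y"
    using assms unfolding closure_sequential by blast
  then show ?thesis
    unfolding closure_sequential
    by (intro exI[of _ "\<lambda>n. X n + Y n"]) (simp add: complex_vector.span_add tendsto_add)
qed

lemma closure_cspan_scale:
  fixes G :: "'a::complex_normed_vector set"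
  assumes "x \<in> closure (cspan G)"
  shows "c *\<^sub>C x \<in> closure (cspan G)"
proof -
  obtain X where "\<forall>n. X n \<in> cspan G" "X \<longlonglongrightarrow> x"
    using assms unfolding closure_sequential by blast
  then show ?thesis
    unfolding closure_sequential
    by (intro exI[of _ "\<lambda>n. c *\<^sub>C X n"])
       (simp add: complex_vector.span_scale bounded_linear.tendsto[OF bounded_linear_scaleC])
qed

lemma closure_cspan_superset:
  fixes A B :: "'a::complex_normed_vector set"
  assumes "closure (cspan A) = UNIV" "A \<subseteq> B"
  shows "closure (cspan B) = UNIV"
  using closure_mono[OF complex_vector.span_mono[OF assms(2)]] unfolding assms(1) by blast

lemma closure_cspan_induct [consumes 1]:
  fixes G :: "'a::complex_normed_vector set"
  assumes "x \<in> closure (cspan G)"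
    and add: "\<And>x y. P x \<Longrightarrow> P y \<Longrightarrow> P (x + y)" and scale: "\<And>c x. P x \<Longrightarrow> P (c *\<^sub>C x)"
    and gen: "\<And>x. x \<in> G \<Longrightarrow> P x" and lim: "\<And>X x. (\<And>n::nat. P (X n)) \<Longrightarrow> X \<longlonglongrightarrow> x \<Longrightarrow> P x"
    and zero: "P 0"
  shows "P x"
proof -
  have "P y" if "y \<in> cspan G" for y
    using that by (induction rule: complex_vector.span_induct_alt) (simp_all add: zero add scale gen)
  then show ?thesis using assms(1) lim unfolding closure_sequential by metis
qed

lemma eq_on_generators:
  fixes f g :: "'a::complex_normed_vector \<Rightarrow> 'b::complex_normed_vector"
  assumes dense: "closure (cspan G) = UNIV" and f: "clinear f" "continuous_on UNIV f"
    and g: "clinear g" "continuous_on UNIV g" and eq: "\<And>x. x \<in> G \<Longrightarrow> f x = g x"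
  shows "f x = g x"
proof -
  have lin: "f (x + y) = f x + f y" "f (c *\<^sub>C x) = c *\<^sub>C f x" "g (x + y) = g x + g y" "g (c *\<^sub>C x) = c *\<^sub>C g x"
    for x y c using f(1) g(1) by (simp_all add: clinear_iff)
  have "x \<in> closure (cspan G)" using dense by simp
  then show ?thesis
  proof (induction rule: closure_cspan_induct)
    case (4 X x)
    have "isCont f x" "isCont g x" using f(2) g(2) by (simp_all add: continuous_on_eq_continuous_at)
    then have "(\<lambda>n. f (X n)) \<longlonglongrightarrow> f x" "(\<lambda>n. g (X n)) \<longlonglongrightarrow> g x"
      using 4(2) by (simp_all add: isCont_tendsto_compose)
    then show ?case using LIMSEQ_unique 4(1) by simp
  next
    case 5
    show ?case using lin(1)[of 0 0] lin(3)[of 0 0] by simp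
  qed (simp_all add: lin eq)
qed

text \<open>The uniform bound makes the set of points with limit 0 closed: replacing
  \<open>x\<close> by \<open>X m\<close> costs at most \<open>C * norm (x - X m)\<close>, whatever
  \<open>n\<close> is.\<close>

lemma tendsto_zero_generators:
  fixes f :: "nat \<Rightarrow> 'a::complex_normed_vector \<Rightarrow> 'b::complex_normed_vector"
  assumes dense: "closure (cspan G) = UNIV" and lin: "\<And>n. clinear (f n)"
    and bound: "\<And>n x. norm (f n x) \<le> C * norm x" and gen: "\<And>x. x \<in> G \<Longrightarrow> (\<lambda>n. f n x) \<longlonglongrightarrow> 0"
  shows "(\<lambda>n. f n x) \<longlonglongrightarrow> 0"
proof -
  have add: "f n (x + y) = f n x + f n y" and scale: "f n (c *\<^sub>C x) = c *\<^sub>C f n x" for n x y c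
    using lin by (simp_all add: clinear_iff)
  have "x \<in> closure (cspan G)" using dense by simp
  then show ?thesis
  proof (induction rule: closure_cspan_induct)
    case (1 x y) then show ?case using tendsto_add[OF 1] by (simp add: add)
  next
    case (2 c x) then show ?case
      using bounded_linear.tendsto[OF bounded_linear_scaleC 2, of c] by (simp add: scale)
  next
    case (4 X x)
    show ?case
    proof (rule LIMSEQ_I)
      fix e :: real assume e: "0 < e"
      have "(\<lambda>m. C * norm (x - X m)) \<longlonglongrightarrow> C * norm (x - x)" by (intro tendsto_intros 4)
      then have "\<forall>\<^sub>F m in sequentially. C * norm (x - X m) < e / 2"
        using e by (intro order_tendstoD) auto
      then obtain m where m: "C * norm (x - X m) < e / 2"
        using eventually_happens'[OF sequentially_bot] by blast
      obtain N where N: "\<And>n. n \<ge> N \<Longrightarrow> norm (f n (X m) - 0) < e / 2"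
        using LIMSEQ_D[OF 4(1)[of m], of "e / 2"] e by auto
      have "norm (f n x - 0) < e" if "n \<ge> N" for n
      proof -
        have "f n x = f n (x - X m) + f n (X m)" using add[of n "x - X m" "X m"] by simp
        then have "norm (f n x) \<le> norm (f n (x - X m)) + norm (f n (X m))"
          by (simp add: norm_triangle_ineq)
        then show ?thesis using bound[of n "x - X m"] m N[OF that] by simp
      qed
      then show "\<exists>N. \<forall>n\<ge>N. norm (f n x - 0) < e" by blast
    qed
  next
    case 5 show ?case using add[of _ 0 0] by simp
  qed (rule gen)
qed

section \<open>Hilbert modules and adjointable maps\<close>

lemma
  assumes "hilbert_module M"
  shows iprod_add_right: "iprod M x (y + z) = iprod M x y + iprod M x z"
    and iprod_scaleC_right: "iprod M x (c *\<^sub>C y) = c *\<^sub>C iprod M x y"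
    and iprod_ract: "iprod M x (ract M y a) = iprod M x y * a"
    and iprod_star: "star (iprod M x y) = iprod M y x"
    and iprod_self_positive: "cstar_positive (iprod M x x)"
    and norm_iprod_self: "norm (iprod M x x) = (norm x)\<^sup>2"
proof -
  note M = assms[unfolded hilbert_module_def]
  show "iprod M x (y + z) = iprod M x y + iprod M x z"
    "iprod M x (c *\<^sub>C y) = c *\<^sub>C iprod M x y"
    "iprod M x (ract M y a) = iprod M x y * a" "cstar_positive (iprod M x x)"
    using M by blast+
  show "star (iprod M x y) = iprod M y x" using M by metis
  have "norm x = sqrt (norm (iprod M x x))" using M by blast
  then show "norm (iprod M x x) = (norm x)\<^sup>2" by simp
qed

lemma
  assumes M: "hilbert_module M"
  shows iprod_add_left: "iprod M (x + y) z = iprod M x z + iprod M y z"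
    and iprod_scaleC_left: "iprod M (c *\<^sub>C x) z = cnj c *\<^sub>C iprod M x z"
    and iprod_scaleR_right: "iprod M x (r *\<^sub>R z) = r *\<^sub>R iprod M x z"
    and iprod_scaleR_left: "iprod M (r *\<^sub>R x) z = r *\<^sub>R iprod M x z"
proof -
  have *: "iprod M u z = star (iprod M z u)" for u by (simp add: iprod_star[OF M])
  show "iprod M (x + y) z = iprod M x z + iprod M y z"
    unfolding * by (simp add: iprod_add_right[OF M] star_add)
  show sc: "iprod M (c *\<^sub>C x) z = cnj c *\<^sub>C iprod M x z" for c
    unfolding * by (simp add: iprod_scaleC_right[OF M] star_scaleC)
  show "iprod M x (r *\<^sub>R z) = r *\<^sub>R iprod M x z" "iprod M (r *\<^sub>R x) z = r *\<^sub>R iprod M x z"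
    by (simp_all add: scaleR_scaleC iprod_scaleC_right[OF M] sc)
qed

text \<open>The constant comes from polarization; the sharp Cauchy-Schwarz inequality is never needed.\<close>

lemma norm_iprod_le:
  assumes M: "hilbert_module M"
  shows "norm (iprod M x y) \<le> 4 * norm x * norm y"
proof -
  note simps = iprod_add_right[OF M] iprod_add_left[OF M] iprod_scaleC_right[OF M] iprod_scaleC_left[OF M]
  have unit: "norm (iprod M x y) \<le> 4" if "norm x \<le> 1" "norm y \<le> 1" for x y
  proof -
    let ?q = "\<lambda>c. iprod M (x + c *\<^sub>C y) (x + c *\<^sub>C y)"
    have pol: "4 *\<^sub>C iprod M x y = ?q 1 + (- 1) *\<^sub>C ?q (- 1) + (- \<i>) *\<^sub>C ?q \<i> + \<i> *\<^sub>C ?q (- \<i>)"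
    proof -
      have q: "?q c = (iprod M x x + iprod M y y) + (c *\<^sub>C iprod M x y + cnj c *\<^sub>C iprod M y x)"
        if "cnj c * c = 1" for c
        using that by (simp add: simps scaleC_add_right scaleC_scaleC scaleC_one mult.commute add_ac)
      have "4 *\<^sub>C iprod M x y = (2 + 2) *\<^sub>R iprod M x y" by (simp add: scaleR_scaleC)
      then have "4 *\<^sub>C iprod M x y = (iprod M x y + iprod M x y) + (iprod M x y + iprod M x y)"
        by (simp only: scaleR_add_left scaleR_2)
      then show ?thesis
        by (subst (1 2 3 4) q)
           (simp_all add: scaleC_add_right complex_vector.scale_right_diff_distrib scaleC_scaleC scaleC_one)
    qed
    have q: "norm (d *\<^sub>C ?q c) \<le> 4" if "cmod c = 1" "cmod d = 1" for c d
    proof -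
      have "norm (x + c *\<^sub>C y) \<le> 2"
        using norm_triangle_ineq[of x "c *\<^sub>C y"] \<open>norm x \<le> 1\<close> \<open>norm y \<le> 1\<close> that by (simp add: norm_scaleC)
      then have "(norm (x + c *\<^sub>C y))\<^sup>2 \<le> 2\<^sup>2" by (intro power_mono) auto
      then show ?thesis by (simp add: norm_scaleC that norm_iprod_self[OF M])
    qed
    have "norm (4 *\<^sub>C iprod M x y) \<le> 4 + 4 + 4 + 4"
      unfolding pol using q[of 1 1] q[of "- 1" "- 1"] q[of \<i> "- \<i>"] q[of "- \<i>" \<i>]
      by (intro norm_triangle_mono) (simp_all add: scaleC_one)
    then show ?thesis by (simp add: norm_scaleC)
  qed
  have scale: "iprod M x y = (norm x * norm y) *\<^sub>R iprod M (sgn x) (sgn y)"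
  proof (cases "x = 0 \<or> y = 0")
    case True
    then show ?thesis
      using iprod_scaleR_right[OF M, of x 0 0] iprod_scaleR_left[OF M, of 0 0 y] by auto
  qed (simp add: sgn_div_norm iprod_scaleR_right[OF M] iprod_scaleR_left[OF M] field_simps)
  have "norm (iprod M (sgn x) (sgn y)) \<le> 4" by (rule unit) (simp_all add: norm_sgn)
  then show ?thesis
    unfolding scale norm_scaleR
    using mult_left_mono[of "norm (iprod M (sgn x) (sgn y))" 4 "norm x * norm y"] by (simp add: mult_ac)
qed

lemma bounded_bilinear_iprod:
  assumes M: "hilbert_module M"
  shows "bounded_bilinear (iprod M)"
  by unfold_locales
     (auto simp: iprod_add_left[OF M] iprod_add_right[OF M] iprod_scaleR_left[OF M]
        iprod_scaleR_right[OF M] mult_ac intro!: exI[of _ 4] order_trans[OF norm_iprod_le[OF M]])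

lemmas iprod_zero_left = bounded_bilinear.zero_left[OF bounded_bilinear_iprod]
  and iprod_zero_right = bounded_bilinear.zero_right[OF bounded_bilinear_iprod]
  and iprod_diff_left = bounded_bilinear.diff_left[OF bounded_bilinear_iprod]
  and iprod_diff_right = bounded_bilinear.diff_right[OF bounded_bilinear_iprod]
  and iprod_minus_left = bounded_bilinear.minus_left[OF bounded_bilinear_iprod]
  and iprod_minus_right = bounded_bilinear.minus_right[OF bounded_bilinear_iprod]
  and iprod_sum_left = bounded_bilinear.sum_left[OF bounded_bilinear_iprod]
  and iprod_sum_right = bounded_bilinear.sum_right[OF bounded_bilinear_iprod]
  and tendsto_iprod = bounded_bilinear.tendsto[OF bounded_bilinear_iprod]

lemmas iprod_linear = iprod_zero_left iprod_zero_right iprod_add_left iprod_add_right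
  iprod_diff_left iprod_diff_right iprod_minus_left iprod_minus_right
  iprod_scaleC_left iprod_scaleC_right iprod_scaleR_left iprod_scaleR_right
  iprod_sum_left iprod_sum_right

lemma iprod_eqI:
  assumes M: "hilbert_module M" and "\<And>z. iprod M z x = iprod M z y"
  shows "x = y"
proof -
  have "(norm (x - y))\<^sup>2 = norm (iprod M (x - y) (x - y))" by (simp only: norm_iprod_self[OF M])
  also have "\<dots> = 0" by (simp add: iprod_diff_right[OF M] assms(2))
  finally show ?thesis by simp
qed

text \<open>Only inner products are compared, so no linear map taking \<open>u\<close> to
  \<open>v\<close> has to exist yet. This is how \<open>preserving_extension\<close> sees that image
  sequences are Cauchy.\<close>

lemma norm_diff_iprod:
  assumes M: "hilbert_module M" and N: "hilbert_module N"
    and "iprod N v v = iprod M u u" "iprod N v v' = iprod M u u'"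
      "iprod N v' v = iprod M u' u" "iprod N v' v' = iprod M u' u'"
  shows "norm (v - v') = norm (u - u')"
proof -
  have "(norm (v - v'))\<^sup>2 = (norm (u - u'))\<^sup>2"
    unfolding norm_iprod_self[OF M, symmetric] norm_iprod_self[OF N, symmetric]
    by (simp add: iprod_linear[OF M] iprod_linear[OF N] assms(3-))
  then show ?thesis by simp
qed

text \<open>The adjoint is carried as a second map because not every bounded module map has one.
  Linearity is not demanded: it follows by moving the map to the other side of the inner
  product.\<close>

definition adjoint_pair ::
    "('m::cbanach, 'a::cstar_algebra) correspondence \<Rightarrow> ('n::cbanach, 'a) correspondence \<Rightarrow>
     ('m \<Rightarrow> 'n) \<Rightarrow> ('n \<Rightarrow> 'm) \<Rightarrow> bool"
  where "adjoint_pair M N f g \<longleftrightarrow> (\<forall>x y. iprod N (f x) y = iprod M x (g y))"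

lemma adjoint_pairD: "adjoint_pair M N f g \<Longrightarrow> iprod N (f x) y = iprod M x (g y)"
  by (simp add: adjoint_pair_def)

lemma adjoint_pair_sym:
  assumes "hilbert_module M" "hilbert_module N" "adjoint_pair M N f g"
  shows "adjoint_pair N M g f"
  using assms(3) unfolding adjoint_pair_def
  by (metis iprod_star[OF assms(1)] iprod_star[OF assms(2)])

lemma adjoint_pair_comp:
  "adjoint_pair M N f g \<Longrightarrow> adjoint_pair N L f' g' \<Longrightarrow> adjoint_pair M L (\<lambda>x. f' (f x)) (\<lambda>y. g (g' y))"
  by (simp add: adjoint_pair_def)

lemma adjoint_pair_linear:
  assumes M: "hilbert_module M" and N: "hilbert_module N" and f: "adjoint_pair M N f g"
  shows "f (x + y) = f x + f y" "f (c *\<^sub>C x) = c *\<^sub>C f x" "f (x - y) = f x - f y"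
    "f 0 = 0" "f (r *\<^sub>R x) = r *\<^sub>R f x" "f (sum h I) = (\<Sum>i\<in>I. f (h i))" "f (- x) = - f x"
proof -
  note g = adjoint_pairD[OF adjoint_pair_sym[OF M N f], symmetric]
  show "f (x + y) = f x + f y" "f (c *\<^sub>C x) = c *\<^sub>C f x" "f (x - y) = f x - f y"
    "f 0 = 0" "f (r *\<^sub>R x) = r *\<^sub>R f x" "f (sum h I) = (\<Sum>i\<in>I. f (h i))" "f (- x) = - f x"
    by (rule iprod_eqI[OF N]; simp add: g iprod_linear[OF M] iprod_linear[OF N])+
qed

lemma iprod_eqI_generators:
  assumes M: "hilbert_module M" and dense: "closure (cspan G) = UNIV"
    and eq: "\<And>v. v \<in> G \<Longrightarrow> iprod M v x = iprod M v y"
  shows "x = y"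
proof -
  have "iprod M (x - y) z = 0" for z
  proof (rule eq_on_generators[OF dense, of "iprod M (x - y)" "\<lambda>_. 0"])
    show "clinear (iprod M (x - y))" "clinear (\<lambda>_. 0)"
      by (simp_all add: clinear_iff iprod_add_right[OF M] iprod_scaleC_right[OF M])
    show "continuous_on UNIV (iprod M (x - y))"
      by (intro linear_continuous_on bounded_bilinear.bounded_linear_right[OF bounded_bilinear_iprod[OF M]])
    fix v assume "v \<in> G"
    then have "iprod M v (x - y) = 0" by (simp add: iprod_diff_right[OF M] eq)
    then show "iprod M (x - y) v = 0" by (metis iprod_star[OF M] star_zero)
  qed simp
  then have "iprod M z x = iprod M z y" for z
    by (metis iprod_star[OF M] star_zero iprod_diff_right[OF M] right_minus_eq)
  then show ?thesis by (rule iprod_eqI[OF M])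
qed

text \<open>An isometric module map need not have an adjoint, so adjoint values are required on a
  generating set and extended by continuity. If \<open>Z n\<close> is the value at
  \<open>Y n\<close>, pairing \<open>Z m - Z n\<close> with itself gives
  \<open>norm (Z m - Z n) \<le> 4 * norm (Y m - Y n)\<close>, so the values converge.\<close>

lemma preserving_adjoint:
  assumes M: "hilbert_module M" and N: "hilbert_module N"
    and V: "\<And>x y. iprod N (V x) (V y) = iprod M x y"
    and dense: "closure (cspan G) = UNIV" and G: "\<And>y. y \<in> G \<Longrightarrow> \<exists>z. \<forall>x. iprod N (V x) y = iprod M x z"
  shows "\<exists>Va. adjoint_pair M N V Va"
proof -
  have D: "\<exists>z. \<forall>x. iprod N (V x) y = iprod M x z" if "y \<in> cspan G" for y
    using that
  proof (induction rule: complex_vector.span_induct_alt)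
    case base
    show ?case by (rule exI[of _ 0]) (simp add: iprod_linear[OF M] iprod_linear[OF N])
  next
    case (step c y y')
    obtain z where z: "\<And>x. iprod N (V x) y = iprod M x z" using G[OF step(1)] by blast
    obtain z' where z': "\<And>x. iprod N (V x) y' = iprod M x z'" using step(2) by blast
    show ?case
      by (rule exI[of _ "c *\<^sub>C z + z'"]) (simp add: iprod_linear[OF M] iprod_linear[OF N] z z')
  qed
  have "\<exists>z. \<forall>x. iprod N (V x) y = iprod M x z" for y
  proof -
    obtain Y where Y: "\<And>n. Y n \<in> cspan G" "Y \<longlonglongrightarrow> y"
      using dense closure_sequential[of y "cspan G"] by auto
    obtain Z where Z: "\<And>n x. iprod N (V x) (Y n) = iprod M x (Z n)" using D[OF Y(1)] by metis
    have norm_V: "norm (V x) = norm x" for x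
      using norm_iprod_self[OF M, of x] norm_iprod_self[OF N, of "V x"] V by simp
    have le: "norm (Z m - Z n) \<le> 4 * norm (Y m - Y n)" for m n
    proof -
      let ?d = "Z m - Z n"
      have "norm ?d * norm ?d = norm (iprod M ?d ?d)"
        by (simp add: norm_iprod_self[OF M] power2_eq_square)
      also have "iprod M ?d ?d = iprod N (V ?d) (Y m - Y n)"
        by (simp only: iprod_diff_right[OF M, of ?d] iprod_diff_right[OF N] Z)
      also have "norm \<dots> \<le> 4 * norm ?d * norm (Y m - Y n)"
        using norm_iprod_le[OF N, of "V ?d" "Y m - Y n"] by (simp add: norm_V)
      finally have "norm ?d * norm ?d \<le> norm ?d * (4 * norm (Y m - Y n))" by (simp add: mult_ac)
      then show ?thesis by (cases "norm ?d = 0") (auto simp: mult_le_cancel_left less_le)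
    qed
    have "Cauchy Z"
      unfolding Cauchy_def dist_norm
    proof (intro allI impI)
      fix e :: real assume "0 < e"
      then obtain K where K: "\<forall>m\<ge>K. \<forall>n\<ge>K. norm (Y m - Y n) < e / 4"
        using LIMSEQ_imp_Cauchy[OF Y(2)] unfolding Cauchy_def dist_norm
        by (metis divide_pos_pos zero_less_numeral)
      have "norm (Z m - Z n) < e" if "m \<ge> K" "n \<ge> K" for m n
        using le[of m n] K that by fastforce
      then show "\<exists>K. \<forall>m\<ge>K. \<forall>n\<ge>K. norm (Z m - Z n) < e" by blast
    qed
    then obtain z where z: "Z \<longlonglongrightarrow> z" by (auto simp: Cauchy_convergent_iff convergent_def)
    have "iprod N (V x) y = iprod M x z" for x
    proof (rule LIMSEQ_unique)
      show "(\<lambda>n. iprod N (V x) (Y n)) \<longlonglongrightarrow> iprod N (V x) y"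
        by (intro tendsto_iprod[OF N] tendsto_const Y)
      show "(\<lambda>n. iprod N (V x) (Y n)) \<longlonglongrightarrow> iprod M x z"
        unfolding Z by (intro tendsto_iprod[OF M] tendsto_const z)
    qed
    then show ?thesis by blast
  qed
  then show ?thesis unfolding adjoint_pair_def by metis
qed

text \<open>\<open>R\<close> is a relation since a vector may come with several representations;
  preserving inner products makes it single-valued and isometric. By completeness its closure
  \<open>R'\<close> is defined everywhere, and \<open>V\<close> selects its values.\<close>

lemma preserving_extension:
  assumes M: "hilbert_module M" and N: "hilbert_module N"
    and R: "\<And>u v u' v'. R u v \<Longrightarrow> R u' v' \<Longrightarrow> iprod N v v' = iprod M u u'"
    and dense: "closure {u. \<exists>v. R u v} = UNIV"
  shows "\<exists>V. (\<forall>x y. iprod N (V x) (V y) = iprod M x y) \<and> (\<forall>u v. R u v \<longrightarrow> V u = v)"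
proof -
  define R' where "R' x z \<longleftrightarrow> (\<exists>U W. (\<forall>n::nat. R (U n) (W n)) \<and> U \<longlonglongrightarrow> x \<and> W \<longlonglongrightarrow> z)" for x z
  have ex: "\<exists>z. R' x z" for x
  proof -
    obtain U where U: "\<And>n. \<exists>v. R (U n) v" "U \<longlonglongrightarrow> x"
      using dense closure_sequential[of x "{u. \<exists>v. R u v}"] by auto
    then obtain W where W: "\<And>n. R (U n) (W n)" by metis
    have "norm (W m - W n) = norm (U m - U n)" for m n
      by (intro norm_diff_iprod[OF M N] R W)
    then have "Cauchy W"
      using LIMSEQ_imp_Cauchy[OF U(2)] unfolding Cauchy_def dist_norm by simp
    then show ?thesis
      unfolding R'_def using U(2) W by (auto simp: Cauchy_convergent_iff convergent_def)
  qed
  have pres: "iprod N z z' = iprod M x x'" if R': "R' x z" "R' x' z'" for x z x' z'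
  proof -
    obtain U W U' W' where *: "\<And>n. R (U n) (W n)" "U \<longlonglongrightarrow> x" "W \<longlonglongrightarrow> z"
      "\<And>n. R (U' n) (W' n)" "U' \<longlonglongrightarrow> x'" "W' \<longlonglongrightarrow> z'"
      using R' unfolding R'_def by metis
    have "(\<lambda>n. iprod N (W n) (W' n)) \<longlonglongrightarrow> iprod N z z'" by (intro tendsto_iprod[OF N] *)
    moreover have "(\<lambda>n. iprod N (W n) (W' n)) \<longlonglongrightarrow> iprod M x x'"
      unfolding R[OF *(1,4)] by (intro tendsto_iprod[OF M] *)
    ultimately show ?thesis by (rule LIMSEQ_unique)
  qed
  obtain V where V: "\<And>x. R' x (V x)" using ex by metis
  have "V u = v" if "R u v" for u v
  proof -
    have "R' u v" unfolding R'_def using that by (auto intro!: exI[of _ "\<lambda>_. u"] exI[of _ "\<lambda>_. v"])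
    then have "norm (V u - v) = norm (u - u)" by (intro norm_diff_iprod[OF M N] pres V)
    then show ?thesis by simp
  qed
  then show ?thesis using pres V by blast
qed

text \<open>Equal inner products make the assignment of \<open>g' i\<close> to \<open>g i\<close>
  well defined on linear combinations, even when the \<open>g i\<close> are linearly
  dependent.\<close>

lemma preserving_on_generators:
  assumes M: "hilbert_module M" and N: "hilbert_module N"
    and g: "\<And>i j. iprod N (g' i) (g' j) = iprod M (g i) (g j)"
    and dense: "closure (cspan (range g)) = UNIV"
  shows "\<exists>V. (\<forall>x y. iprod N (V x) (V y) = iprod M x y) \<and> (\<forall>i. V (g i) = g' i)"
proof -
  define R where "R u v \<longleftrightarrow> (\<exists>I c. finite I \<and> u = (\<Sum>i\<in>I. c i *\<^sub>C g i) \<and> v = (\<Sum>i\<in>I. c i *\<^sub>C g' i))" for u v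
  have "\<exists>v. R u v" if u: "u \<in> cspan (range g)" for u
  proof -
    obtain F r where F: "finite F" "F \<subseteq> range g" "u = (\<Sum>a\<in>F. r a *\<^sub>C a)"
      using u unfolding complex_vector.span_explicit by auto
    \<comment> \<open>\<open>g\<close> may repeat values, so an index set on which it is injective
      is chosen before the coefficients are moved to indices.\<close>
    obtain I where I: "inj_on g I" "F = g ` I" using F(2) by (meson subset_image_inj)
    then have "finite I" using F(1) finite_image_iff by blast
    then
    show ?thesis
      unfolding R_def F(3) I(2) by (subst sum.reindex[OF I(1)]) (auto intro!: exI[of _ I] exI[of _ "\<lambda>i. r (g i)"])
  qed
  then have "cspan (range g) \<subseteq> {u. \<exists>v. R u v}" by blast
  from closure_mono[OF this] have "closure {u. \<exists>v. R u v} = UNIV" using dense by blast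
  moreover have "iprod N v v' = iprod M u u'" if "R u v" "R u' v'" for u v u' v'
    using that unfolding R_def by (auto simp: iprod_linear[OF M] iprod_linear[OF N] g)
  ultimately obtain V where V: "\<And>x y. iprod N (V x) (V y) = iprod M x y" "\<And>u v. R u v \<Longrightarrow> V u = v"
    using preserving_extension[OF M N] by metis
  have "R (g i) (g' i)" for i
    unfolding R_def by (rule exI[of _ "{i}"], rule exI[of _ "\<lambda>_. 1"]) (simp add: scaleC_one)
  then show ?thesis using V by blast
qed

text \<open>The defect, for example \<open>V (x + y) - (V x + V y)\<close>, paired with itself
  expands into inner products that cancel, so it vanishes.\<close>

lemma preserving_linear:
  assumes M: "hilbert_module M" and N: "hilbert_module N"
    and V: "\<And>x y. iprod N (V x) (V y) = iprod M x y"
  shows "V (x + y) = V x + V y" "V (c *\<^sub>C x) = c *\<^sub>C V x" "V (x - y) = V x - V y"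
    "norm (V x) = norm x" "V (ract M x a) = ract N (V x) a"
proof -
  have eqI: "u = v" if "iprod N (u - v) (u - v) = 0" for u v
    using that norm_iprod_self[OF N, of "u - v"] by simp
  note lin = iprod_linear[OF M] iprod_linear[OF N] V
  have ract: "iprod M (ract M x a) y = star a * iprod M x y" "iprod N (ract N v a) w = star a * iprod N v w" for x y v w
    by (metis iprod_star[OF M] iprod_ract[OF M] star_mult) (metis iprod_star[OF N] iprod_ract[OF N] star_mult)
  show add: "V (x + y) = V x + V y" and diff: "V (x - y) = V x - V y" for x y
    by (rule eqI; simp add: lin)+
  show "V (c *\<^sub>C x) = c *\<^sub>C V x" by (rule eqI) (simp add: lin)
  show "V (ract M x a) = ract N (V x) a"
    by (rule eqI) (simp add: lin ract iprod_ract[OF M] iprod_ract[OF N] mult.assoc)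
  have "(norm (V x))\<^sup>2 = (norm x)\<^sup>2"
    unfolding norm_iprod_self[OF M, symmetric] norm_iprod_self[OF N, symmetric] V ..
  then show "norm (V x) = norm x" by simp
qed

section \<open>Monotonicity of the norm on positive elements\<close>

text \<open>True in every C*-algebra; for a stable one this needs no spectral theory.\<close>

definition norm_monotone :: "'a::cstar_algebra itself \<Rightarrow> bool"
  where "norm_monotone _ \<longleftrightarrow> (\<forall>a b :: 'a. cstar_positive a \<longrightarrow> cstar_positive b \<longrightarrow>
    cstar_positive (a + b) \<and> norm a \<le> norm (a + b))"

lemma
  assumes "norm_monotone TYPE('a::cstar_algebra)" "cstar_positive (a :: 'a)" "cstar_positive b"
  shows positive_add: "cstar_positive (a + b)" and norm_le_norm_add: "norm a \<le> norm (a + b)"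
  using assms unfolding norm_monotone_def by blast+

lemma cstar_positive_zero [simp]: "cstar_positive 0"
  unfolding cstar_positive_def by (metis mult_zero_right)

lemma cstar_positive_scaleR:
  assumes "cstar_positive a" "0 \<le> r"
  shows "cstar_positive (r *\<^sub>R a)"
proof -
  obtain b where "a = star b * b" using assms unfolding cstar_positive_def by blast
  then have "r *\<^sub>R a = star (sqrt r *\<^sub>R b) * (sqrt r *\<^sub>R b)"
    using assms(2) by (simp add: star_scaleR)
  then show ?thesis unfolding cstar_positive_def by blast
qed

lemma positive_sum:
  assumes "norm_monotone TYPE('a::cstar_algebra)" "\<And>i. i \<in> I \<Longrightarrow> cstar_positive (f i :: 'a)"
  shows "cstar_positive (sum f I)"
  using assms(2) by (induction I rule: infinite_finite_induct) (auto intro: positive_add[OF assms(1)])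

text \<open>This is the substitute for operator inequalities: a contraction estimate is proved by
  exhibiting the missing part as \<open>iprod L z z\<close>.\<close>

lemma norm_le_of_iprod_add:
  fixes M :: "('m::cbanach, 'a::cstar_algebra) correspondence"
  assumes mono: "norm_monotone TYPE('a)" and M: "hilbert_module M" and N: "hilbert_module N" and L: "hilbert_module L"
    and "iprod N y y + iprod L z z = iprod M x x"
  shows "norm y \<le> norm x"
proof -
  have "norm (iprod N y y) \<le> norm (iprod M x x)"
    unfolding assms(5)[symmetric]
    by (intro norm_le_norm_add[OF mono] iprod_self_positive N L)
  then show ?thesis by (simp add: norm_iprod_self[OF M] norm_iprod_self[OF N])
qed

lemma hilbert_module_standard: "hilbert_module (standard_correspondence :: ('a::cstar_algebra, 'a) correspondence)"
  using cstar_correspondence_standard[where ?'b='a] by (simp add: cstar_correspondence_def)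

lemma iprod_standard [simp]: "iprod standard_correspondence x y = star x * y"
  and ract_standard [simp]: "ract standard_correspondence x b = x * b"
  and lact_standard [simp]: "lact standard_correspondence b x = b * x"
  by (simp_all add: standard_correspondence_def)

text \<open>
  If \<open>\<gamma> = V\<^sub>0 a + V\<^sub>1 b\<close> then \<open>\<gamma>\<^sup>* \<gamma> = a\<^sup>* a + b\<^sup>* b\<close>, and \<open>V\<^sub>0 a - V\<^sub>1 b\<close> has the same norm as \<open>\<gamma>\<close>.
\<close>

lemma norm_monotoneI:
  fixes V0 V1 :: "'a::cstar_algebra \<Rightarrow> 'a"
  assumes V0: "\<And>x y. star (V0 x) * V0 y = star x * y" and V1: "\<And>x y. star (V1 x) * V1 y = star x * y"
    and V01: "\<And>x y. star (V0 x) * V1 y = 0"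
  shows "norm_monotone TYPE('a)"
  unfolding norm_monotone_def
proof (intro allI impI)
  fix a b :: 'a assume "cstar_positive a" "cstar_positive b"
  then obtain x y where xy: "a = star x * x" "b = star y * y" unfolding cstar_positive_def by blast
  have V10: "star (V1 x) * V0 y = 0" for x y
    using V01[of y x] by (metis star_mult star_star star_zero)
  let ?g = "V0 x + V1 y" and ?h = "V0 x - V1 y"
  have g: "star ?g * ?g = a + b" and h: "star ?h * ?h = a + b"
    by (simp_all add: star_add star_diff algebra_simps V0 V1 V01 V10 xy)
  have "(norm (V0 x))\<^sup>2 = (norm x)\<^sup>2" by (simp add: cstar_identity[symmetric] V0)
  moreover have "(norm ?h)\<^sup>2 = (norm ?g)\<^sup>2" by (simp add: cstar_identity[symmetric] g h)
  \<comment> \<open>\<open>?g + ?h\<close> is twice \<open>V0 x\<close>, and the two summands have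
    equal norm.\<close>
  moreover have "norm (V0 x + V0 x) \<le> norm ?g + norm ?h" using norm_triangle_ineq[of ?g ?h] by simp
  ultimately have "norm x \<le> norm ?g" by (simp flip: scaleR_2)
  then have "(norm x)\<^sup>2 \<le> (norm ?g)\<^sup>2" by (intro power_mono) auto
  then have "norm a \<le> norm (a + b)" by (simp add: cstar_identity[symmetric] g xy)
  moreover have "cstar_positive (a + b)" unfolding cstar_positive_def using g by metis
  ultimately show "cstar_positive (a + b) \<and> norm a \<le> norm (a + b)" by blast
qed

text \<open>
  This is \<open>h = 1 - (1 - f)\<^sup>2\<close>: a square root of \<open>1 - h\<close> in the unitization, found as the fixed
  point of \<open>f \<mapsto> (h + f\<^sup>2) / 2\<close>.
\<close>

lemma selfadjoint_sqrt:
  fixes h :: "'a::cstar_algebra"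
  assumes sa: "star h = h" and h: "norm h \<le> 3/4"
  shows "\<exists>f. star f = f \<and> h = f + f - f * f"
proof -
  \<comment> \<open>The radius fits: \<open>(3/4 + 1/4) / 2 = 1/2\<close>, so \<open>T\<close> maps
    \<open>S\<close> to itself, and squaring is 1-Lipschitz on \<open>S\<close>, so \<open>T\<close>
    contracts by \<open>1/2\<close>. Self-adjointness is a closed condition, so the fixed point
    inherits it from \<open>S\<close>.\<close>
  define S where "S = {f :: 'a. star f = f \<and> norm f \<le> 1/2}"
  define T where "T f = (1/2) *\<^sub>R (h + f * f)" for f
  have "isCont star x" for x :: 'a by (rule linear_continuous_at[OF bounded_linear_star])
  then have "continuous_on UNIV (star :: 'a \<Rightarrow> 'a)" by (simp add: continuous_on_eq_continuous_at)
  then have "closed S"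
    unfolding S_def
    by (intro closed_Collect_conj closed_Collect_eq closed_Collect_le continuous_intros) auto
  moreover have "0 \<in> S" by (simp add: S_def star_zero)
  moreover have "T f \<in> S" if "f \<in> S" for f
  proof -
    have f: "star f = f" "norm f \<le> 1/2" using that by (auto simp: S_def)
    have "norm (f * f) \<le> norm f * norm f" by (rule norm_mult_ineq)
    also have "\<dots> \<le> 1/2 * (1/2)" using f(2) by (intro mult_mono) auto
    finally have "norm (h + f * f) \<le> 1" using norm_triangle_ineq[of h "f * f"] h by simp
    then show ?thesis by (simp add: S_def T_def star_scaleR star_add star_mult f sa)
  qed
  moreover have "dist (T f) (T g) \<le> 1/2 * dist f g" if "f \<in> S" "g \<in> S" for f g
  proof -
    have fg: "norm f \<le> 1/2" "norm g \<le> 1/2" using that by (auto simp: S_def)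
    have "norm (f * f - g * g) = norm (f * (f - g) + (f - g) * g)" by (simp add: algebra_simps)
    also have "\<dots> \<le> norm f * norm (f - g) + norm (f - g) * norm g"
      by (intro norm_triangle_mono norm_mult_ineq)
    also have "\<dots> \<le> 1/2 * norm (f - g) + norm (f - g) * (1/2)"
      using fg by (intro add_mono mult_mono) auto
    finally have "norm (f * f - g * g) \<le> norm (f - g)" by simp
    moreover have "T f - T g = (1/2) *\<^sub>R (f * f - g * g)"
      by (simp add: T_def scaleR_diff_right scaleR_add_right)
    ultimately show ?thesis by (simp add: dist_norm)
  qed
  ultimately have "\<exists>!f\<in>S. T f = f"
    by (intro Banach_fix[of S "1/2" T]) (auto simp: complete_eq_closed)
  then obtain f where f: "f \<in> S" "T f = f" by blast
  have "2 *\<^sub>R f = 2 *\<^sub>R T f" by (simp add: f)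
  also have "\<dots> = h + f * f" by (simp add: T_def)
  finally have "f + f = h + f * f" by (simp add: scaleR_2)
  then show ?thesis using f(1) by (auto simp: S_def algebra_simps)
qed

section \<open>Bounds for left actions\<close>

lemma rescale_half:
  fixes b :: "'b::real_normed_vector"
  assumes "b \<noteq> 0"
  obtains r b' where "b = r *\<^sub>R b'" "\<bar>r\<bar> = 2 * norm b" "norm b' = 1/2"
  using assms that[of "2 * norm b" "(1 / (2 * norm b)) *\<^sub>R b"] by simp

text \<open>In the unitization the equation says that \<open>star b * b\<close> and the square of
  \<open>1 - f\<close> add up to 1. Hence acting by \<open>b\<close> and by \<open>1 - f\<close>
  together preserves inner products, which shows that \<open>b\<close> acts contractively.\<close>

lemma sqrt_of_half:
  fixes b :: "'a::cstar_algebra"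
  assumes "norm b = 1/2"
  obtains f where "star f = f" "star b * b + f * f = f + f"
proof -
  have "norm (star b * b) \<le> 3/4" by (simp add: cstar_identity assms power2_eq_square)
  then obtain f where "star f = f" "star b * b = f + f - f * f"
    using selfadjoint_sqrt[of "star b * b"] by (auto simp: star_mult star_star)
  then show ?thesis by (intro that[of f]) simp_all
qed

text \<open>The definition of a correspondence has only algebraic clauses for \<open>lact\<close>,
  so boundedness is derived. An element of norm \<open>1/2\<close> acts as a contraction by
  \<open>sqrt_of_half\<close>; rescaling costs the factor 2.\<close>

lemma norm_lact_le:
  fixes E :: "('e::cbanach, 'a::cstar_algebra) correspondence"
  assumes mono: "norm_monotone TYPE('a)" and E: "cstar_correspondence E"
  shows "norm (lact E b x) \<le> 2 * norm b * norm x"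
proof -
  have M: "hilbert_module E" using E by (simp add: cstar_correspondence_def)
  have lact: "lact E (a + b) x = lact E a x + lact E b x" "lact E (c *\<^sub>C a) x = c *\<^sub>C lact E a x"
    "lact E (a * b) x = lact E a (lact E b x)" "iprod E (lact E a x) y = iprod E x (lact E (star a) y)"
    for a b c x y using E by (auto simp: cstar_correspondence_def)
  show ?thesis
  proof (cases "b = 0")
    case True
    have "lact E 0 x = 0" using lact(1)[of 0 0 x] by simp
    then show ?thesis using True by simp
  next
    case False
    then obtain r b' where b': "b = r *\<^sub>R b'" "\<bar>r\<bar> = 2 * norm b" "norm b' = 1/2" by (rule rescale_half)
    obtain f where f: "star f = f" "star b' * b' + f * f = f + f" using sqrt_of_half[OF b'(3)] .
    have "iprod E x (lact E (star b' * b' + f * f) x) = iprod E x (lact E (f + f) x)" by (simp only: f)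
    then have "iprod E (lact E b' x) (lact E b' x) + iprod E (x - lact E f x) (x - lact E f x) = iprod E x x"
      by (simp add: iprod_linear[OF M] lact f algebra_simps)
    then have "norm (lact E b' x) \<le> norm x" by (rule norm_le_of_iprod_add[OF mono M M M])
    moreover have "lact E b x = r *\<^sub>R lact E b' x" by (simp add: b'(1) scaleR_scaleC lact)
    ultimately show ?thesis using b'(2) by (simp add: mult_left_mono)
  qed
qed

section \<open>Norm estimates for tensor products\<close>

lemma
  assumes "cbilinear t"
  shows bilinear_add_left: "t (u + u') v = t u v + t u' v"
    and bilinear_add_right: "t u (v + v') = t u v + t u v'"
    and bilinear_scaleC_left: "t (c *\<^sub>C u) v = c *\<^sub>C t u v"
    and bilinear_scaleC_right: "t u (c *\<^sub>C v) = c *\<^sub>C t u v"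
    and bilinear_scaleR_left: "t (r *\<^sub>R u) v = r *\<^sub>R t u v"
    and bilinear_scaleR_right: "t u (r *\<^sub>R v) = r *\<^sub>R t u v"
    and bilinear_zero_left: "t 0 v = 0" and bilinear_zero_right: "t u 0 = 0"
    and bilinear_diff_left: "t (u - u') v = t u v - t u' v"
    and bilinear_diff_right: "t u (v - v') = t u v - t u v'"
    and bilinear_sum_left: "t (sum f I) v = (\<Sum>i\<in>I. t (f i) v)"
    and bilinear_sum_right: "t u (sum h I) = (\<Sum>i\<in>I. t u (h i))"
proof -
  show add: "t (u + u') v = t u v + t u' v" "t u (v + v') = t u v + t u v'"
    "t (c *\<^sub>C u) v = c *\<^sub>C t u v" "t u (c *\<^sub>C v) = c *\<^sub>C t u v" for u u' v v' c
    using assms by (auto simp: cbilinear_def clinear_iff)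
  show "t (r *\<^sub>R u) v = r *\<^sub>R t u v" "t u (r *\<^sub>R v) = r *\<^sub>R t u v" by (simp_all add: scaleR_scaleC add)
  show zero: "t 0 v = 0" "t u 0 = 0" for u v using add(1)[of 0 0 v] add(2)[of u 0 0] by simp_all
  show "t (u - u') v = t u v - t u' v" "t u (v - v') = t u v - t u v'"
    by (simp_all add: eq_diff_eq add[symmetric])
  show "t (sum f I) v = (\<Sum>i\<in>I. t (f i) v)" "t u (sum h I) = (\<Sum>i\<in>I. t u (h i))"
    by (induction I rule: infinite_finite_induct; simp add: zero add)+
qed

lemmas bilinear_simps = bilinear_add_left bilinear_add_right bilinear_scaleC_left bilinear_scaleC_right
  bilinear_scaleR_left bilinear_scaleR_right bilinear_zero_left bilinear_zero_right
  bilinear_diff_left bilinear_diff_right bilinear_sum_left bilinear_sum_right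

lemma
  assumes "minimal_tensor_product t"
  shows tensor_cbilinear: "cbilinear t"
    and tensor_mult: "t a b * t a' b' = t (a * a') (b * b')"
    and tensor_star: "star (t a b) = t (star a) (star b)"
    and tensor_dense: "closure (tensor_span t) = UNIV"
  using assms by (auto simp: minimal_tensor_product_def algebraic_tensor_def)

lemma generators_pair: "{t u v | u v. True} = range (\<lambda>(u, v). t u v)"
  by auto

text \<open>\<open>V0\<close> and \<open>V1\<close> are amplified to \<open>1 \<otimes> V0\<close>
  and \<open>1 \<otimes> V1\<close> on the tensor product, where \<open>norm_monotoneI\<close>
  applies. Orthogonality of the ranges is checked on elementary tensors and extended by
  density.\<close>

lemma norm_monotone_tensor:
  fixes t :: "'a::cstar_algebra \<Rightarrow> 'b::cstar_algebra \<Rightarrow> 't::cstar_algebra"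
  assumes t: "minimal_tensor_product t"
    and V0: "\<And>x y. star (V0 x) * V0 y = star x * y" and V1: "\<And>x y. star (V1 x) * V1 y = star x * y"
    and V01: "\<And>x y :: 'b. star (V0 x :: 'b) * V1 y = 0"
  shows "norm_monotone TYPE('t)"
proof -
  let ?S = "standard_correspondence :: ('t, 't) correspondence"
  note S = hilbert_module_standard[where ?'a='t]
  have dense: "closure (cspan (range (\<lambda>(a, b). t a b))) = UNIV"
    using tensor_dense[OF t] by (simp only: generators_pair)
  have ext: "\<exists>W. (\<forall>x y. star (W x) * W y = star x * y) \<and> (\<forall>a b. W (t a b) = t a (V b))"
    if V: "\<And>x y :: 'b. star (V x) * V y = star x * y" for V
    using preserving_on_generators[OF S S _ dense, of "\<lambda>(a, b). t a (V b)"]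
    by (simp add: split_paired_all case_prod_beta tensor_mult[OF t] tensor_star[OF t] V)
  obtain W0 where W0: "\<And>x y. star (W0 x) * W0 y = star x * y" "\<And>a b. W0 (t a b) = t a (V0 b)"
    using ext[OF V0] by metis
  obtain W1 where W1: "\<And>x y. star (W1 x) * W1 y = star x * y" "\<And>a b. W1 (t a b) = t a (V1 b)"
    using ext[OF V1] by metis
  note lin0 = preserving_linear[OF S S, of W0, simplified, OF W0(1)]
  note lin1 = preserving_linear[OF S S, of W1, simplified, OF W1(1)]
  have bl: "bounded_linear W0" "bounded_linear W1"
    by (rule bounded_linear_intro[where K=1]; simp add: lin0 lin1 scaleR_scaleC)+
  have gen: "star (W0 (t a b)) * W1 y = 0" for a b y
  proof (rule eq_on_generators[OF dense, where f="\<lambda>y. star (W0 (t a b)) * W1 y" and g="\<lambda>_. 0"])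
    show "clinear (\<lambda>y. star (W0 (t a b)) * W1 y)"
      by (simp add: clinear_iff lin1 distrib_left mult_scaleC_right)
    show "continuous_on UNIV (\<lambda>y. star (W0 (t a b)) * W1 y)"
      by (rule linear_continuous_on[OF bounded_linear_compose[OF bounded_linear_mult_right bl(2)]])
  qed (auto simp: clinear_iff complex_vector.scale_zero_right W0 W1 tensor_star[OF t] tensor_mult[OF t] V01
      bilinear_zero_right[OF tensor_cbilinear[OF t]])
  \<comment> \<open>The extension in the other variable goes through the starred identity, since
    \<open>star (W0 x)\<close> is conjugate-linear in \<open>x\<close>.\<close>
  have "star (W1 y) * W0 x = 0" for x y
  proof (rule eq_on_generators[OF dense, where f="\<lambda>x. star (W1 y) * W0 x" and g="\<lambda>_. 0"])
    show "clinear (\<lambda>x. star (W1 y) * W0 x)"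
      by (simp add: clinear_iff lin0 distrib_left mult_scaleC_right)
    show "continuous_on UNIV (\<lambda>x. star (W1 y) * W0 x)"
      by (rule linear_continuous_on[OF bounded_linear_compose[OF bounded_linear_mult_right bl(1)]])
    fix x assume "x \<in> range (\<lambda>(a, b). t a b)"
    then obtain a b where "x = t a b" by auto
    then have "star (W0 x) * W1 y = 0" using gen by simp
    then show "star (W1 y) * W0 x = 0" by (metis star_mult star_star star_zero)
  qed (simp_all add: clinear_iff complex_vector.scale_zero_right)
  then have W01: "star (W0 x) * W1 y = 0" for x y by (metis star_mult star_star star_zero)
  show ?thesis by (rule norm_monotoneI[OF W0(1) W1(1) W01])
qed

text \<open>Factors of norm \<open>1/2\<close> multiply contractively in each leg, again by
  \<open>sqrt_of_half\<close>. The square of \<open>norm (t a b)\<close> is the norm of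
  \<open>t (a * star a) (b * star b)\<close>; splitting off \<open>a\<close> and \<open>b\<close>
  costs a factor 2 each and leaves one \<open>norm (t a b)\<close> to cancel.\<close>

lemma norm_tensor_le:
  fixes t :: "'a::cstar_algebra \<Rightarrow> 'b::cstar_algebra \<Rightarrow> 't::cstar_algebra"
  assumes mono: "norm_monotone TYPE('t)" and t: "minimal_tensor_product t"
  shows "norm (t a b) \<le> 4 * norm a * norm b"
proof -
  note S = hilbert_module_standard[where ?'a='t]
  note [simp] = tensor_mult[OF t] tensor_star[OF t] bilinear_simps[OF tensor_cbilinear[OF t]]
  have le: "norm x \<le> norm z" if "star x * x + star y * y = star z * z" for x y z :: 't
    using norm_le_of_iprod_add[OF mono S S S, of x y z] that by simp
  have left: "norm (t (a * a') b') \<le> 2 * norm a * norm (t a' b')" for a a' b'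
  proof (cases "a = 0")
    case False
    then obtain r c where c: "a = r *\<^sub>R c" "\<bar>r\<bar> = 2 * norm a" "norm c = 1/2" by (rule rescale_half)
    obtain f where f: "star f = f" "star c * c + f * f = f + f" using sqrt_of_half[OF c(3)] .
    have "star a' * (star c * c + f * f) * a' = star a' * (f + f) * a'" by (simp only: f)
    then have "t (star a' * (star c * c + f * f) * a') b = t (star a' * (f + f) * a') b" for b by simp
    then have "norm (t (c * a') b') \<le> norm (t a' b')"
      by (intro le[where y="t (a' - f * a') b'"]) (simp add: star_mult star_diff f algebra_simps)
    then have "\<bar>r\<bar> * norm (t (c * a') b') \<le> \<bar>r\<bar> * norm (t a' b')" by (intro mult_left_mono) auto
    then show ?thesis unfolding c(2)[symmetric] by (simp add: c(1))
  qed simp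
  have right: "norm (t a' (b * b')) \<le> 2 * norm b * norm (t a' b')" for a' b b'
  proof (cases "b = 0")
    case False
    then obtain r c where c: "b = r *\<^sub>R c" "\<bar>r\<bar> = 2 * norm b" "norm c = 1/2" by (rule rescale_half)
    obtain f where f: "star f = f" "star c * c + f * f = f + f" using sqrt_of_half[OF c(3)] .
    have "star b' * (star c * c + f * f) * b' = star b' * (f + f) * b'" by (simp only: f)
    then have "t a (star b' * (star c * c + f * f) * b') = t a (star b' * (f + f) * b')" for a by simp
    then have "norm (t a' (c * b')) \<le> norm (t a' b')"
      by (intro le[where y="t a' (b' - f * b')"]) (simp add: star_mult star_diff f algebra_simps)
    then have "\<bar>r\<bar> * norm (t a' (c * b')) \<le> \<bar>r\<bar> * norm (t a' b')" by (intro mult_left_mono) auto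
    then show ?thesis unfolding c(2)[symmetric] by (simp add: c(1))
  qed simp
  have "norm (t a b) * norm (t a b) = norm (star (t (star a) (star b)) * t (star a) (star b))"
    by (simp only: cstar_identity norm_star[of "t a b", unfolded tensor_star[OF t]] power2_eq_square)
  also have "\<dots> = norm (t (a * star a) (b * star b))" by (simp add: star_star)
  also have "\<dots> \<le> 2 * norm a * (2 * norm b * norm (t (star a) (star b)))"
    by (rule order_trans[OF left]) (intro mult_left_mono right, simp)
  also have "norm (t (star a) (star b)) = norm (t a b)" using norm_star[of "t a b"] by simp
  finally have "norm (t a b) * norm (t a b) \<le> norm (t a b) * (4 * norm a * norm b)" by (simp add: mult_ac)
  then show ?thesis by (cases "norm (t a b) = 0") (auto simp: mult_le_cancel_left less_le)
qed

lemma
  assumes "exterior_tensor_product t E F G \<tau>"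
  shows exterior_correspondence: "cstar_correspondence G"
    and exterior_hilbert: "hilbert_module G"
    and exterior_cbilinear: "cbilinear \<tau>"
    and exterior_iprod: "iprod G (\<tau> x y) (\<tau> x' y') = t (iprod E x x') (iprod F y y')"
    and exterior_ract: "ract G (\<tau> x y) (t a b) = \<tau> (ract E x a) (ract F y b)"
    and exterior_dense: "closure (tensor_span \<tau>) = UNIV"
proof -
  note G = assms[unfolded exterior_tensor_product_def]
  show "cstar_correspondence G" "cbilinear \<tau>" "closure (tensor_span \<tau>) = UNIV"
    "iprod G (\<tau> x y) (\<tau> x' y') = t (iprod E x x') (iprod F y y')"
    "ract G (\<tau> x y) (t a b) = \<tau> (ract E x a) (ract F y b)"
    using G by blast+
  then show "hilbert_module G" by (simp add: cstar_correspondence_def)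
qed

lemma norm_exterior_le:
  fixes t :: "'a::cstar_algebra \<Rightarrow> 'b::cstar_algebra \<Rightarrow> 't::cstar_algebra"
  assumes mono: "norm_monotone TYPE('t)" and t: "minimal_tensor_product t"
    and E: "hilbert_module E" and F: "hilbert_module F" and G: "exterior_tensor_product t E F G \<tau>"
  shows "norm (\<tau> x y) \<le> 2 * norm x * norm y"
proof (rule power2_le_imp_le)
  have "(norm (\<tau> x y))\<^sup>2 \<le> 4 * norm (iprod E x x) * norm (iprod F y y)"
    unfolding norm_iprod_self[OF exterior_hilbert[OF G], symmetric] exterior_iprod[OF G]
    by (rule norm_tensor_le[OF mono t])
  then show "(norm (\<tau> x y))\<^sup>2 \<le> (2 * norm x * norm y)\<^sup>2"
    by (simp add: norm_iprod_self[OF E] norm_iprod_self[OF F] power_mult_distrib)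
qed simp

section \<open>Cuntz families\<close>

text \<open>The \<open>S i\<close> are isometries with orthogonal ranges whose range projections sum
  strongly to 1. Such a family identifies \<open>M\<close> with a direct sum of countably many
  copies of itself.\<close>

definition cuntz_family ::
    "('m::cbanach, 'a::cstar_algebra) correspondence \<Rightarrow> (nat \<Rightarrow> 'm \<Rightarrow> 'm) \<Rightarrow> (nat \<Rightarrow> 'm \<Rightarrow> 'm) \<Rightarrow> bool"
  where "cuntz_family M S Sa \<longleftrightarrow> (\<forall>i. adjoint_pair M M (S i) (Sa i)) \<and>
    (\<forall>i j x. Sa i (S j x) = (if i = j then x else 0)) \<and>
    (\<forall>x. (\<lambda>n. \<Sum>i<n. S i (Sa i x)) \<longlonglongrightarrow> x)"

lemma
  assumes "cuntz_family M S Sa"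
  shows cuntz_adjoint: "adjoint_pair M M (S i) (Sa i)"
    and cuntz_orthogonal: "Sa i (S j x) = (if i = j then x else 0)"
    and cuntz_tendsto: "(\<lambda>n. \<Sum>i<n. S i (Sa i x)) \<longlonglongrightarrow> x"
  using assms unfolding cuntz_family_def by blast+

lemma cuntz_iprod:
  assumes "cuntz_family M S Sa" and M: "hilbert_module M"
  shows "iprod M (S i x) (S j y) = (if i = j then iprod M x y else 0)"
  by (simp add: adjoint_pairD[OF cuntz_adjoint[OF assms(1)]] cuntz_orthogonal[OF assms(1)] iprod_zero_right[OF M])

text \<open>The partial sums \<open>p n\<close> are self-adjoint and idempotent, so
  \<open>1 - p n\<close> is a contraction and convergence need only be checked on
  generators.\<close>

lemma cuntz_familyI:
  fixes M :: "('m::cbanach, 'a::cstar_algebra) correspondence"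
  assumes mono: "norm_monotone TYPE('a)" and M: "hilbert_module M"
    and adj: "\<And>i. adjoint_pair M M (S i) (Sa i)"
    and orth: "\<And>i j x. Sa i (S j x) = (if i = j then x else 0)"
    and dense: "closure (cspan G) = UNIV" and gen: "\<And>x. x \<in> G \<Longrightarrow> (\<lambda>n. \<Sum>i<n. S i (Sa i x)) \<longlonglongrightarrow> x"
  shows "cuntz_family M S Sa"
proof -
  note lin = adjoint_pair_linear[OF M M adj] adjoint_pair_linear[OF M M adjoint_pair_sym[OF M M adj]]
  define p where "p n x = (\<Sum>i<n. S i (Sa i x))" for n x
  have "(\<lambda>n. x - p n x) \<longlonglongrightarrow> 0" for x
  proof (rule tendsto_zero_generators[OF dense])
    show "clinear (\<lambda>x. x - p n x)" for n
      by (simp add: clinear_iff p_def lin sum.distrib complex_vector.scale_right_diff_distrib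
          complex_vector.scale_sum_right)
    show "(\<lambda>n. x - p n x) \<longlonglongrightarrow> 0" if "x \<in> G" for x
      using tendsto_diff[OF tendsto_const gen[OF that], of x] by (simp add: p_def)
    show "norm (x - p n x) \<le> 1 * norm x" for n x
    proof -
      have "Sa j (p n x) = Sa j x" if "j < n" for j
        using that by (simp add: p_def lin(13) orth)
      then have "iprod M (p n x) (p n x) = iprod M (p n x) x"
        by (subst (1 3) p_def) (simp add: iprod_sum_left[OF M] adjoint_pairD[OF adj])
      moreover have "iprod M x (p n x) = iprod M (p n x) x"
        by (simp add: p_def iprod_linear[OF M] adjoint_pairD[OF adj]
            adjoint_pairD[OF adjoint_pair_sym[OF M M adj], symmetric])
      ultimately have "iprod M (x - p n x) (x - p n x) + iprod M (p n x) (p n x) = iprod M x x"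
        by (simp add: iprod_diff_left[OF M] iprod_diff_right[OF M])
      then show ?thesis using norm_le_of_iprod_add[OF mono M M M] by simp
    qed
  qed
  then have "(\<lambda>n. p n x) \<longlonglongrightarrow> x" for x
    using tendsto_diff[OF tendsto_const, of "\<lambda>n. x - p n x" 0 sequentially x] by simp
  then show ?thesis unfolding cuntz_family_def p_def using adj orth by blast
qed

section \<open>Coordinate operators and a Cuntz family on the compact operators\<close>

lemma ell2_eqI: "(\<And>n. coord x n = coord y n) \<Longrightarrow> x = y"
  by (rule coord_inject[THEN iffD1]) (rule ext)

lemma ell2_norm_mono:
  assumes "\<And>n. cmod (coord x n) \<le> cmod (coord y n)"
  shows "norm x \<le> norm y"
proof (rule ell2_norm_le)
  show "L2_set (\<lambda>n. cmod (coord x n)) {..<N} \<le> norm y" for N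
    by (rule order_trans[OF L2_set_mono ell2_L2_set_le_norm]) (auto simp: assms)
qed

lemma coord_add: "coord (x + y) n = coord x n + coord y n"
  by (simp add: plus_ell2.rep_eq)

lemma coord_sum: "coord (sum f I) n = (\<Sum>i\<in>I. coord (f i) n)"
  by (induction I rule: infinite_finite_induct) (simp_all add: zero_ell2.rep_eq coord_add)

lemma cinner_ell2_unit: "cinner_ell2 (ell2_unit n) x = coord x n"
proof -
  have "cinner_ell2 (ell2_unit n) x = (\<Sum>m\<in>{n}. cnj (coord (ell2_unit n) m) * coord x m)"
    unfolding cinner_ell2_def by (rule suminf_finite) (auto simp: ell2_unit.rep_eq)
  then show ?thesis by (simp add: ell2_unit.rep_eq)
qed

lemma ell2_units_dense: "closure (cspan (range ell2_unit)) = UNIV"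
proof -
  have "ell2_trunc N s \<in> cspan (range ell2_unit)" for N s
    unfolding ell2_trunc_def
    by (intro complex_vector.span_sum complex_vector.span_scale complex_vector.span_base) auto
  then have "x \<in> closure (cspan (range ell2_unit))" for x
    unfolding closure_sequential by (intro exI[of _ "\<lambda>N. ell2_trunc N (coord x)"]) (simp add: ell2_trunc_tendsto)
  then show ?thesis by blast
qed

text \<open>For injective \<open>f\<close> this is a coisometry; its adjoint puts coordinate
  \<open>n\<close> at position \<open>f n\<close> and zeros elsewhere.\<close>

definition pull :: "(nat \<Rightarrow> nat) \<Rightarrow> ell2 \<Rightarrow> ell2"
  where "pull f x = Abs_ell2 (\<lambda>n. coord x (f n))"

lemma
  assumes f: "inj f"
  shows coord_pull: "coord (pull f x) n = coord x (f n)"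
    and norm_pull: "norm (pull f x) \<le> norm x"
proof -
  have bd: "L2_set (\<lambda>n. cmod (coord x (f n))) {..<N} \<le> norm x" for x N
  proof -
    have f': "inj_on f {..<N}" using f by (rule inj_on_subset) simp
    obtain M where "f ` {..<N} \<subseteq> {..<M}"
      using finite_nat_set_iff_bounded[of "f ` {..<N}"] by auto
    then have "(\<Sum>m\<in>f ` {..<N}. (cmod (coord x m))\<^sup>2) \<le> (\<Sum>m<M. (cmod (coord x m))\<^sup>2)"
      by (intro sum_mono2) auto
    then have "L2_set (\<lambda>n. cmod (coord x (f n))) {..<N} \<le> L2_set (\<lambda>m. cmod (coord x m)) {..<M}"
      unfolding L2_set_def by (simp add: sum.reindex[OF f'])
    then show ?thesis using ell2_L2_set_le_norm order_trans by blast
  qed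
  show c: "coord (pull f x) n = coord x (f n)" for x n
    unfolding pull_def using ell2_sqrt_bound(1)[OF bd] by (simp add: Abs_ell2_inverse)
  show "norm (pull f x) \<le> norm x" by (rule ell2_norm_le) (simp add: c bd)
qed

definition pull_op :: "(nat \<Rightarrow> nat) \<Rightarrow> ell2 \<Rightarrow>\<^sub>L ell2"
  where "pull_op f = Blinfun (pull f)"

lemma pull_op:
  assumes f: "inj f"
  shows "blinfun_apply (pull_op f) = pull f" "clinear (blinfun_apply (pull_op f))"
proof -
  have "bounded_linear (pull f)"
    by (rule bounded_linear_intro[where K=1])
       (auto intro!: ell2_eqI simp: coord_pull[OF f] coord_add scaleR_scaleC scaleC_ell2.rep_eq norm_pull[OF f])
  then show *: "blinfun_apply (pull_op f) = pull f"
    unfolding pull_op_def by (rule bounded_linear_Blinfun_apply)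
  show "clinear (blinfun_apply (pull_op f))"
    unfolding * clinear_iff by (auto intro!: ell2_eqI simp: coord_pull[OF f] coord_add scaleC_ell2.rep_eq)
qed

lemma pull_unit:
  assumes "inj f"
  shows "pull f (ell2_unit m) = (if m \<in> range f then ell2_unit (inv f m) else 0)"
proof (rule ell2_eqI)
  have "f n = m \<longleftrightarrow> m \<in> range f \<and> n = inv f m" for n
    using assms by (auto simp: f_inv_into_f)
  then show "coord (pull f (ell2_unit m)) n = coord (if m \<in> range f then ell2_unit (inv f m) else 0) n" for n
    using assms by (simp add: coord_pull ell2_unit.rep_eq zero_ell2.rep_eq)
qed

lemma coord_pull_adj:
  assumes "inj f"
  shows "coord (ell2_adj (pull_op f) x) m = (if m \<in> range f then coord x (inv f m) else 0)"
proof -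
  have "coord (ell2_adj (pull_op f) x) m = cinner_ell2 (pull f (ell2_unit m)) x"
    using ell2_adj[OF pull_op(2)[OF assms], of "ell2_unit m" x]
    by (simp add: cinner_ell2_unit pull_op(1)[OF assms])
  then show ?thesis
    by (simp add: pull_unit[OF assms] cinner_ell2_unit cinner_ell2_def[of 0] zero_ell2.rep_eq)
qed

lemma op_of_sum: "op_of (sum g I) y = (\<Sum>i\<in>I. op_of (g i) y)"
  by (induction I rule: infinite_finite_induct)
     (simp_all add: zero_compact_op.rep_eq plus_compact_op.rep_eq blinfun.add_left)

text \<open>Strong convergence is uniform on the relatively compact image of the unit ball under \<open>k\<close>.\<close>

lemma compact_op_tendsto_zero:
  fixes k :: compact_op and T :: "nat \<Rightarrow> ell2 \<Rightarrow> ell2"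
  assumes lin: "\<And>n x y. T n (x - y) = T n x - T n y" and bound: "\<And>n x. norm (T n x) \<le> norm x"
    and lim: "\<And>x. (\<lambda>n. T n x) \<longlonglongrightarrow> 0" and K: "\<And>n x. op_of (K n) x = T n (op_of k x)"
  shows "K \<longlonglongrightarrow> 0"
proof (rule LIMSEQ_I)
  fix e :: real assume e: "0 < e"
  obtain A where A: "finite A" "op_of k ` cball 0 1 \<subseteq> (\<Union>x\<in>A. ball x (e / 4))"
    using compact_operator_op_of[of k] e unfolding compact_operator_def compact_closure_iff
    by (metis divide_pos_pos zero_less_numeral)
  have "\<forall>\<^sub>F n in sequentially. \<forall>x\<in>A. norm (T n x) < e / 4"
    using A(1) e tendsto_norm_zero[OF lim] by (intro eventually_ball_finite ballI order_tendstoD(2)) auto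
  then obtain N where N: "\<And>n x. n \<ge> N \<Longrightarrow> x \<in> A \<Longrightarrow> norm (T n x) < e / 4"
    unfolding eventually_sequentially by blast
  have "norm (K n - 0) < e" if n: "n \<ge> N" for n
  proof -
    have ball: "norm (op_of (K n) x) \<le> e / 2" if x: "x \<in> cball 0 1" for x
    proof -
      obtain y where y: "y \<in> A" "norm (op_of k x - y) < e / 4"
        using A(2) x by (fastforce simp: dist_norm norm_minus_commute)
      have "norm (T n (op_of k x)) = norm (T n (op_of k x - y) + T n y)" by (simp add: lin)
      also have "\<dots> \<le> norm (op_of k x - y) + norm (T n y)" by (intro norm_triangle_mono bound order_refl)
      finally show ?thesis using y(2) N[OF n y(1)] by (simp add: K)
    qed
    have "norm (op_of (K n) x) \<le> e / 2 * norm x" for x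
    proof (cases "x = 0")
      case False
      then show ?thesis
        using ball[of "sgn x"] by (simp add: sgn_div_norm blinfun.scaleR_right field_simps)
    qed (simp add: blinfun.zero_right)
    then have "norm (op_of (K n)) \<le> e / 2" using e by (intro norm_blinfun_bound) auto
    then show ?thesis using e by (simp add: norm_compact_op.rep_eq)
  qed
  then show "\<exists>N. \<forall>n\<ge>N. norm (K n - 0) < e" by blast
qed

text \<open>Pairing splits the indices into infinitely many rows, each a copy of the whole index
  set. \<open>L i\<close> is left multiplication by the isometry onto row \<open>i\<close>, and
  \<open>La i\<close> by its adjoint.\<close>

lemma cuntz_family_compact:
  "\<exists>L La. cuntz_family (standard_correspondence :: (compact_op, compact_op) correspondence) L La"
proof -
  define f :: "nat \<Rightarrow> nat \<Rightarrow> nat" where "f i n = prod_encode (i, n)" for i n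
  have f: "inj (f i)" for i by (auto simp: inj_def f_def)
  have range: "m \<in> range (f i) \<longleftrightarrow> fst (prod_decode m) = i" for m i
    by (auto simp: f_def image_iff) (metis prod.collapse prod_decode_inverse)
  have inv: "inv (f i) (f i n) = n" for i n using f by simp
  define L where "L i k = Abs_compact_op (ell2_adj (pull_op (f i)) o\<^sub>L op_of k)" for i k
  define La where "La i k = Abs_compact_op (pull_op (f i) o\<^sub>L op_of k)" for i k
  note cl = pull_op(2)[OF f]
  have L: "op_of (L i k) = ell2_adj (pull_op (f i)) o\<^sub>L op_of k" for i k
    unfolding L_def by (rule Abs_compact_op_inverse)
      (simp add: compact_operator_compose_left compact_operator_op_of clinear_ell2_adj cl)
  have La: "op_of (La i k) = pull_op (f i) o\<^sub>L op_of k" for i k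
    unfolding La_def by (rule Abs_compact_op_inverse)
      (simp add: compact_operator_compose_left compact_operator_op_of cl)
  have "adjoint_pair standard_correspondence standard_correspondence (L i) (La i)" for i
    unfolding adjoint_pair_def iprod_standard
  proof (intro allI op_of_inject[THEN iffD1])
    fix k k' :: compact_op
    have "ell2_adj (ell2_adj (pull_op (f i)) o\<^sub>L op_of k) = ell2_adj (op_of k) o\<^sub>L pull_op (f i)"
      by (rule ell2_adj_eqI) (simp add: ell2_adj_right[OF cl] ell2_adj[OF clinear_op_of])
    then show "op_of (star (L i k) * k') = op_of (star k * La i k')"
      by (intro blinfun_eqI) (simp add: times_compact_op.rep_eq star_compact_op.rep_eq L La)
  qed
  moreover have "La i (L j k) = (if i = j then k else 0)" for i j k
  proof (rule op_of_inject[THEN iffD1], rule blinfun_eqI, rule ell2_eqI)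
    fix x n
    have "f i n \<in> range (f j) \<longleftrightarrow> i = j" by (simp add: range) (simp add: f_def)
    then show "coord (op_of (La i (L j k)) x) n = coord (op_of (if i = j then k else 0) x) n"
      by (auto simp: L La pull_op(1)[OF f] coord_pull[OF f] coord_pull_adj[OF f] inv
          zero_compact_op.rep_eq zero_ell2.rep_eq)
  qed
  moreover have "(\<lambda>n. \<Sum>i<n. L i (La i k)) \<longlonglongrightarrow> k" for k
  proof -
    \<comment> \<open>\<open>T n\<close> projects onto the rows from \<open>n\<close> on. It tends
      to zero only strongly; norm convergence comes from composing with the compact
      \<open>k\<close>.\<close>
    define T where "T n x = x - (\<Sum>i<n. ell2_adj (pull_op (f i)) (pull_op (f i) x))" for n x
    have coord_T: "coord (T n x) m = (if fst (prod_decode m) < n then 0 else coord x m)" for n x m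
    proof -
      have "coord (ell2_adj (pull_op (f i)) (pull_op (f i) x)) m = (if fst (prod_decode m) = i then coord x m else 0)" for i
      proof (cases "m \<in> range (f i)")
        case True
        then show ?thesis
          by (simp add: coord_pull_adj[OF f] pull_op(1)[OF f] coord_pull[OF f] f_inv_into_f range[symmetric])
      qed (simp add: coord_pull_adj[OF f] range[symmetric])
      then show ?thesis by (simp add: T_def coord_diff coord_sum)
    qed
    have "(\<lambda>n. (\<Sum>i<n. L i (La i k)) - k) \<longlonglongrightarrow> 0"
    proof (rule compact_op_tendsto_zero[of "\<lambda>n x. - T n x"])
      show "- T n (x - y) = - T n x - - T n y" for n x y
        by (rule ell2_eqI) (simp add: uminus_ell2.rep_eq coord_diff coord_T)
      show "norm (- T n x) \<le> norm x" for n x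
        by (simp, rule ell2_norm_mono) (simp add: coord_T)
      show "op_of ((\<Sum>i<n. L i (La i k)) - k) x = - T n (op_of k x)" for n x
        by (simp add: minus_compact_op.rep_eq blinfun.diff_left op_of_sum L La T_def)
      have "(\<lambda>n. T n x) \<longlonglongrightarrow> 0" for x
      proof (rule tendsto_zero_generators[OF ell2_units_dense])
        show "clinear (T n)" for n
          unfolding clinear_iff by (auto intro!: ell2_eqI simp: coord_T coord_add scaleC_ell2.rep_eq)
        show "norm (T n x) \<le> 1 * norm x" for n x
          by (simp, rule ell2_norm_mono) (simp add: coord_T)
        fix x assume "x \<in> range ell2_unit"
        then obtain m where m: "x = ell2_unit m" by blast
        have "T n x = 0" if "n > fst (prod_decode m)" for n
          using that by (intro ell2_eqI) (auto simp: coord_T m ell2_unit.rep_eq zero_ell2.rep_eq)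
        then have "\<forall>\<^sub>F n in sequentially. T n x = 0"
          by (intro eventually_mono[OF eventually_gt_at_top])
        then show "(\<lambda>n. T n x) \<longlonglongrightarrow> 0" by (rule tendsto_eventually)
      qed
      then show "(\<lambda>n. - T n x) \<longlonglongrightarrow> 0" for x using tendsto_minus by fastforce
    qed
    then show ?thesis by (simp add: LIM_zero_iff)
  qed
  ultimately show ?thesis unfolding cuntz_family_def by blast
qed

text \<open>The maps are \<open>1 \<otimes> L i\<close>. They exist because inner products of
  elementary tensors are preserved, and they have adjoints because \<open>1 \<otimes> La i\<close>
  gives the adjoint values on elementary tensors.\<close>

lemma cuntz_family_exterior:
  fixes t :: "'a::cstar_algebra \<Rightarrow> 'b::cstar_algebra \<Rightarrow> 't::cstar_algebra"
    and G :: "('g::cbanach, 't) correspondence"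
  assumes mono: "norm_monotone TYPE('t)" and t: "minimal_tensor_product t"
    and E: "hilbert_module E" and F: "hilbert_module F" and G: "exterior_tensor_product t E F G \<tau>"
    and C: "cuntz_family F L La"
  shows "\<exists>S Sa. cuntz_family G S Sa"
proof -
  note M = exterior_hilbert[OF G]
  let ?g = "\<lambda>(x, y). \<tau> x y"
  have dense: "closure (cspan (range ?g)) = UNIV"
    using exterior_dense[OF G] by (simp only: generators_pair)
  note [simp] = exterior_iprod[OF G] cuntz_iprod[OF C F] bilinear_simps[OF exterior_cbilinear[OF G]]
    bilinear_simps[OF tensor_cbilinear[OF t]] cuntz_orthogonal[OF C]
  have "\<exists>S. (\<forall>x y. iprod G (S x) (S y) = iprod G x y) \<and> (\<forall>x y. S (\<tau> x y) = \<tau> x (L i y))" for i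
    using preserving_on_generators[OF M M _ dense, of "\<lambda>(x, y). \<tau> x (L i y)"]
    by (simp add: split_paired_all case_prod_beta)
  then obtain S where S: "\<And>i x y. iprod G (S i x) (S i y) = iprod G x y"
    "\<And>i x y. S i (\<tau> x y) = \<tau> x (L i y)" by metis
  note lin = preserving_linear[OF M M, of "S i" for i, OF S(1)]
  have cont: "continuous_on UNIV (S i)" for i
  proof -
    have "bounded_linear (S i)"
      by (rule bounded_linear_intro[where K=1]) (simp_all add: lin scaleR_scaleC)
    then show ?thesis by (rule linear_continuous_on)
  qed
  have clin: "clinear (\<lambda>u. iprod G v (S i u))" "continuous_on UNIV (\<lambda>u. iprod G v (S i u))"
    "clinear (iprod G v)" "continuous_on UNIV (iprod G v)" for v i
  proof -
    have ci: "continuous_on UNIV (iprod G v)"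
      by (intro linear_continuous_on bounded_bilinear.bounded_linear_right[OF bounded_bilinear_iprod[OF M]])
    then show "continuous_on UNIV (iprod G v)" .
    show "continuous_on UNIV (\<lambda>u. iprod G v (S i u))"
      by (rule continuous_on_compose2[OF ci cont]) simp
  qed (simp_all add: clinear_iff lin iprod_linear[OF M])
  have adjL: "iprod F (L i x) y = iprod F x (La i y)" and adjL': "iprod F x (L i y) = iprod F (La i x) y" for i x y
    using adjoint_pairD[OF cuntz_adjoint[OF C]] adjoint_pairD[OF adjoint_pair_sym[OF F F cuntz_adjoint[OF C]]]
    by auto
  \<comment> \<open>Here \<open>u\<close> is arbitrary: both sides are linear and continuous in
    \<open>u\<close> and agree on elementary tensors.\<close>
  have adj: "iprod G (\<tau> x y) (S i u) = iprod G (\<tau> x (La i y)) u" for x y i u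
    by (rule eq_on_generators[OF dense clin(1,2) clin(3,4)]) (auto simp: S adjL')
  have "\<exists>Va. adjoint_pair G G (S i) Va" for i
  proof (rule preserving_adjoint[OF M M S(1) dense])
    fix v assume "v \<in> range ?g"
    then obtain x y where v: "v = \<tau> x y" by auto
    show "\<exists>z. \<forall>u. iprod G (S i u) v = iprod G u z"
      using adj[of x y i] v by (metis iprod_star[OF M])
  qed
  then obtain Sa where Sa: "\<And>i. adjoint_pair G G (S i) (Sa i)" by metis
  have Sa_tau: "Sa i (\<tau> x y) = \<tau> x (La i y)" for i x y
  proof (rule iprod_eqI[OF M])
    fix z
    have "iprod G z (Sa i (\<tau> x y)) = iprod G (S i z) (\<tau> x y)" by (simp add: adjoint_pairD[OF Sa])
    also have "\<dots> = iprod G z (\<tau> x (La i y))" using adj[of x y i z] by (metis iprod_star[OF M])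
    finally show "iprod G z (Sa i (\<tau> x y)) = iprod G z (\<tau> x (La i y))" .
  qed
  have orth: "Sa i (S j u) = (if i = j then u else 0)" for i j u
  proof (rule iprod_eqI_generators[OF M dense])
    fix v assume "v \<in> range ?g"
    then obtain x y where v: "v = \<tau> x y" by auto
    have "iprod G v (Sa i (S j u)) = iprod G (\<tau> x (La j (L i y))) u"
      by (simp only: adjoint_pairD[OF Sa, symmetric] v S(2) adj)
    then show "iprod G v (Sa i (S j u)) = iprod G v (if i = j then u else 0)"
      by (auto simp: v iprod_linear[OF M])
  qed
  have "(\<lambda>n. \<Sum>i<n. S i (Sa i v)) \<longlonglongrightarrow> v" if gen: "v \<in> range ?g" for v
  proof -
    obtain x y where v: "v = \<tau> x y" using gen by auto
    have "(\<lambda>n. norm ((\<Sum>i<n. S i (Sa i v)) - v)) \<longlonglongrightarrow> 0"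
    proof (rule tendsto_sandwich[OF _ _ tendsto_const])
      have "(\<Sum>i<n. S i (Sa i v)) - v = \<tau> x ((\<Sum>i<n. L i (La i y)) - y)" for n
        by (simp add: v Sa_tau S)
      then show "\<forall>\<^sub>F n in sequentially. norm ((\<Sum>i<n. S i (Sa i v)) - v) \<le> 2 * norm x * norm ((\<Sum>i<n. L i (La i y)) - y)"
        by (intro always_eventually allI) (simp only: norm_exterior_le[OF mono t E F G])
      have "(\<lambda>n. 2 * norm x * norm ((\<Sum>i<n. L i (La i y)) - y)) \<longlonglongrightarrow> 2 * norm x * norm (y - y)"
        by (intro tendsto_intros cuntz_tendsto[OF C])
      then show "(\<lambda>n. 2 * norm x * norm ((\<Sum>i<n. L i (La i y)) - y)) \<longlonglongrightarrow> 0" by simp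
    qed simp
    then show ?thesis by (simp add: tendsto_norm_zero_iff LIM_zero_iff)
  qed
  then have "cuntz_family G S Sa" by (rule cuntz_familyI[OF mono M Sa orth dense])
  then show ?thesis by blast
qed

text \<open>This presents the algebra itself as an exterior tensor product, so that
  \<open>cuntz_family_exterior\<close> also gives a Cuntz family for it.\<close>

lemma exterior_tensor_standard:
  assumes "minimal_tensor_product t"
  shows "exterior_tensor_product t standard_correspondence standard_correspondence standard_correspondence t"
  using assms unfolding exterior_tensor_product_def
  by (intro conjI allI)
     (simp_all only: cstar_correspondence_standard tensor_cbilinear tensor_mult tensor_star tensor_dense
        iprod_standard ract_standard lact_standard)

section \<open>Isometries into modules with a Cuntz family\<close>

text \<open>The isometry is the column with entries \<open>t m\<close>, namely the sum of all
  \<open>S m (t m x)\<close>. The sum converges because the ranges of the \<open>S m\<close> are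
  orthogonal, and the adjoint exists because its values \<open>ta m y\<close> at the generating
  vectors \<open>S m y\<close> are known.\<close>

lemma cuntz_sum_isometry:
  assumes M: "hilbert_module M" and N: "hilbert_module N" and C: "cuntz_family N S Sa"
    and adj: "\<And>m. adjoint_pair M N (t m) (ta m)"
    and lim: "\<And>x y. (\<lambda>n. \<Sum>m<n. iprod N (t m x) (t m y)) \<longlonglongrightarrow> iprod M x y"
  shows "\<exists>V Va. adjoint_pair M N V Va \<and> (\<forall>x. Va (V x) = x) \<and> (\<forall>m y. Va (S m y) = ta m y) \<and>
    (\<forall>m x. Sa m (V x) = t m x)"
proof -
  have partial: "iprod N (\<Sum>m\<in>A. S m (t m x)) (\<Sum>m\<in>A. S m (t m y)) = (\<Sum>m\<in>A. iprod N (t m x) (t m y))"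
    if "finite A" for A x y
    using that by (simp add: iprod_sum_left[OF N] iprod_sum_right[OF N] cuntz_iprod[OF C N] sum.delta)
  have "summable (\<lambda>m. S m (t m x))" for x
    unfolding summable_Cauchy
  proof (intro allI impI)
    fix e :: real assume e: "0 < e"
    have "summable (\<lambda>m. iprod N (t m x) (t m x))" using lim[of x x] by (auto simp: summable_def sums_def)
    then obtain K where K: "\<And>m n. m \<ge> K \<Longrightarrow> norm (\<Sum>m\<in>{m..<n}. iprod N (t m x) (t m x)) < e\<^sup>2"
      unfolding summable_Cauchy using e by (meson zero_less_power)
    have "norm (\<Sum>m\<in>{m..<n}. S m (t m x)) < e" if "m \<ge> K" for m n
    proof -
      have "(norm (\<Sum>m\<in>{m..<n}. S m (t m x)))\<^sup>2 < e\<^sup>2"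
        using K[OF that, of n] by (simp add: norm_iprod_self[OF N, symmetric] partial)
      then show ?thesis using e by (meson less_imp_le power_less_imp_less_base)
    qed
    then show "\<exists>K. \<forall>m\<ge>K. \<forall>n. norm (\<Sum>m\<in>{m..<n}. S m (t m x)) < e" by blast
  qed
  then obtain V where V: "\<And>x. (\<lambda>n. \<Sum>m<n. S m (t m x)) \<longlonglongrightarrow> V x"
    unfolding summable_def sums_def by metis
  have pres: "iprod N (V x) (V y) = iprod M x y" for x y
  proof (rule LIMSEQ_unique)
    show "(\<lambda>n. iprod N (\<Sum>m<n. S m (t m x)) (\<Sum>m<n. S m (t m y))) \<longlonglongrightarrow> iprod N (V x) (V y)"
      by (intro tendsto_iprod[OF N] V)
    show "(\<lambda>n. iprod N (\<Sum>m<n. S m (t m x)) (\<Sum>m<n. S m (t m y))) \<longlonglongrightarrow> iprod M x y"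
      by (simp add: partial lim)
  qed
  have SV: "iprod N (S j z) (V x) = iprod N z (t j x)" for j z x
  proof (rule LIMSEQ_unique)
    show "(\<lambda>n. iprod N (S j z) (\<Sum>m<n. S m (t m x))) \<longlonglongrightarrow> iprod N (S j z) (V x)"
      by (intro tendsto_iprod[OF N] tendsto_const V)
    have "iprod N (S j z) (\<Sum>m<n. S m (t m x)) = iprod N z (t j x)" if "n > j" for n
      using that by (simp add: iprod_sum_right[OF N] cuntz_iprod[OF C N] sum.delta)
    then have "\<forall>\<^sub>F n in sequentially. iprod N (S j z) (\<Sum>m<n. S m (t m x)) = iprod N z (t j x)"
      by (intro eventually_mono[OF eventually_gt_at_top])
    then show "(\<lambda>n. iprod N (S j z) (\<Sum>m<n. S m (t m x))) \<longlonglongrightarrow> iprod N z (t j x)"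
      by (rule tendsto_eventually)
  qed
  have VS: "iprod N (V x) (S j z) = iprod M x (ta j z)" for x j z
    using SV[of j z x] by (metis iprod_star[OF N] adjoint_pairD[OF adj])
  have "y \<in> closure (cspan {S j z | j z. True})" for y
    unfolding closure_sequential
    by (intro exI[of _ "\<lambda>n. \<Sum>i<n. S i (Sa i y)"] conjI allI cuntz_tendsto[OF C]
        complex_vector.span_sum complex_vector.span_base) auto
  then have "\<exists>Va. adjoint_pair M N V Va"
    by (intro preserving_adjoint[OF M N pres, of "{S j z | j z. True}"]) (auto intro: VS)
  then obtain Va where Va: "adjoint_pair M N V Va" by blast
  have "Va (V x) = x" for x
    by (rule iprod_eqI[OF M]) (simp add: adjoint_pairD[OF Va, symmetric] pres)
  moreover have "Va (S m y) = ta m y" for m y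
    by (rule iprod_eqI[OF M]) (simp add: adjoint_pairD[OF Va, symmetric] VS)
  moreover have "Sa m (V x) = t m x" for m x
    by (rule iprod_eqI[OF N]) (simp add: adjoint_pairD[OF cuntz_adjoint[OF C], symmetric] SV)
  ultimately show ?thesis using Va by blast
qed

text \<open>
  With \<open>h = X\<^sup>* X\<close>, \<open>q = (1 + h)\<^sup>-\<^sup>1\<close> is the resolvent and \<open>c = (1 - h) / (1 + h)\<close> the Cayley transform;
  the last identity is \<open>1 - c\<^sup>2 = (2 X q)\<^sup>* (2 X q)\<close>.
\<close>

lemma cayley_transform:
  assumes M: "hilbert_module M" and N: "hilbert_module N" and X: "adjoint_pair M N X Xa"
    and bound: "\<And>x. norm (X x) \<le> 1/2 * norm x" "\<And>y. norm (Xa y) \<le> 1/2 * norm y"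
  shows "\<exists>q c. adjoint_pair M M q q \<and> adjoint_pair M M c c \<and> (\<forall>x. q (x + Xa (X x)) = x) \<and>
    (\<forall>x. q x + Xa (X (q x)) = x) \<and> (\<forall>x. c x = q x + q x - x) \<and>
    (\<forall>x y. iprod M (c x) (c y) + iprod N (2 *\<^sub>R X (q x)) (2 *\<^sub>R X (q y)) = iprod M x y)"
proof -
  define h where "h x = Xa (X x)" for x
  note h = adjoint_pair_comp[OF X adjoint_pair_sym[OF M N X], folded h_def]
  note lin = adjoint_pair_linear[OF M M h]
  have norm_h: "norm (h x) \<le> 1/4 * norm x" for x
    unfolding h_def using bound(1)[of x] bound(2)[of "X x"] by simp
  have "\<exists>x. x + h x = y" for y
  proof -
    have "dist (y - h a) (y - h b) \<le> 1/4 * dist a b" for a b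
      using norm_h[of "b - a"] by (simp add: dist_norm lin(3) norm_minus_commute)
    then have "\<exists>!x. y - h x = x" by (intro banach_fix_type[of "1/4"]) auto
    then show ?thesis by (metis diff_add_cancel)
  qed
  then obtain q where q: "\<And>y. q y + h (q y) = y" by metis
  have inj: "x = x'" if "x + h x = x' + h x'" for x x'
  proof -
    have "x - x' = h (x' - x)" using that by (simp add: lin algebra_simps)
    then have "norm (x - x') = norm (h (x' - x))" by (rule arg_cong)
    then have "norm (x - x') \<le> 1/4 * norm (x - x')" using norm_h[of "x' - x"] by (metis norm_minus_commute)
    then have "norm (x - x') \<le> 0" by simp
    then show ?thesis by simp
  qed
  have q': "q (x + h x) = x" for x by (rule inj) (rule q)
  have adj_q: "adjoint_pair M M q q"
    unfolding adjoint_pair_def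
  proof (intro allI)
    fix x y
    have "iprod M (q x) (q y + h (q y)) = iprod M (q x + h (q x)) (q y)"
      by (simp add: iprod_linear[OF M] adjoint_pairD[OF h])
    then show "iprod M (q x) y = iprod M x (q y)" by (simp add: q)
  qed
  define c where "c x = q x + q x - x" for x
  have "adjoint_pair M M c c"
    unfolding adjoint_pair_def c_def by (simp add: iprod_linear[OF M] adjoint_pairD[OF adj_q])
  moreover have "iprod M (c x) (c y) + iprod N (2 *\<^sub>R X (q x)) (2 *\<^sub>R X (q y)) = iprod M x y" for x y
  proof -
    \<comment> \<open>With \<open>x = a + h a\<close> and \<open>y = b + h b\<close> the transform
      gives \<open>a - h a\<close> and \<open>b - h b\<close>; the two inner products differ by four
      times \<open>iprod M a (h b)\<close>.\<close>
    define a b where "a = q x" and "b = q y"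
    have xy: "x = a + h a" "y = b + h b" by (simp_all add: a_def b_def q)
    have c: "c x = a - h a" "c y = b - h b"
      unfolding c_def a_def[symmetric] b_def[symmetric] by (simp_all add: xy)
    have Xab: "iprod N (X a) (X b) = iprod M a (h b)" by (simp add: h_def adjoint_pairD[OF X])
    have four: "4 *\<^sub>R iprod M a (h b) = 2 *\<^sub>R iprod M a (h b) + 2 *\<^sub>R iprod M a (h b)"
      by (simp flip: scaleR_add_left)
    show ?thesis
      unfolding c a_def[symmetric] b_def[symmetric] unfolding xy
      by (simp add: iprod_linear[OF M] iprod_linear[OF N] adjoint_pairD[OF h] Xab four scaleR_2)
  qed
  ultimately show ?thesis using adj_q q q' unfolding h_def c_def by blast
qed

lemma adjoint_pair_funpow:
  assumes "adjoint_pair M M c c"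
  shows "adjoint_pair M M (c ^^ n) (c ^^ n)"
  using assms by (induction n) (simp_all add: adjoint_pair_def funpow_swap1)

text \<open>
  Telescoping \<open>1 - c\<^sup>2\<^sup>n\<close> gives the sum; since the terms decrease, the \<open>n\<close>-th one is at most \<open>1/n\<close>,
  and so \<open>c\<^sup>n\<close> tends to zero on the range of \<open>X\<^sup>*\<close>.
\<close>

lemma frame_exists:
  fixes M :: "('m::cbanach, 'a::cstar_algebra) correspondence" and N :: "('n::cbanach, 'a) correspondence"
  assumes mono: "norm_monotone TYPE('a)"
    and M: "hilbert_module M" and N: "hilbert_module N" and X: "adjoint_pair M N X Xa"
    and bound: "\<And>x. norm (X x) \<le> 1/2 * norm x" "\<And>y. norm (Xa y) \<le> 1/2 * norm y"
    and dense: "closure (cspan (range Xa)) = UNIV"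
  shows "\<exists>t ta. (\<forall>m. adjoint_pair M N (t m) (ta m)) \<and>
    (\<forall>x y. (\<lambda>n. \<Sum>m<n. iprod N (t m x) (t m y)) \<longlonglongrightarrow> iprod M x y)"
proof -
  note X' = adjoint_pair_sym[OF M N X]
  obtain q c where q: "adjoint_pair M M q q" and c: "adjoint_pair M M c c"
    and q1: "\<And>x. q (x + Xa (X x)) = x" and q2: "\<And>x. q x + Xa (X (q x)) = x"
    and c_def: "\<And>x. c x = q x + q x - x"
    and cayley: "\<And>x y. iprod M (c x) (c y) + iprod N (2 *\<^sub>R X (q x)) (2 *\<^sub>R X (q y)) = iprod M x y"
    using cayley_transform[OF M N X bound] by metis
  \<comment> \<open>\<open>X\<close> intertwines \<open>c\<close> with the transform
    \<open>c'\<close> built from the adjoint of \<open>X\<close>. Hence \<open>t (Suc m)\<close> is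
    \<open>c'\<close> applied to \<open>t m\<close>, and \<open>cayley'\<close> shows that the
    squares of the terms decrease.\<close>
  obtain q' c' where q1': "\<And>x. q' (x + X (Xa x)) = x" and c'_def: "\<And>x. c' x = q' x + q' x - x"
    and c': "adjoint_pair N N c' c'"
    and cayley': "\<And>x y. iprod N (c' x) (c' y) + iprod M (2 *\<^sub>R Xa (q' x)) (2 *\<^sub>R Xa (q' y)) = iprod N x y"
    using cayley_transform[OF N M X' bound(2,1)] by metis
  note linX = adjoint_pair_linear[OF M N X] and linXa = adjoint_pair_linear[OF N M X']
    and linq = adjoint_pair_linear[OF M M q] and linc = adjoint_pair_linear[OF M M c]
    and linc' = adjoint_pair_linear[OF N N c']
  have qc: "q (c x) = c (q x)" for x by (simp add: c_def linq)
  have "q' (X x) = X (q x)" for x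
    using q1'[of "X (q x)"] by (simp add: linX(1)[symmetric] q2)
  then have Xc: "X (c x) = c' (X x)" for x by (simp add: c_def c'_def linX)
  note cn = adjoint_pair_funpow[OF c]
  note lincn = adjoint_pair_linear[OF M M cn]
  have qcn: "q ((c ^^ n) x) = (c ^^ n) (q x)" for n x by (induction n) (simp_all add: qc)
  define t where "t m x = 2 *\<^sub>R X (q ((c ^^ m) x))" for m x
  define ta where "ta m y = (c ^^ m) (q (2 *\<^sub>R Xa y))" for m y
  have t: "adjoint_pair M N (t m) (ta m)" for m
    unfolding adjoint_pair_def t_def ta_def
    by (simp add: linq lincn linXa iprod_linear[OF M] iprod_linear[OF N] adjoint_pairD[OF X]
        adjoint_pairD[OF q] adjoint_pairD[OF cn])
  have sum: "(\<Sum>m<n. iprod N (t m x) (t m y)) + iprod M ((c ^^ n) x) ((c ^^ n) y) = iprod M x y" for n x y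
  proof (induction n)
    case (Suc n)
    have "iprod M ((c ^^ n) x) ((c ^^ n) y) = iprod M (c ((c ^^ n) x)) (c ((c ^^ n) y)) + iprod N (t n x) (t n y)"
      unfolding t_def cayley ..
    then show ?case by (simp add: Suc[symmetric] add_ac)
  qed simp
  have t_Suc: "t (Suc m) x = c' (t m x)" for m x
    by (simp add: t_def qc Xc linc')
  \<comment> \<open>The induction step adds \<open>n + 1\<close> times the decrease from term
    \<open>n\<close> to term \<open>n + 1\<close>.\<close>
  have pos: "cstar_positive ((\<Sum>m<n. iprod N (t m u) (t m u)) - real n *\<^sub>R iprod N (t n u) (t n u))" for n u
  proof (induction n)
    case (Suc n)
    have "iprod N (t n u) (t n u) - iprod N (t (Suc n) u) (t (Suc n) u) =
        iprod M (2 *\<^sub>R Xa (q' (t n u))) (2 *\<^sub>R Xa (q' (t n u)))"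
      using cayley'[of "t n u" "t n u"] by (simp add: t_Suc algebra_simps)
    then have "cstar_positive (real (Suc n) *\<^sub>R (iprod N (t n u) (t n u) - iprod N (t (Suc n) u) (t (Suc n) u)))"
      by (intro cstar_positive_scaleR) (simp_all add: iprod_self_positive[OF M])
    from positive_add[OF mono Suc this] show ?case by (simp add: algebra_simps)
  qed simp
  have t_bound: "real n * (norm (t n u))\<^sup>2 \<le> (norm u)\<^sup>2" for n u
  proof -
    let ?s = "\<Sum>m<n. iprod N (t m u) (t m u)" and ?d = "real n *\<^sub>R iprod N (t n u) (t n u)"
    have "norm ?d \<le> norm (?d + (?s - ?d))"
      by (intro norm_le_norm_add[OF mono] pos cstar_positive_scaleR iprod_self_positive N) simp
    also have "\<dots> = norm ?s" by simp
    also have "\<dots> \<le> norm (?s + iprod M ((c ^^ n) u) ((c ^^ n) u))"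
      by (intro norm_le_norm_add[OF mono] positive_sum[OF mono] iprod_self_positive M N)
    finally show ?thesis by (simp add: sum norm_iprod_self[OF M] norm_iprod_self[OF N])
  qed
  have t_lim: "(\<lambda>n. t n u) \<longlonglongrightarrow> 0" for u
  proof -
    have "(\<lambda>n. (norm (t n u))\<^sup>2) \<longlonglongrightarrow> 0"
    proof (rule tendsto_sandwich[OF _ _ tendsto_const])
      show "\<forall>\<^sub>F n in sequentially. (norm (t n u))\<^sup>2 \<le> (norm u)\<^sup>2 / real n"
        using eventually_gt_at_top[of 0]
        by eventually_elim (use t_bound[of _ u] in \<open>simp add: field_simps\<close>)
      show "(\<lambda>n. (norm u)\<^sup>2 / real n) \<longlonglongrightarrow> 0" by (rule lim_const_over_n)
    qed simp
    then show ?thesis by (simp add: tendsto_norm_zero_iff)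
  qed
  have X_lim: "(\<lambda>n. X ((c ^^ n) u)) \<longlonglongrightarrow> 0" for u
  proof -
    \<comment> \<open>Evaluating \<open>t n\<close> at \<open>u + Xa (X u)\<close> cancels the
      resolvent \<open>q\<close>, which commutes with the powers of \<open>c\<close>.\<close>
    have "X ((c ^^ n) u) = (1/2) *\<^sub>R t n (u + Xa (X u))" for n
      by (simp add: t_def qcn q1)
    then show ?thesis using tendsto_scaleR[OF tendsto_const t_lim, of "1/2"] by simp
  qed
  have norm_cn: "norm ((c ^^ n) x) \<le> norm x" for n x
  proof -
    have "iprod M ((c ^^ n) x) ((c ^^ n) x) + (\<Sum>m<n. iprod N (t m x) (t m x)) = iprod M x x"
      using sum[where n=n and x=x and y=x] by (simp add: add.commute)
    then have "norm (iprod M ((c ^^ n) x) ((c ^^ n) x)) \<le> norm (iprod M x x)"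
      using norm_le_norm_add[OF mono iprod_self_positive[OF M] positive_sum[OF mono iprod_self_positive[OF N]]]
      by metis
    then show ?thesis by (simp add: norm_iprod_self[OF M])
  qed
  have cn_lim: "(\<lambda>n. (c ^^ n) x) \<longlonglongrightarrow> 0" for x
  proof (rule tendsto_zero_generators[OF dense])
    show "clinear (c ^^ n)" for n by (simp add: clinear_iff lincn)
    show "norm ((c ^^ n) x) \<le> 1 * norm x" for n x by (simp add: norm_cn)
    fix x assume "x \<in> range Xa"
    then obtain z where z: "x = Xa z" by blast
    have "(\<lambda>n. (norm ((c ^^ n) x))\<^sup>2) \<longlonglongrightarrow> 0"
    proof (rule tendsto_sandwich[OF _ _ tendsto_const])
      \<comment> \<open>For \<open>x = Xa z\<close>, self-adjointness of \<open>c\<close> collects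
        both powers on one side and \<open>Xa\<close> moves over as \<open>X\<close>; this reduces
        the claim to \<open>X_lim\<close> along even indices.\<close>
      have "(norm ((c ^^ n) x))\<^sup>2 \<le> 4 * norm z * norm (X ((c ^^ (n + n)) x))" for n
      proof -
        have "(norm ((c ^^ n) x))\<^sup>2 = norm (iprod M ((c ^^ n) x) ((c ^^ n) x))"
          by (simp add: norm_iprod_self[OF M])
        also have "iprod M ((c ^^ n) x) ((c ^^ n) x) = iprod N z (X ((c ^^ (n + n)) x))"
          by (simp add: adjoint_pairD[OF cn] funpow_add z adjoint_pairD[OF X'])
        finally show ?thesis using norm_iprod_le[OF N] by simp
      qed
      then show "\<forall>\<^sub>F n in sequentially. (norm ((c ^^ n) x))\<^sup>2 \<le> 4 * norm z * norm (X ((c ^^ (n + n)) x))"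
        by (intro always_eventually) blast
      have "strict_mono (\<lambda>n::nat. n + n)" by (auto simp: strict_mono_def)
      then have "(\<lambda>n. X ((c ^^ (n + n)) x)) \<longlonglongrightarrow> 0"
        using LIMSEQ_subseq_LIMSEQ[OF X_lim[of x]] by (simp add: o_def)
      then have "(\<lambda>n. 4 * norm z * norm (X ((c ^^ (n + n)) x))) \<longlonglongrightarrow> 4 * norm z * norm (0 :: 'n)"
        by (intro tendsto_intros)
      then show "(\<lambda>n. 4 * norm z * norm (X ((c ^^ (n + n)) x))) \<longlonglongrightarrow> 0" by simp
    qed simp
    then show "(\<lambda>n. (c ^^ n) x) \<longlonglongrightarrow> 0" by (simp add: tendsto_norm_zero_iff)
  qed
  have "(\<lambda>n. \<Sum>m<n. iprod N (t m x) (t m y)) \<longlonglongrightarrow> iprod M x y" for x y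
  proof -
    have "(\<lambda>n. iprod M x y - iprod M ((c ^^ n) x) ((c ^^ n) y)) \<longlonglongrightarrow> iprod M x y - iprod M 0 0"
      by (intro tendsto_diff tendsto_const tendsto_iprod[OF M] cn_lim)
    moreover have "iprod M x y - iprod M ((c ^^ n) x) ((c ^^ n) y) = (\<Sum>m<n. iprod N (t m x) (t m y))" for n
      using sum[where n=n and x=x and y=y] by (simp add: algebra_simps)
    ultimately show ?thesis by (simp add: iprod_zero_left[OF M])
  qed
  then show ?thesis using t by blast
qed

section \<open>Isometries from countably many adjointable maps\<close>

lemma cuntz_norm:
  assumes "cuntz_family M S Sa" and M: "hilbert_module M"
  shows "norm (S i x) = norm x" "norm (Sa i x) \<le> 4 * norm x"
proof -
  have "(norm (S i x))\<^sup>2 = (norm x)\<^sup>2" for x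
    by (simp add: norm_iprod_self[OF M, symmetric] cuntz_iprod[OF assms])
  then show S: "norm (S i x) = norm x" for x by simp
  have "norm (Sa i x) * norm (Sa i x) = norm (iprod M (S i (Sa i x)) x)"
    by (simp add: adjoint_pairD[OF cuntz_adjoint[OF assms(1)]] norm_iprod_self[OF M] power2_eq_square)
  also have "\<dots> \<le> 4 * norm (Sa i x) * norm x"
    using norm_iprod_le[OF M, of "S i (Sa i x)" x] by (simp add: S)
  finally have "norm (Sa i x) * norm (Sa i x) \<le> norm (Sa i x) * (4 * norm x)" by (simp add: mult_ac)
  then show "norm (Sa i x) \<le> 4 * norm x"
    by (cases "norm (Sa i x) = 0") (auto simp: mult_le_cancel_left less_le)
qed

text \<open>Placing \<open>\<xi> n\<close> in the copy \<open>S n\<close> keeps the maps apart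
  inside one sum \<open>X\<close>: \<open>Xa (S n y)\<close> is a positive multiple of
  \<open>\<xi>a n y\<close>. So the range of \<open>Xa\<close> has dense span and
  \<open>frame_exists\<close> applies.\<close>

lemma isometry_exists:
  fixes M :: "('m::cbanach, 'a::cstar_algebra) correspondence" and N :: "('n::cbanach, 'a) correspondence"
    and K :: "nat \<Rightarrow> real"
  assumes mono: "norm_monotone TYPE('a)" and M: "hilbert_module M" and N: "hilbert_module N"
    and C: "cuntz_family N S Sa" and \<xi>: "\<And>n. adjoint_pair M N (\<xi> n) (\<xi>a n)"
    and bound: "\<And>n x. norm (\<xi> n x) \<le> K n * norm x" "\<And>n y. norm (\<xi>a n y) \<le> K n * norm y"
    and dense: "closure (cspan {\<xi>a n y | n y. True}) = UNIV"
  shows "\<exists>V Va. adjoint_pair M N V Va \<and> (\<forall>x. Va (V x) = x)"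
proof -
  \<comment> \<open>The weights bring the bounds for \<open>X\<close> and \<open>Xa\<close> down to
    \<open>1/2\<close>: for \<open>Sa n\<close> only the bound 4 is known, and four times the sum of
    all \<open>(1/2) ^ (n + 4)\<close> is \<open>1/2\<close>. The denominator is positive for every
    value of \<open>K n\<close>.\<close>
  define r where "r n = (1/2) ^ (n + 4) / (\<bar>K n\<bar> + 1)" for n
  have r: "r n > 0" for n by (simp add: r_def add_nonneg_pos)
  have rK: "r n * K n \<le> (1/2) ^ (n + 4)" for n
  proof -
    have "K n / (\<bar>K n\<bar> + 1) \<le> 1" by (simp add: field_simps add_nonneg_pos)
    then have "(1/2) ^ (n + 4) * (K n / (\<bar>K n\<bar> + 1)) \<le> (1/2) ^ (n + 4) * (1 :: real)"
      by (intro mult_left_mono) auto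
    then show ?thesis by (simp add: r_def)
  qed
  have geo: "summable (\<lambda>n. (1/2) ^ (n + 4) * (4 * b))" "(\<Sum>n. (1/2) ^ (n + 4) * (4 * b)) = 1/2 * b" for b :: real
  proof -
    have "(\<lambda>n. (1/2) ^ n * (1/4 * b)) sums (2 * (1/4 * b))"
      using sums_mult2[OF geometric_sums[of "1/2 :: real"], of "1/4 * b"] by simp
    moreover have "(1/2) ^ n * (1/4 * b) = (1/2) ^ (n + 4) * (4 * b)" for n
      by (simp add: power_add power_divide)
    moreover have "2 * (1/4 * b) = 1/2 * b" by simp
    ultimately have "(\<lambda>n. (1/2) ^ (n + 4) * (4 * b)) sums (1/2 * b)" by (simp only:)
    then show "summable (\<lambda>n. (1/2) ^ (n + 4) * (4 * b))" "(\<Sum>n. (1/2) ^ (n + 4) * (4 * b)) = 1/2 * b"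
      by (simp_all only: sums_iff)
  qed
  have f: "norm (r n *\<^sub>R S n (\<xi> n x)) \<le> (1/2) ^ (n + 4) * (4 * norm x)" for n x
  proof -
    have "norm (r n *\<^sub>R S n (\<xi> n x)) \<le> (r n * K n) * norm x"
      using r[of n] bound(1)[of n x] by (simp add: cuntz_norm[OF C N] mult.assoc)
    also have "\<dots> \<le> (1/2) ^ (n + 4) * (4 * norm x)" by (intro mult_mono rK) auto
    finally show ?thesis .
  qed
  have g: "norm (r n *\<^sub>R \<xi>a n (Sa n y)) \<le> (1/2) ^ (n + 4) * (4 * norm y)" for n y
  proof -
    have "norm (r n *\<^sub>R \<xi>a n (Sa n y)) \<le> (r n * K n) * norm (Sa n y)"
      using r[of n] bound(2)[of n "Sa n y"] by (simp add: mult.assoc)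
    also have "\<dots> \<le> (1/2) ^ (n + 4) * (4 * norm y)" by (intro mult_mono rK cuntz_norm[OF C N]) auto
    finally show ?thesis .
  qed
  define X where "X x = (\<Sum>n. r n *\<^sub>R S n (\<xi> n x))" for x
  define Xa where "Xa y = (\<Sum>n. r n *\<^sub>R \<xi>a n (Sa n y))" for y
  have X: "(\<lambda>n. r n *\<^sub>R S n (\<xi> n x)) sums X x" "norm (X x) \<le> 1/2 * norm x" for x
    unfolding X_def using norm_suminf_le[OF f geo(1), of x]
    by (simp_all only: geo(2) summable_sums summable_comparison_test'[OF geo(1) f])
  have Xa: "(\<lambda>n. r n *\<^sub>R \<xi>a n (Sa n y)) sums Xa y" "norm (Xa y) \<le> 1/2 * norm y" for y
    unfolding Xa_def using norm_suminf_le[OF g geo(1), of y]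
    by (simp_all only: geo(2) summable_sums summable_comparison_test'[OF geo(1) g])
  note bl = bounded_bilinear.bounded_linear_left[OF bounded_bilinear_iprod]
    bounded_bilinear.bounded_linear_right[OF bounded_bilinear_iprod]
  have "adjoint_pair M N X Xa"
    unfolding adjoint_pair_def
  proof (intro allI)
    fix x y
    have "(\<lambda>n. iprod N (r n *\<^sub>R S n (\<xi> n x)) y) sums iprod N (X x) y"
      by (rule bounded_linear.sums[OF bl(1)[OF N] X(1)])
    moreover have "(\<lambda>n. iprod M x (r n *\<^sub>R \<xi>a n (Sa n y))) sums iprod M x (Xa y)"
      by (rule bounded_linear.sums[OF bl(2)[OF M] Xa(1)])
    moreover have "iprod N (r n *\<^sub>R S n (\<xi> n x)) y = iprod M x (r n *\<^sub>R \<xi>a n (Sa n y))" for n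
      by (simp add: iprod_linear[OF M] iprod_linear[OF N] adjoint_pairD[OF \<xi>] adjoint_pairD[OF cuntz_adjoint[OF C]])
    ultimately show "iprod N (X x) y = iprod M x (Xa y)" using sums_unique2 by auto
  qed
  moreover have "closure (cspan (range Xa)) = UNIV"
  proof -
    have "\<xi>a n y \<in> cspan (range Xa)" for n y
    proof -
      have "Xa (S n y) = (\<Sum>m\<in>{n}. r m *\<^sub>R \<xi>a m (Sa m (S n y)))"
        unfolding Xa_def
        by (rule suminf_finite)
           (auto simp: cuntz_orthogonal[OF C] adjoint_pair_linear(4)[OF N M adjoint_pair_sym[OF M N \<xi>]])
      then have "\<xi>a n y = (1 / r n) *\<^sub>R Xa (S n y)"
        using r[of n] by (simp add: cuntz_orthogonal[OF C])
      then have "\<xi>a n y = complex_of_real (1 / r n) *\<^sub>C Xa (S n y)" by (simp only: scaleR_scaleC)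
      then show ?thesis by (auto intro: complex_vector.span_scale complex_vector.span_base)
    qed
    then have "cspan {\<xi>a n y | n y. True} \<subseteq> cspan (range Xa)"
      by (intro complex_vector.span_minimal complex_vector.subspace_span) auto
    from closure_mono[OF this] show ?thesis unfolding dense by blast
  qed
  ultimately obtain t ta where "\<And>m. adjoint_pair M N (t m) (ta m)"
    "\<And>x y. (\<lambda>n. \<Sum>m<n. iprod N (t m x) (t m y)) \<longlonglongrightarrow> iprod M x y"
    using frame_exists[OF mono M N _ X(2) Xa(2)] by metis
  from cuntz_sum_isometry[OF M N C this] show ?thesis by blast
qed

section \<open>The Eilenberg swindle\<close>

lemma cuntz_eqI:
  assumes "cuntz_family M S Sa" "\<And>i. Sa i x = Sa i y"
  shows "x = y"
  using LIMSEQ_unique[OF cuntz_tendsto[OF assms(1), of x]] cuntz_tendsto[OF assms(1), of y]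
  by (simp add: assms(2))

text \<open>
  \<open>(Z1, Z2)\<close> is a unitary from the direct sum of \<open>M\<close> and \<open>N\<close> onto \<open>N\<close>.  In the decomposition of \<open>N\<close>
  into copies of itself, \<open>P\<close> projects each copy onto the range of \<open>V\<close>, and \<open>Z2\<close> shifts the range of
  \<open>P\<close> by one copy to make room for \<open>Z1\<close>.
\<close>

lemma absorb:
  assumes M: "hilbert_module M" and N: "hilbert_module N"
    and CM: "cuntz_family M R Ra" and CN: "cuntz_family N S Sa"
    and V: "adjoint_pair M N V Va" and VaV: "\<And>x. Va (V x) = x"
  shows "\<exists>Z1 Z1a Z2 Z2a. adjoint_pair M N Z1 Z1a \<and> adjoint_pair N N Z2 Z2a \<and>
    (\<forall>x. Z1a (Z1 x) = x) \<and> (\<forall>y. Z2a (Z2 y) = y) \<and> (\<forall>y. Z1a (Z2 y) = 0) \<and> (\<forall>x. Z2a (Z1 x) = 0) \<and>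
    (\<forall>y. Z1 (Z1a y) + Z2 (Z2a y) = y)"
proof -
  note Va = adjoint_pair_sym[OF M N V]
  note S = cuntz_adjoint[OF CN] and R = cuntz_adjoint[OF CM]
  note Sa = adjoint_pair_sym[OF N N S] and Ra = adjoint_pair_sym[OF M M R]
  note linS = adjoint_pair_linear[OF N N S] and linSa = adjoint_pair_linear[OF N N Sa]
    and linV = adjoint_pair_linear[OF M N V] and linVa = adjoint_pair_linear[OF N M Va]
  note orthS = cuntz_orthogonal[OF CN] and orthR = cuntz_orthogonal[OF CM]
  have lim: "(\<lambda>n. \<Sum>m<n. iprod L (T m x) (T m y)) \<longlonglongrightarrow> iprod L x y"
    if L: "hilbert_module L" and C: "cuntz_family L Q T" for L :: "('l::cbanach, 'b) correspondence" and Q T x y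
  proof -
    have "(\<lambda>n. iprod L (\<Sum>m<n. Q m (T m x)) y) \<longlonglongrightarrow> iprod L x y"
      by (intro tendsto_iprod[OF L] tendsto_const cuntz_tendsto[OF C])
    then show ?thesis by (simp add: iprod_sum_left[OF L] adjoint_pairD[OF cuntz_adjoint[OF C]])
  qed
  \<comment> \<open>\<open>W\<close> applies \<open>V\<close> in every copy, carrying copy
    \<open>R m\<close> of \<open>M\<close> into copy \<open>S m\<close> of \<open>N\<close>.\<close>
  have "\<exists>W Wa. adjoint_pair M N W Wa \<and> (\<forall>x. Wa (W x) = x) \<and> (\<forall>m y. Wa (S m y) = R m (Va y)) \<and>
      (\<forall>m x. Sa m (W x) = V (Ra m x))"
  proof (rule cuntz_sum_isometry[OF M N CN])
    show "adjoint_pair M N (\<lambda>x. V (Ra m x)) (\<lambda>y. R m (Va y))" for m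
      by (rule adjoint_pair_comp[OF Ra V])
    show "(\<lambda>n. \<Sum>m<n. iprod N (V (Ra m x)) (V (Ra m y))) \<longlonglongrightarrow> iprod M x y" for x y
      using lim[OF M CM] by (simp add: adjoint_pairD[OF V] VaV)
  qed
  then obtain W Wa where W: "adjoint_pair M N W Wa" and WaW: "\<And>x. Wa (W x) = x"
    and SaW: "\<And>m x. Sa m (W x) = V (Ra m x)" by metis
  note linW = adjoint_pair_linear[OF M N W] and linWa = adjoint_pair_linear[OF N M adjoint_pair_sym[OF M N W]]
  have RaWa: "Ra m (Wa y) = Va (Sa m y)" for m y
  proof (rule iprod_eqI[OF M])
    fix z
    have "W (R m z) = S m (V z)"
      by (rule cuntz_eqI[OF CN]) (simp add: SaW orthS orthR linV)
    then show "iprod M z (Ra m (Wa y)) = iprod M z (Va (Sa m y))"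
      by (simp add: adjoint_pairD[OF R, symmetric] adjoint_pairD[OF W, symmetric]
          adjoint_pairD[OF S, symmetric] adjoint_pairD[OF V, symmetric])
  qed
  define P where "P y = W (Wa y)" for y
  have P: "adjoint_pair N N P P"
    unfolding P_def by (rule adjoint_pair_comp[OF adjoint_pair_sym[OF M N W] W])
  note linP = adjoint_pair_linear[OF N N P]
  have PP: "P (P y) = P y" for y by (simp add: P_def WaW)
  have SaP: "Sa m (P y) = V (Va (Sa m y))" for m y by (simp add: P_def SaW RaWa)
  \<comment> \<open>The value 0 at index 0 makes \<open>s\<close> the shift of copy \<open>i\<close>
    to copy \<open>i + 1\<close>, with copy 0 left empty.\<close>
  define t where "t m = (case m of 0 \<Rightarrow> \<lambda>_. 0 | Suc i \<Rightarrow> Sa i)" for m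
  define ta where "ta m = (case m of 0 \<Rightarrow> \<lambda>_. 0 | Suc i \<Rightarrow> S i)" for m
  have "\<exists>s sa. adjoint_pair N N s sa \<and> (\<forall>x. sa (s x) = x) \<and> (\<forall>m y. sa (S m y) = ta m y) \<and>
      (\<forall>m x. Sa m (s x) = t m x)"
  proof (rule cuntz_sum_isometry[OF N N CN])
    show "adjoint_pair N N (t m) (ta m)" for m
      by (cases m) (simp_all add: t_def ta_def Sa adjoint_pair_def iprod_linear[OF N] adjoint_pairD[OF Sa])
    fix x y
    have "(\<lambda>n. \<Sum>m<Suc n. iprod N (t m x) (t m y)) \<longlonglongrightarrow> iprod N x y"
      using lim[OF N CN] by (simp add: t_def sum.lessThan_Suc_shift iprod_linear[OF N] del: sum.lessThan_Suc)
    then show "(\<lambda>n. \<Sum>m<n. iprod N (t m x) (t m y)) \<longlonglongrightarrow> iprod N x y"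
      by (rule LIMSEQ_imp_Suc)
  qed
  then obtain s sa where s: "adjoint_pair N N s sa" and sas: "\<And>x. sa (s x) = x"
    and saS: "\<And>m y. sa (S m y) = ta m y" and Sas: "\<And>m x. Sa m (s x) = t m x" by metis
  note sa = adjoint_pair_sym[OF N N s]
  note lins = adjoint_pair_linear[OF N N s] and linsa = adjoint_pair_linear[OF N N sa]
  have Ps: "P (s y) = s (P y)" for y
  proof (rule cuntz_eqI[OF CN])
    show "Sa i (P (s y)) = Sa i (s (P y))" for i
      by (cases i) (simp_all add: SaP Sas t_def linV linVa)
  qed
  have Psa: "P (sa y) = sa (P y)" for y
    by (rule iprod_eqI[OF N])
       (simp add: adjoint_pairD[OF P, symmetric] adjoint_pairD[OF s, symmetric] Ps)
  have Sasa: "Sa i (sa y) = Sa (Suc i) y" for i y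
  proof (rule iprod_eqI[OF N])
    fix z
    have "s (S i z) = S (Suc i) z"
      by (rule cuntz_eqI[OF CN]) (auto simp: Sas orthS t_def split: nat.split)
    then show "iprod N z (Sa i (sa y)) = iprod N z (Sa (Suc i) y)"
      by (simp add: adjoint_pairD[OF S, symmetric] adjoint_pairD[OF s, symmetric])
  qed
  have ssa: "s (sa y) = y - S 0 (Sa 0 y)" for y
  proof (rule cuntz_eqI[OF CN])
    show "Sa i (s (sa y)) = Sa i (y - S 0 (Sa 0 y))" for i
      by (cases i) (simp_all add: Sas t_def linSa orthS Sasa)
  qed
  have PS0: "P (S 0 y) = S 0 (V (Va y))" for y
    by (rule cuntz_eqI[OF CN]) (simp add: SaP orthS linV linVa)
  \<comment> \<open>The range projection of \<open>?Z1\<close> is \<open>P\<close> cut down to copy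
    0; that of \<open>?Z2\<close> is \<open>1 - P\<close> plus \<open>P\<close> cut down to the
    other copies. Together they give 1.\<close>
  let ?Z1 = "\<lambda>x. S 0 (V x)" and ?Z1a = "\<lambda>y. Va (Sa 0 y)"
  let ?Z2 = "\<lambda>y. s (P y) + (y - P y)" and ?Z2a = "\<lambda>y. P (sa y) + (y - P y)"
  have "adjoint_pair M N ?Z1 ?Z1a" by (rule adjoint_pair_comp[OF V S])
  moreover have "adjoint_pair N N ?Z2 ?Z2a"
    unfolding adjoint_pair_def by (simp add: iprod_linear[OF N] adjoint_pairD[OF s] adjoint_pairD[OF P])
  moreover have "?Z1a (?Z1 x) = x" for x by (simp add: orthS VaV)
  moreover have "?Z2a (?Z2 y) = y" for y by (simp add: linP linsa Ps PP Psa sas)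
  moreover have "?Z1a (?Z2 y) = 0" for y by (simp add: linSa linVa Sas t_def SaP VaV)
  moreover have "?Z2a (?Z1 x) = 0" for x by (simp add: saS ta_def linP PS0 VaV)
  moreover have "?Z1 (?Z1a y) + ?Z2 (?Z2a y) = y" for y
    by (simp add: linP lins PP Psa ssa SaP)
  ultimately show ?thesis by blast
qed

text \<open>\<open>Z1\<close>, \<open>Z2\<close> form a unitary from \<open>M \<oplus> N\<close>
  onto \<open>N\<close>, and \<open>Y1\<close>, \<open>Y2\<close> one from
  \<open>N \<oplus> M\<close> onto \<open>M\<close>. Going back along the second and forward along
  the first gives \<open>U\<close>.\<close>

lemma swindle:
  assumes M: "hilbert_module M" and N: "hilbert_module N"
    and CM: "cuntz_family M R Ra" and CN: "cuntz_family N S Sa"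
    and V: "adjoint_pair M N V Va" "\<And>x. Va (V x) = x" and W: "adjoint_pair N M W Wa" "\<And>y. Wa (W y) = y"
  shows "\<exists>U. bij U \<and> (\<forall>x y. iprod N (U x) (U y) = iprod M x y)"
proof -
  obtain Z1 Z1a Z2 Z2a where Z: "adjoint_pair M N Z1 Z1a" "adjoint_pair N N Z2 Z2a"
    "\<And>x. Z1a (Z1 x) = x" "\<And>y. Z2a (Z2 y) = y" "\<And>y. Z1a (Z2 y) = 0" "\<And>x. Z2a (Z1 x) = 0"
    "\<And>y. Z1 (Z1a y) + Z2 (Z2a y) = y"
    using absorb[OF M N CM CN V] by metis
  obtain Y1 Y1a Y2 Y2a where Y: "adjoint_pair N M Y1 Y1a" "adjoint_pair M M Y2 Y2a"
    "\<And>x. Y1a (Y1 x) = x" "\<And>y. Y2a (Y2 y) = y" "\<And>y. Y1a (Y2 y) = 0" "\<And>x. Y2a (Y1 x) = 0"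
    "\<And>y. Y1 (Y1a y) + Y2 (Y2a y) = y"
    using absorb[OF N M CN CM W] by metis
  note lin = adjoint_pair_linear(1)[OF M N Z(1)] adjoint_pair_linear(1)[OF N N Z(2)]
    adjoint_pair_linear(1)[OF N M Y(1)] adjoint_pair_linear(1)[OF M M Y(2)]
    adjoint_pair_linear(1)[OF N M adjoint_pair_sym[OF M N Z(1)]]
    adjoint_pair_linear(1)[OF N N adjoint_pair_sym[OF N N Z(2)]]
    adjoint_pair_linear(1)[OF M N adjoint_pair_sym[OF N M Y(1)]]
    adjoint_pair_linear(1)[OF M M adjoint_pair_sym[OF M M Y(2)]]
  define U where "U x = Z2 (Y1a x) + Z1 (Y2a x)" for x
  define Ua where "Ua y = Y1 (Z2a y) + Y2 (Z1a y)" for y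
  have U: "adjoint_pair M N U Ua"
    unfolding adjoint_pair_def U_def Ua_def
    by (simp add: iprod_linear[OF M] iprod_linear[OF N] adjoint_pairD[OF Z(1)] adjoint_pairD[OF Z(2)]
        adjoint_pairD[OF adjoint_pair_sym[OF N M Y(1)]] adjoint_pairD[OF adjoint_pair_sym[OF M M Y(2)]])
  have UaU: "Ua (U x) = x" for x by (simp add: U_def Ua_def lin Z(3-6) Y(7))
  moreover have "U (Ua y) = y" for y using Z(7)[of y] by (simp add: U_def Ua_def lin Y(3-6) add.commute)
  ultimately have "bij U" by (metis bij_def inj_on_def surj_def)
  moreover have "iprod N (U x) (U y) = iprod M x y" for x y by (simp add: adjoint_pairD[OF U] UaU)
  ultimately show ?thesis by blast
qed

section \<open>Countable generation\<close>

text \<open>Density is extended in one variable at a time; the norm bound makes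
  \<open>\<tau>\<close> continuous in each.\<close>

lemma exterior_dense_of_dense:
  fixes t :: "'a::cstar_algebra \<Rightarrow> 'b::cstar_algebra \<Rightarrow> 't::cstar_algebra"
    and \<tau> :: "'u::cbanach \<Rightarrow> 'v::cbanach \<Rightarrow> 'w::cbanach"
  assumes \<tau>: "cbilinear \<tau>" and bound: "\<And>x y. norm (\<tau> x y) \<le> K * norm x * norm y"
    and D: "closure (cspan D) = UNIV" and D': "closure (cspan D') = UNIV"
    and dense: "closure (tensor_span \<tau>) = UNIV"
  shows "closure (cspan {\<tau> u v | u v. u \<in> D \<and> v \<in> D'}) = UNIV"
proof -
  let ?T = "closure (cspan {\<tau> u v | u v. u \<in> D \<and> v \<in> D'})"
  note [simp] = bilinear_simps[OF \<tau>]
  have lim: "x \<in> ?T" if "\<And>n. X n \<in> ?T" "X \<longlonglongrightarrow> x" for X :: "nat \<Rightarrow> 'w" and x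
    by (rule closed_sequentially[OF closed_closure that])
  have zero: "0 \<in> ?T" by (rule closure_subset[THEN subsetD, OF complex_vector.span_zero])
  have cont: "(\<lambda>n. \<tau> (X n) v) \<longlonglongrightarrow> \<tau> x v" if "X \<longlonglongrightarrow> x" for X :: "nat \<Rightarrow> 'u" and x v
  proof -
    have "bounded_linear (\<lambda>u. \<tau> u v)"
      by (rule bounded_linear_intro[where K="K * norm v"]) (use bound in \<open>auto simp: mult_ac\<close>)
    then show ?thesis using that by (rule bounded_linear.tendsto)
  qed
  have cont': "(\<lambda>n. \<tau> u (Y n)) \<longlonglongrightarrow> \<tau> u y" if "Y \<longlonglongrightarrow> y" for Y :: "nat \<Rightarrow> 'v" and y u
  proof -
    have "bounded_linear (\<tau> u)"
      by (rule bounded_linear_intro[where K="K * norm u"]) (use bound in \<open>auto simp: mult_ac\<close>)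
    then show ?thesis using that by (rule bounded_linear.tendsto)
  qed
  have right: "\<tau> u v \<in> ?T" if u: "u \<in> D" for u v
  proof -
    have "v \<in> closure (cspan D')" using D' by simp
    then show ?thesis
    proof (induction rule: closure_cspan_induct)
      case (3 v) then show ?case
        using u by (intro closure_subset[THEN subsetD] complex_vector.span_base) blast
    next
      case (4 X x) show ?case by (rule lim[OF 4(1) cont'[OF 4(2)]])
    qed (simp_all add: closure_cspan_add closure_cspan_scale zero)
  qed
  have gen: "\<tau> u v \<in> ?T" for u v
  proof -
    have "u \<in> closure (cspan D)" using D by simp
    then show ?thesis
    proof (induction rule: closure_cspan_induct)
      case (4 X x) show ?case by (rule lim[OF 4(1) cont[OF 4(2)]])
    qed (simp_all add: closure_cspan_add closure_cspan_scale zero right)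
  qed
  have "x \<in> ?T" if "x \<in> tensor_span \<tau>" for x
    using that
    by (induction rule: complex_vector.span_induct_alt)
       (auto intro: zero gen closure_cspan_add closure_cspan_scale)
  then have "tensor_span \<tau> \<subseteq> ?T" by blast
  from closure_minimal[OF this closed_closure] show ?thesis unfolding dense by blast
qed

text \<open>Each \<open>e n\<close> is a limit of combinations of inner products, each involving
  finitely many left vectors. Right multiplication by \<open>a\<close> changes only the second
  vectors, so these countably many left vectors also approximate \<open>e n * a\<close>, hence
  \<open>a\<close>.\<close>

lemma full_countable:
  fixes E :: "('e::cbanach, 'a::cstar_algebra) correspondence"
  assumes E: "hilbert_module E" and unit: "sigma_unital TYPE('a)" and full: "full E"
  shows "\<exists>X. countable X \<and> closure (cspan {iprod E x y | x y. x \<in> X}) = UNIV"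
proof -
  obtain e :: "nat \<Rightarrow> 'a" where e: "\<And>a. (\<lambda>n. e n * a) \<longlonglongrightarrow> a"
    using unit unfolding sigma_unital_def by blast
  define C where "C F = cspan {iprod E x y | x y. x \<in> F}" for F
  have "\<exists>F v. finite F \<and> v \<in> C F \<and> norm (v - e n) < inverse (real (Suc k))" for n k
  proof -
    have "e n \<in> closure (cspan {iprod E x y | x y. True})" using full by (simp add: full_def)
    then obtain v where v: "v \<in> cspan {iprod E x y | x y. True}" "dist v (e n) < inverse (real (Suc k))"
      unfolding closure_approachable by (metis inverse_positive_iff_positive of_nat_0_less_iff zero_less_Suc)
    have "\<exists>F. finite F \<and> v \<in> cspan {iprod E x y | x y. x \<in> F}"
      using v(1)
    proof (induction rule: complex_vector.span_induct_alt)
      case base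
      show ?case by (intro exI[of _ "{}"]) (simp add: complex_vector.span_zero)
    next
      case (step c a b)
      obtain x y where a: "a = iprod E x y" using step(1) by blast
      obtain F where F: "finite F" "b \<in> cspan {iprod E x y | x y. x \<in> F}" using step(2) by blast
      have "b \<in> cspan {iprod E x' y | x' y. x' \<in> insert x F}"
        using F(2) by (rule complex_vector.span_mono[THEN subsetD, rotated]) blast
      moreover have "a \<in> cspan {iprod E x' y | x' y. x' \<in> insert x F}"
        unfolding a by (rule complex_vector.span_base) blast
      ultimately show ?case
        using F(1) by (intro exI[of _ "insert x F"]) (simp add: complex_vector.span_add complex_vector.span_scale)
    qed
    then show ?thesis using v(2) unfolding C_def dist_norm by blast
  qed
  then obtain F v where F: "\<And>n k. finite (F n k)" and v: "\<And>n k. v n k \<in> C (F n k)"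
    "\<And>n k. norm (v n k - e n) < inverse (real (Suc k))" by metis
  define X where "X = (\<Union>n k. F n k)"
  let ?T = "cspan {iprod E x y | x y. x \<in> X}"
  have "countable X" unfolding X_def using F by (intro countable_UN countable_finite[of "F _ _"]) simp_all
  moreover have "a \<in> closure ?T" for a
  proof -
    have vT: "v n k * a \<in> ?T" for n k
      using v(1)[of n k, unfolded C_def]
    proof (induction rule: complex_vector.span_induct_alt)
      case base
      show ?case by (simp add: complex_vector.span_zero)
    next
      case (step c w b)
      obtain x y where w: "w = iprod E x y" "x \<in> F n k" using step(1) by blast
      have "w * a = iprod E x (ract E y a)" by (simp add: w iprod_ract[OF E])
      then have "w * a \<in> ?T" using w(2) unfolding X_def by (intro complex_vector.span_base) blast
      then show ?case
        using step(2) by (simp add: distrib_right mult_scaleC_left complex_vector.span_add complex_vector.span_scale)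
    qed
    have "(\<lambda>k. v n k) \<longlonglongrightarrow> e n" for n
    proof -
      have "(\<lambda>k. norm (v n k - e n)) \<longlonglongrightarrow> 0"
        by (rule tendsto_sandwich[OF _ _ tendsto_const LIMSEQ_inverse_real_of_nat])
           (simp, intro always_eventually allI less_imp_le v(2))
      then show ?thesis by (simp add: tendsto_norm_zero_iff LIM_zero_iff)
    qed
    then have lim: "(\<lambda>k. v n k * a) \<longlonglongrightarrow> e n * a" for n by (intro tendsto_mult tendsto_const)
    have "e n * a \<in> closure ?T" for n unfolding closure_sequential
      by (intro exI[of _ "\<lambda>k. v n k * a"] conjI allI vT lim)
    then show "a \<in> closure ?T" by (rule closed_sequentially[OF closed_closure _ e])
  qed
  ultimately show ?thesis by blast
qed

text \<open>The diagonal matrix unit at \<open>n\<close>. These projections add up strongly to 1,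
  which makes them a countable generating set of the compact operators as a right module.\<close>

definition rank_one_unit :: "nat \<Rightarrow> compact_op"
  where "rank_one_unit n = Abs_compact_op (Blinfun (\<lambda>x. coord x n *\<^sub>C ell2_unit n))"

lemma op_of_rank_one_unit: "op_of (rank_one_unit n) x = coord x n *\<^sub>C ell2_unit n"
proof -
  let ?f = "\<lambda>x. coord x n *\<^sub>C ell2_unit n"
  have "norm (ell2_unit n) = 1"
    using norm_ell2_trunc[of "Suc n" "\<lambda>m. if m = n then 1 else 0"]
    by (simp add: ell2_trunc_def L2_set_def scaleC_one complex_vector.scale_zero_left if_distrib
        if_distribR cong: if_cong)
  then have bl: "bounded_linear ?f"
    by (intro bounded_linear_intro[where K=1])
       (auto simp: coord_add scaleC_add_left scaleR_scaleC scaleC_ell2.rep_eq scaleC_scaleC norm_scaleC ell2_coord_le)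
  have "compact (closure (?f ` cball 0 1))"
  proof (rule compact_closure_subset)
    have "compact ((\<lambda>z. z *\<^sub>C ell2_unit n) ` cball (0 :: complex) 1)"
    proof (rule compact_continuous_image)
      have "bounded_linear (\<lambda>z. z *\<^sub>C ell2_unit n)"
        by (rule bounded_linear_intro[where K="norm (ell2_unit n)"])
           (simp_all add: scaleC_add_left norm_scaleC scaleR_scaleC scaleC_scaleC scaleR_conv_of_real)
      then show "continuous_on (cball 0 1) (\<lambda>z. z *\<^sub>C ell2_unit n)" by (rule linear_continuous_on)
    qed simp
    then show "compact (closure ((\<lambda>z. z *\<^sub>C ell2_unit n) ` cball (0 :: complex) 1))"
      by (simp add: closure_closed compact_imp_closed)
    show "?f ` cball 0 1 \<subseteq> (\<lambda>z. z *\<^sub>C ell2_unit n) ` cball (0 :: complex) 1"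
      using ell2_coord_le order_trans by fastforce
  qed
  then have "compact_operator (Blinfun ?f)"
    unfolding compact_operator_def clinear_iff
    by (simp add: bounded_linear_Blinfun_apply[OF bl] coord_add scaleC_add_left scaleC_ell2.rep_eq scaleC_scaleC)
  then show ?thesis
    by (simp add: rank_one_unit_def Abs_compact_op_inverse bounded_linear_Blinfun_apply[OF bl])
qed

lemma star_rank_one_unit: "star (rank_one_unit n) = rank_one_unit n"
proof (rule op_of_inject[THEN iffD1])
  have "cinner_ell2 x (ell2_unit n) = cnj (coord x n)" for x
    using cinner_ell2_commute[of x "ell2_unit n"] by (simp add: cinner_ell2_unit)
  then show "op_of (star (rank_one_unit n)) = op_of (rank_one_unit n)"
    unfolding star_compact_op.rep_eq
    by (intro ell2_adj_eqI)
       (simp add: op_of_rank_one_unit cinner_ell2_scaleC_left cinner_ell2_scaleC_right cinner_ell2_unit)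
qed

text \<open>Truncation tends strongly to the identity; composing with the compact \<open>k\<close>
  turns this into norm convergence.\<close>

lemma rank_one_units_dense: "closure (cspan {rank_one_unit n * k | n k. True}) = UNIV"
proof -
  have "k \<in> closure (cspan {rank_one_unit n * k | n k. True})" for k
  proof -
    have "(\<lambda>N. (\<Sum>n<N. rank_one_unit n * k) - k) \<longlonglongrightarrow> 0"
    proof (rule compact_op_tendsto_zero[of "\<lambda>N x. ell2_trunc N (coord x) - x"])
      have c: "coord (ell2_trunc N (coord x) - x) m = (if m < N then 0 else - coord x m)" for N x m
        by (simp add: coord_diff coord_ell2_trunc)
      show "ell2_trunc N (coord (x - y)) - (x - y) = ell2_trunc N (coord x) - x - (ell2_trunc N (coord y) - y)" for N x y
        by (rule ell2_eqI) (simp add: coord_diff coord_ell2_trunc)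
      show "norm (ell2_trunc N (coord x) - x) \<le> norm x" for N x
        by (rule ell2_norm_mono) (simp add: c)
      show "(\<lambda>N. ell2_trunc N (coord x) - x) \<longlonglongrightarrow> 0" for x
        using ell2_trunc_tendsto by (simp add: LIM_zero_iff)
      show "op_of ((\<Sum>n<N. rank_one_unit n * k) - k) x =
          ell2_trunc N (coord (op_of k x)) - op_of k x" for N x
        by (simp add: minus_compact_op.rep_eq blinfun.diff_left op_of_sum times_compact_op.rep_eq
            op_of_rank_one_unit ell2_trunc_def)
    qed
    then have "(\<lambda>N. \<Sum>n<N. rank_one_unit n * k) \<longlonglongrightarrow> k" by (simp add: LIM_zero_iff)
    then show ?thesis
      unfolding closure_sequential
      by (intro exI[of _ "\<lambda>N. \<Sum>n<N. rank_one_unit n * k"] conjI allI complex_vector.span_sum complex_vector.span_base) auto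
  qed
  then show ?thesis by blast
qed

section \<open>Transport of the left action\<close>

text \<open>Conjugating the left action by \<open>U\<close> gives maps \<open>L b\<close> on the
  algebra with adjoint \<open>L (star b)\<close>. Having an adjoint makes them commute with right
  multiplication, so they are left multipliers; boundedness comes from
  \<open>norm_lact_le\<close>.\<close>

lemma isomorphic_multiplier_correspondence:
  fixes G :: "('g::cbanach, 'b::cstar_algebra) correspondence"
  assumes mono: "norm_monotone TYPE('b)" and G: "cstar_correspondence G"
    and U: "bij U" "\<And>x y. star (U x) * U y = iprod G x y"
  shows "\<exists>\<rho> :: 'b \<Rightarrow> 'b multiplier. star_hom \<rho> \<and> isomorphic G (multiplier_correspondence \<rho>)"
proof -
  have M: "hilbert_module G" using G by (simp add: cstar_correspondence_def)
  note S = hilbert_module_standard[where ?'a='b]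
  note linU = preserving_linear[OF M S, of U, simplified, OF U(2)]
  define W where "W = inv U"
  have UW: "U (W y) = y" and WU: "W (U x) = x" for x y
    using U(1) by (simp_all add: W_def bij_is_surj surj_f_inv_f bij_is_inj)
  have W: "iprod G (W x) (W y) = star x * y" for x y by (simp add: U(2)[symmetric] UW)
  note linW = preserving_linear[OF S M, of W, simplified, OF W]
  have lact: "lact G (a + b) x = lact G a x + lact G b x" "lact G (c *\<^sub>C a) x = c *\<^sub>C lact G a x"
    "lact G (a * b) x = lact G a (lact G b x)" "iprod G (lact G a x) y = iprod G x (lact G (star a) y)"
    for a b c x y using G by (auto simp: cstar_correspondence_def)
  have adj: "adjoint_pair G G (lact G a) (lact G (star a))" for a by (simp add: adjoint_pair_def lact)
  note linlact = adjoint_pair_linear[OF M M adj]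
  define L where "L b x = U (lact G b (W x))" for b x
  \<comment> \<open>The right half is forced: right multiplication by a multiplier is left
    multiplication by its adjoint between two stars.\<close>
  define R where "R b x = star (L (star b) (star x))" for b x
  have adjL: "star (L b x) * y = star x * L (star b) y" for b x y
    by (simp add: L_def U(2)[of "lact G b (W x)" "W y", simplified UW] lact(4)
        U(2)[of "W x" "lact G (star b) (W y)", simplified UW])
  have adjL': "star z * L b w = star (L (star b) z) * w" for b z w
    using adjL[of "star b" z w] by (simp add: star_star)
  have L_lin: "L b (x + y) = L b x + L b y" "L b (c *\<^sub>C x) = c *\<^sub>C L b x" for b c x y
    by (simp_all add: L_def linW linU linlact)
  have eqI: "x = y" if "\<And>z. star z * x = star z * y" for x y :: 'b
    using iprod_eqI[OF S, of x y] that by simp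
  have L_mult: "L b (x * y) = L b x * y" for b x y
    by (rule eqI) (simp add: adjL' mult.assoc[symmetric])
  have bl: "bounded_linear (L b)" for b
    by (rule bounded_linear_intro[where K="2 * norm b"])
       (use norm_lact_le[OF mono G, of b "W _"] in \<open>simp_all add: L_lin scaleR_scaleC L_def[of b] linU linW mult_ac\<close>)
  have "double_centralizer (L b) (R b)" for b
  proof -
    have "bounded_linear (R b)"
      unfolding R_def
      by (intro bounded_linear_compose[OF bounded_linear_star] bounded_linear_compose[OF bl bounded_linear_star])
    moreover have "clinear (L b)" "clinear (R b)"
      by (simp_all add: clinear_iff R_def L_lin star_add star_scaleC)
    moreover have "R b (x * y) = x * R b y" for x y
      by (simp add: R_def star_mult L_mult star_star)
    moreover have "R b x * y = x * L b y" for x y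
      unfolding R_def using adjL[of "star b" "star x" y] by (simp add: star_star)
    ultimately show ?thesis unfolding double_centralizer_def by (simp add: bl L_mult)
  qed
  then have cent: "centralizer (Abs_multiplier (L b, R b)) = (L b, R b)" for b
    by (intro Abs_multiplier_inverse) simp
  define \<rho> where "\<rho> b = Abs_multiplier (L b, R b)" for b
  have left: "left_mult (\<rho> b) x = L b x" and right: "right_mult (\<rho> b) x = R b x" for b x
    by (simp_all add: \<rho>_def left_mult.rep_eq right_mult.rep_eq cent)
  have "star_hom \<rho>"
    unfolding star_hom_def clinear_iff
    by (intro conjI allI; rule multiplier_eqI)
       (simp_all add: left_right_mult left right R_def L_def star_add star_scaleC star_mult star_star
          lact linU UW WU)
  moreover have "correspondence_iso G (multiplier_correspondence \<rho>) U"
    unfolding correspondence_iso_def multiplier_correspondence_def clinear_iff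
    by (simp add: U linU left L_def WU)
  ultimately show ?thesis unfolding isomorphic_def by blast
qed

section \<open>Isometries in both directions and the isomorphism\<close>

theorem proposition2p1:
  fixes E :: "('e::cbanach, 'a::cstar_algebra) correspondence"
    and tens :: "'a \<Rightarrow> compact_op \<Rightarrow> 't::cstar_algebra"
    and EK :: "('g::cbanach, 't) correspondence"
    and \<tau> :: "'e \<Rightarrow> compact_op \<Rightarrow> 'g"
  assumes "sigma_unital TYPE('a)"
    and "cstar_correspondence E"
    and "faithful E"
    and "nondegenerate E"
    and "full E"
    and "countably_generated E"
    and "minimal_tensor_product tens"
    and "exterior_tensor_product tens E (standard_correspondence :: (compact_op, compact_op) correspondence) EK \<tau>"
  shows "\<exists>\<rho> :: 't \<Rightarrow> 't multiplier. star_hom \<rho> \<and> isomorphic EK (multiplier_correspondence \<rho>)"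
proof -
  let ?K = "standard_correspondence :: (compact_op, compact_op) correspondence"
  let ?A = "standard_correspondence :: ('a, 'a) correspondence"
  let ?T = "standard_correspondence :: ('t, 't) correspondence"
  note t = assms(7) and G = assms(8)
  have E: "hilbert_module E" using assms(2) by (simp add: cstar_correspondence_def)
  note K = hilbert_module_standard[where ?'a=compact_op] and A = hilbert_module_standard[where ?'a='a]
    and T = hilbert_module_standard[where ?'a='t] and M = exterior_hilbert[OF G]
  obtain L La where L: "cuntz_family ?K L La" using cuntz_family_compact by blast
  \<comment> \<open>\<open>L 0\<close> and \<open>L 1\<close> are the two isometries with orthogonal
    ranges behind monotonicity.\<close>
  have mono: "norm_monotone TYPE('t)"
    by (rule norm_monotone_tensor[OF t, of "L 0" "L 1"]) (use cuntz_iprod[OF L K] in simp_all)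
  obtain S Sa where S: "cuntz_family EK S Sa"
    using cuntz_family_exterior[OF mono t E K G L] by blast
  obtain R Ra where R: "cuntz_family ?T R Ra"
    using cuntz_family_exterior[OF mono t A K exterior_tensor_standard[OF t] L] by blast
  \<comment> \<open>Each vector \<open>g\<close> gives a map from the algebra to the module, whose
    adjoint pairs with \<open>g\<close>. These maps are the input to \<open>isometry_exists\<close>
    in both directions.\<close>
  have bd_g: "adjoint_pair ?T EK (ract EK g) (iprod EK g)" for g
  proof -
    have "iprod EK (ract EK g x) y = star x * iprod EK g y" for x y
      by (metis iprod_star[OF M] iprod_ract[OF M] star_mult)
    then show ?thesis by (simp add: adjoint_pair_def)
  qed
  have norm_ract: "norm (ract EK g x) \<le> 4 * norm g * norm x" for g x
  proof (rule power2_le_imp_le)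
    have "(norm (ract EK g x))\<^sup>2 = norm (star x * (iprod EK g g * x))"
      using adjoint_pairD[OF bd_g, of g x "ract EK g x"] by (simp add: norm_iprod_self[OF M, symmetric] iprod_ract[OF M])
    also have "\<dots> \<le> norm x * (norm (iprod EK g g) * norm x)"
      by (rule order_trans[OF norm_mult_ineq]) (simp add: norm_star norm_mult_ineq mult_left_mono)
    also have "\<dots> = (norm g * norm x)\<^sup>2" by (simp add: norm_iprod_self[OF M] power2_eq_square)
    \<comment> \<open>The constant is raised to that of \<open>norm_iprod_le\<close>, so that one
      \<open>K\<close> bounds the map and its adjoint.\<close>
    also have "\<dots> \<le> (4 * norm g * norm x)\<^sup>2" by (intro power_mono) (simp_all add: mult_right_mono)
    finally show "(norm (ract EK g x))\<^sup>2 \<le> (4 * norm g * norm x)\<^sup>2" .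
  qed simp
  note norm_tau = norm_exterior_le[OF mono t E K G]

  obtain X where X: "countable X" "closure (cspan {iprod E x y | x y. x \<in> X}) = UNIV"
    using full_countable[OF E assms(1,5)] by blast
  obtain Y where Y: "countable Y" "closure (cspan {ract E x a | x a. x \<in> Y}) = UNIV"
    using assms(6) unfolding countably_generated_def by blast
  \<comment> \<open>One sequence serves both directions: \<open>X\<close> comes from fullness and
    \<open>Y\<close> from countable generation. The added 0 makes the set nonempty, so that it can
    be enumerated.\<close>
  obtain g :: "nat \<Rightarrow> 'g" where g: "range g = insert 0 {\<tau> x (rank_one_unit n) | x n. x \<in> X \<union> Y}"
  proof -
    have "{\<tau> x (rank_one_unit n) | x n. x \<in> X \<union> Y} = (\<lambda>(x, n). \<tau> x (rank_one_unit n)) ` ((X \<union> Y) \<times> UNIV)"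
      by auto
    then have "countable (insert 0 {\<tau> x (rank_one_unit n) | x n. x \<in> X \<union> Y})"
      using X(1) Y(1) by simp
    then show thesis using that[of "from_nat_into (insert 0 {\<tau> x (rank_one_unit n) | x n. x \<in> X \<union> Y})"]
      by (simp add: range_from_nat_into)
  qed
  have in_g: "\<exists>m. g m = \<tau> x (rank_one_unit n)" if "x \<in> X \<union> Y" for x n
  proof -
    have "\<tau> x (rank_one_unit n) \<in> range g" unfolding g using that by blast
    then show ?thesis by (metis rangeE)
  qed

  have "closure (cspan {tens u v | u v. u \<in> {iprod E x y | x y. x \<in> X} \<and> v \<in> {rank_one_unit n * k | n k. True}}) = UNIV"
    by (rule exterior_dense_of_dense[OF tensor_cbilinear[OF t] norm_tensor_le[OF mono t] X(2)
          rank_one_units_dense tensor_dense[OF t]])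
  moreover have "{tens u v | u v. u \<in> {iprod E x y | x y. x \<in> X} \<and> v \<in> {rank_one_unit n * k | n k. True}}
      \<subseteq> {iprod EK (g m) y | m y. True}"
  proof -
    have "\<exists>m z. tens (iprod E x y) (rank_one_unit n * k) = iprod EK (g m) z" if "x \<in> X" for x y n k
    proof -
      obtain m where "g m = \<tau> x (rank_one_unit n)" using in_g \<open>x \<in> X\<close> by blast
      then have "iprod EK (g m) (\<tau> y k) = tens (iprod E x y) (rank_one_unit n * k)"
        by (simp add: exterior_iprod[OF G] star_rank_one_unit)
      then show ?thesis by metis
    qed
    then show ?thesis by blast
  qed
  ultimately have dense_T: "closure (cspan {iprod EK (g m) y | m y. True}) = UNIV"
    by (rule closure_cspan_superset)

  have "closure (cspan {\<tau> u v | u v. u \<in> {ract E x a | x a. x \<in> Y} \<and> v \<in> {rank_one_unit n * k | n k. True}}) = UNIV"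
    by (rule exterior_dense_of_dense[OF exterior_cbilinear[OF G] norm_tau Y(2)
          rank_one_units_dense exterior_dense[OF G]])
  moreover have "{\<tau> u v | u v. u \<in> {ract E x a | x a. x \<in> Y} \<and> v \<in> {rank_one_unit n * k | n k. True}}
      \<subseteq> {ract EK (g m) b | m b. True}"
  proof -
    have "\<exists>m b. \<tau> (ract E x a) (rank_one_unit n * k) = ract EK (g m) b" if "x \<in> Y" for x a n k
    proof -
      obtain m where "g m = \<tau> x (rank_one_unit n)" using in_g \<open>x \<in> Y\<close> by blast
      then have "ract EK (g m) (tens a k) = \<tau> (ract E x a) (rank_one_unit n * k)"
        by (simp add: exterior_ract[OF G])
      then show ?thesis by metis
    qed
    then show ?thesis by blast
  qed
  ultimately have dense_M: "closure (cspan {ract EK (g m) b | m b. True}) = UNIV"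
    by (rule closure_cspan_superset)

  \<comment> \<open>Here the maps are \<open>iprod EK (g m)\<close> and their adjoints
    \<open>ract EK (g m)\<close> have jointly dense range by \<open>dense_M\<close>; for
    \<open>W\<close> the roles are exchanged and \<open>dense_T\<close> is used.\<close>
  have "\<exists>V Va. adjoint_pair EK ?T V Va \<and> (\<forall>x. Va (V x) = x)"
    by (rule isometry_exists[OF mono M T R _ _ _ dense_M, where \<xi>="\<lambda>m. iprod EK (g m)" and K="\<lambda>m. 4 * norm (g m)"])
       (simp_all only: adjoint_pair_sym[OF T M bd_g] norm_iprod_le[OF M] norm_ract)
  then obtain V Va where V: "adjoint_pair EK ?T V Va" "\<And>x. Va (V x) = x" by blast
  have "\<exists>W Wa. adjoint_pair ?T EK W Wa \<and> (\<forall>x. Wa (W x) = x)"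
    by (rule isometry_exists[OF mono T M S _ _ _ dense_T, where \<xi>="\<lambda>m. ract EK (g m)" and K="\<lambda>m. 4 * norm (g m)"])
       (simp_all only: bd_g norm_iprod_le[OF M] norm_ract)
  then obtain W Wa where W: "adjoint_pair ?T EK W Wa" "\<And>x. Wa (W x) = x" by blast
  obtain U where U: "bij U" "\<And>x y. star (U x) * U y = iprod EK x y"
    using swindle[OF M T S R V W] by auto
  show ?thesis by (rule isomorphic_multiplier_correspondence[OF mono exterior_correspondence[OF G] U])
qed

end
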